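(* Let $p$ be a $(0,1)$-valued random variable such that, with $\rho:=(1-p)/p$, there exists a unique $\kappa\in(1/2,1)$ with $E[\rho^\kappa]=1$ and $E[\rho^\kappa\ln^+\rho]<\infty$. Let $\{p_i:i\in\mathbb Z\}$ be i.i.d. copies of $p$ and consider the random environment on $\mathbb Z^2$ given, for all $(i,j)\in\mathbb Z^2$, by $$\omega((i,j),e_2)=\omega((i,j),-e_2)=\tfrac14,\qquad \omega((i,j),e_1)=\tfrac{p_i}{2},\qquad \omega((i,j),-e_1)=\tfrac12-\tfrac{p_i}2 .$$ Let $Q_1$ be the annealed law of the corresponding random walk $(X_n)_{n\ge 0}$ started from $0$. Then: (i) $Q_1$-a.s. $\lim_{n\to\infty}X_n\cdot e_1=\infty$. (ii) $Q_1$-a.s. $\lim_{n\to\infty}\frac{X_n}{n}=0$. (iii) $\lim_{n\to\infty}\frac{X_n}{|X_n|_2}=e_1$ in $Q_1$-probability. (iv) For every $\varepsilon\in(0,\kappa-\frac12)$, the law $Q_1$ satisfies the polynomial condition $(PC)_{M,c}|e_1$ with $M=\kappa-\frac12-\varepsilon$ and $c=1$.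
   Context: For an environment $\omega=\{\omega(x,e):x\in\mathbb Z^2,\ e\in\{\pm e_1,\pm e_2\}\}$ of nearest-neighbour transition probabilities, $P_{0,\omega}$ is the law of the Markov chain started at $0$ with $P_{0,\omega}[X_{n+1}=X_n+e\mid X_n]=\omega(X_n,e)$; the annealed law is the average of $P_{0,\omega}$ over the law of the environment. Definition of $(PC)_{M,c}|l$ for $l=e_1$, $d=2$ (here with real $M>0$): for $A\subset\mathbb Z^2$ let $T_A:=\inf\{n\ge0:X_n\notin A\}$ and $\partial A:=\{z\in\mathbb Z^2\setminus A:\exists y\in A,|y-z|_1=1\}$; let $B_L:=\big((-L,L)\times(-cL,cL)\big)\cap\mathbb Z^2$, $\partial^+B_L:=\partial B_L\cap\{z:z\cdot e_1\ge L\}$. For $y\in\mathbb Z^2$ let $H_y:=\{z\in\mathbb Z^2:z\cdot e_1<y\cdot e_1\}$, $\mathcal H_y:=\sigma(\omega(z):z\in H_y)$ and $\tau_{H_y}:=\inf\{n\ge0:X_n\in H_y\}$. Then $(PC)_{M,c}|e_1$ means $$\limsup_{L\to\infty}L^M\sup Q_1\left[X_{T_{B_L}}\notin\partial^+B_L,\ T_{B_L}<\tau_{H_y}\,\middle|\,\mathcal H_y\right]=0,$$ where the supremum is over $y$ with $y\cdot e_1<0$ and (as an essential supremum) over the environment configuration on which one conditions. *)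

theory Defs
  imports "HOL-Probability.Probability"
begin

type_synonym site = "int \<times> int"

datatype dir = PosE1 | NegE1 | PosE2 | NegE2

lemma UNIV_dir: "(UNIV :: dir set) = {PosE1, NegE1, PosE2, NegE2}"
  by (auto intro: dir.exhaust)

instance dir :: finite
  by standard (simp add: UNIV_dir)

fun dir_vec :: "dir \<Rightarrow> site" where
  "dir_vec PosE1 = (1, 0)"
| "dir_vec NegE1 = (-1, 0)"
| "dir_vec PosE2 = (0, 1)"
| "dir_vec NegE2 = (0, -1)"

text \<open>\<open>\<omega> x d\<close> stands for \<open>\<omega>(x,e)\<close> with \<open>e = dir_vec d\<close>.\<close>

type_synonym env = "site \<Rightarrow> dir \<Rightarrow> real"
type_synonym path = "nat \<Rightarrow> site"

definition env_space :: "env measure" where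
  "env_space = PiM UNIV (\<lambda>_. PiM UNIV (\<lambda>_. borel))"

definition path_space :: "path measure" where
  "path_space = PiM UNIV (\<lambda>_. count_space UNIV)"

definition is_prob_vector :: "(dir \<Rightarrow> real) \<Rightarrow> bool" where
  "is_prob_vector w \<longleftrightarrow> (\<forall>d. 0 \<le> w d) \<and> (\<Sum>d\<in>UNIV. w d) = 1"

text \<open>
  The second branch makes the chain total. For the environments of interest the weights
  form a probability vector at every site almost surely, so it is never used.
\<close>

definition dir_pmf :: "(dir \<Rightarrow> real) \<Rightarrow> dir pmf" where
  "dir_pmf w = (if is_prob_vector w then embed_pmf w else return_pmf PosE1)"

definition step_pmf :: "env \<Rightarrow> site \<Rightarrow> site pmf" where
  "step_pmf \<omega> x = map_pmf (\<lambda>d. x + dir_vec d) (dir_pmf (\<omega> x))"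

text \<open>The law of \<open>X\<^sub>n\<close> given the history \<open>h = (X\<^sub>0, \<dots>, X\<^sub>n\<^sub>-\<^sub>1)\<close>.\<close>

definition walk_kernel :: "env \<Rightarrow> nat \<Rightarrow> path \<Rightarrow> site measure" where
  "walk_kernel \<omega> n h = measure_pmf (case n of 0 \<Rightarrow> return_pmf 0 | Suc k \<Rightarrow> step_pmf \<omega> (h k))"

text \<open>
  The quenched law \<open>P\<^bsub>0,\<omega>\<^esub>\<close>, as the Ionescu-Tulcea measure of these kernels; see
  \<open>emeasure_quenched_cylinder\<close> for its finite-dimensional distributions.
\<close>

definition quenched_law :: "env \<Rightarrow> path measure" where
  "quenched_law \<omega> =
     projective_family.lim UNIV (Ionescu_Tulcea.CI (walk_kernel \<omega>) (\<lambda>_. count_space UNIV))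
       (\<lambda>_. count_space UNIV)"

text \<open>
  The annealed law for the environment law \<open>E\<close>, as a joint law of environment and path:
  the polynomial condition below conditions on part of the environment.
\<close>

definition annealed_law :: "env measure \<Rightarrow> (env \<times> path) measure" where
  "annealed_law E = E \<bind> (\<lambda>\<omega>. distr (quenched_law \<omega>) (env_space \<Otimes>\<^sub>M path_space) (Pair \<omega>))"

definition exit_time :: "site set \<Rightarrow> path \<Rightarrow> enat" where
  "exit_time A X = (INF n\<in>{n. X n \<notin> A}. enat n)"

definition hit_time :: "site set \<Rightarrow> path \<Rightarrow> enat" where
  "hit_time A X = (INF n\<in>{n. X n \<in> A}. enat n)"

definition outer_boundary :: "site set \<Rightarrow> site set" where
  "outer_boundary A = {z. z \<notin> A \<and> (\<exists>y\<in>A. \<bar>fst y - fst z\<bar> + \<bar>snd y - snd z\<bar> = 1)}"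

definition box :: "real \<Rightarrow> real \<Rightarrow> site set" where
  "box c L = {z. real_of_int (fst z) \<in> {-L<..<L} \<and> real_of_int (snd z) \<in> {-(c * L)<..<c * L}}"

definition right_boundary :: "real \<Rightarrow> real \<Rightarrow> site set" where
  "right_boundary c L = outer_boundary (box c L) \<inter> {z. real_of_int (fst z) \<ge> L}"

definition left_halfplane :: "site \<Rightarrow> site set" where
  "left_halfplane y = {z. fst z < fst y}"

text \<open>Only the space and the measurable sets of this measure matter; they form \<open>\<sigma>(\<omega>(z) : z \<in> H\<^sub>y)\<close>.\<close>

definition halfplane_algebra :: "site \<Rightarrow> (env \<times> path) measure" where
  "halfplane_algebra y =
     vimage_algebra (space (env_space \<Otimes>\<^sub>M path_space))
       (\<lambda>(\<omega>, X). restrict \<omega> (left_halfplane y))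
       (PiM (left_halfplane y) (\<lambda>_. PiM UNIV (\<lambda>_. borel)))"

text \<open>On this event the exit time is finite, so \<open>the_enat\<close> is only applied to finite values.\<close>

definition bad_exit_event :: "real \<Rightarrow> real \<Rightarrow> site \<Rightarrow> (env \<times> path) set" where
  "bad_exit_event c L y =
     {(\<omega>, X). exit_time (box c L) X < hit_time (left_halfplane y) X \<and>
              X (the_enat (exit_time (box c L) X)) \<notin> right_boundary c L}"

definition polynomial_condition :: "(env \<times> path) measure \<Rightarrow> real \<Rightarrow> real \<Rightarrow> bool" where
  "polynomial_condition Q M c \<longleftrightarrow>
     Limsup at_top (\<lambda>L::real. ereal (L powr M) *
       (SUP y\<in>{y. fst y < 0}. esssup Q (\<lambda>w. ereal
          (real_cond_exp Q (halfplane_algebra y) (indicator (bad_exit_event c L y)) w)))) = 0"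

fun layered_env :: "(int \<Rightarrow> real) \<Rightarrow> env" where
  "layered_env q (i, j) PosE1 = q i / 2"
| "layered_env q (i, j) NegE1 = 1 / 2 - q i / 2"
| "layered_env q (i, j) PosE2 = 1 / 4"
| "layered_env q (i, j) NegE2 = 1 / 4"

text \<open>The norm on \<open>real \<times> real\<close> is the Euclidean one.\<close>

definition to_plane :: "site \<Rightarrow> real \<times> real" where
  "to_plane z = (real_of_int (fst z), real_of_int (snd z))"

lemma pmf_dir_pmf: "is_prob_vector w \<Longrightarrow> pmf (dir_pmf w) d = w d"
  unfolding dir_pmf_def is_prob_vector_def
  by (auto intro!: pmf_embed_pmf simp: nn_integral_count_space_finite)

lemma is_prob_vector_layered_env:
  "0 \<le> q (fst z) \<Longrightarrow> q (fst z) \<le> 1 \<Longrightarrow> is_prob_vector (layered_env q z)"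
proof -
  assume "0 \<le> q (fst z)" "q (fst z) \<le> 1"
  then have "0 \<le> layered_env q z d" for d
    by (cases z; cases d) auto
  then show ?thesis
    by (cases z) (simp add: is_prob_vector_def UNIV_dir)
qed

interpretation walk: Ionescu_Tulcea "walk_kernel \<omega>" "\<lambda>_. count_space UNIV" for \<omega>
proof (rule Ionescu_Tulcea.intro)
  show "walk_kernel \<omega> i \<in> PiM {0..<i} (\<lambda>_. count_space UNIV) \<rightarrow>\<^sub>M subprob_algebra (count_space UNIV)" for i
  proof (cases i)
    case 0
    then show ?thesis
      by (auto simp: walk_kernel_def[abs_def] intro!: measurable_const measure_pmf_in_subprob_algebra)
  next
    case (Suc k)
    have "(\<lambda>h. h k) \<in> PiM {0..<i} (\<lambda>_. count_space UNIV) \<rightarrow>\<^sub>M count_space (UNIV :: site set)"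
      using Suc by (intro measurable_component_singleton) auto
    then have "(\<lambda>h. measure_pmf (step_pmf \<omega> (h k)))
        \<in> PiM {0..<i} (\<lambda>_. count_space UNIV) \<rightarrow>\<^sub>M subprob_algebra (count_space UNIV)"
      by (rule measurable_compose) (auto intro: measure_pmf_in_subprob_algebra)
    then show ?thesis
      using Suc by (simp add: walk_kernel_def[abs_def])
  qed
  show "prob_space (walk_kernel \<omega> i x)" if "x \<in> space (PiM {0..<i} (\<lambda>_. count_space UNIV))" for i x
    by (simp add: walk_kernel_def prob_space_measure_pmf)
qed

lemma quenched_law_eq: "quenched_law \<omega> = walk.PF.lim \<omega>"
  by (simp add: quenched_law_def)

lemma sets_quenched_law [measurable_cong, simp]: "sets (quenched_law \<omega>) = sets path_space"
  unfolding quenched_law_eq path_space_def by (rule walk.PF.sets_lim)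

lemma space_path_space [simp]: "space path_space = UNIV"
  by (simp add: path_space_def space_PiM)

lemma space_env_space [simp]: "space env_space = UNIV"
  by (simp add: env_space_def space_PiM)

lemma space_quenched_law [simp]: "space (quenched_law \<omega>) = UNIV"
  using sets_eq_imp_space_eq[OF sets_quenched_law] by simp

lemma PiE_singleton_restrict: "PiE A (\<lambda>k. {x k}) = {restrict x A}"
  by (auto simp: PiE_iff fun_eq_iff extensional_def)

lemma emeasure_walk_C:
  "emeasure (walk.C \<omega> 0 n (\<lambda>_. undefined)) {restrict x {0..<n}} =
     (\<Prod>k<n. ennreal (pmf (case k of 0 \<Rightarrow> return_pmf 0 | Suc j \<Rightarrow> step_pmf \<omega> (x j)) (x k)))"
proof (induction n)
  case 0
  then show ?case by (simp add: space_PiM PiM_empty)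
next
  case (Suc n)
  let ?M = "\<lambda>n. PiM {0..<n} (\<lambda>_. count_space (UNIV::site set))"
  let ?r = "\<lambda>n. restrict x {0..<n}"
  have meas: "{?r n} \<in> sets (?M n)" for n
  proof -
    have "{?r n} = PiE {0..<n} (\<lambda>k. {x k})"
      by (simp add: PiE_singleton_restrict)
    then show ?thesis by (simp add: sets_PiM_I_finite)
  qed
  have "emeasure (walk.C \<omega> 0 (Suc n) (\<lambda>_. undefined)) {?r (Suc n)}
      = (\<integral>\<^sup>+h. emeasure (walk.eP \<omega> n h) {?r (Suc n)} \<partial>walk.C \<omega> 0 n (\<lambda>_. undefined))"
    by (simp, rule emeasure_bind[where N = "?M (Suc n)"])
       (use walk.measurable_eP[of \<omega> n] meas[of "Suc n"] in
         \<open>auto simp: walk.space_C measurable_cong_sets[OF walk.sets_C] space_PiM\<close>)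
  also have "\<dots> = (\<integral>\<^sup>+h. emeasure (walk_kernel \<omega> n (?r n)) {x n} * indicator {?r n} h
                     \<partial>walk.C \<omega> 0 n (\<lambda>_. undefined))"
  proof (rule nn_integral_cong)
    fix h assume "h \<in> space (walk.C \<omega> 0 n (\<lambda>_. undefined))"
    then have h: "h \<in> space (?M n)" by (simp add: walk.space_C space_PiM)
    then have ext: "h \<in> extensional {0..<n}" by (simp add: space_PiM PiE_def)
    have eq: "fun_upd h n -` {?r (Suc n)} \<inter> UNIV = (if h = ?r n then {x n} else {})"
    proof -
      have "(h(n := a) = ?r (Suc n)) \<longleftrightarrow> h = ?r n \<and> a = x n" for a
      proof
        assume *: "h(n := a) = ?r (Suc n)"
        have "h k = ?r n k" for k
          using fun_cong[OF *, of k] ext by (cases "k < n") (auto simp: extensional_def split: if_splits)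
        moreover have "a = x n" using fun_cong[OF *, of n] by simp
        ultimately show "h = ?r n \<and> a = x n" by auto
      qed (auto simp: fun_eq_iff)
      then show ?thesis by auto
    qed
    have "emeasure (walk.eP \<omega> n h) {?r (Suc n)}
        = emeasure (walk_kernel \<omega> n h) (fun_upd h n -` {?r (Suc n)} \<inter> UNIV)"
      unfolding walk.eP_def
      by (subst emeasure_distr)
         (use h meas[of "Suc n"] walk.space_P[OF h, of \<omega>] walk.sets_P[OF h, of \<omega>] in
           \<open>auto simp: walk_kernel_def space_PiM PiE_def extensional_def measurable_def intro!: sets_PiM_I_finite\<close>)
    also have "\<dots> = emeasure (walk_kernel \<omega> n (?r n)) {x n} * indicator {?r n} h"
      unfolding eq by auto
    finally show "emeasure (walk.eP \<omega> n h) {?r (Suc n)}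
        = emeasure (walk_kernel \<omega> n (?r n)) {x n} * indicator {?r n} h" .
  qed
  also have "\<dots> = emeasure (walk_kernel \<omega> n (?r n)) {x n} *
                   emeasure (walk.C \<omega> 0 n (\<lambda>_. undefined)) {?r n}"
    using meas[of n] walk.sets_C[of "\<lambda>_. undefined" 0 \<omega> n]
    by (intro nn_integral_cmult_indicator) (simp add: space_PiM)
  also have "emeasure (walk_kernel \<omega> n (?r n)) {x n} =
     ennreal (pmf (case n of 0 \<Rightarrow> return_pmf 0 | Suc j \<Rightarrow> step_pmf \<omega> (x j)) (x n))"
    by (cases n) (simp_all add: walk_kernel_def emeasure_pmf_single)
  finally show ?case
    using Suc.IH by (simp add: mult.commute)
qed

theorem emeasure_quenched_cylinder:
  "emeasure (quenched_law \<omega>) {X. \<forall>k\<le>n. X k = x k} =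
     ennreal (of_bool (x 0 = 0) * (\<Prod>k<n. pmf (step_pmf \<omega> (x k)) (x (Suc k))))"
proof -
  let ?N = "Suc n"
  let ?A = "{restrict x {0..<?N}}"
  have A: "?A \<in> sets (PiM {0..<?N} (\<lambda>_. count_space (UNIV::site set)))"
  proof -
    have "?A = PiE {0..<?N} (\<lambda>k. {x k})" by (simp add: PiE_singleton_restrict)
    then show ?thesis by (simp add: sets_PiM_I_finite)
  qed
  have cyl: "{X. \<forall>k\<le>n. X k = x k} = walk.PF.emb UNIV {0..<?N} ?A"
  proof -
    have "(restrict X {0..<?N} = restrict x {0..<?N}) \<longleftrightarrow> (\<forall>k\<le>n. X k = x k)" for X :: path
      by (metis atLeastLessThan_iff le0 less_Suc_eq_le restrict_apply' restrict_ext)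
    then show ?thesis by (auto simp: prod_emb_def space_PiM)
  qed
  have "emeasure (quenched_law \<omega>) {X. \<forall>k\<le>n. X k = x k} = emeasure (walk.CI \<omega> {0..<?N}) ?A"
    unfolding quenched_law_eq cyl by (rule walk.lim[OF _ A]) simp
  also have "\<dots> = emeasure (walk.C \<omega> 0 ?N (\<lambda>_. undefined)) (walk.PF.emb {0..<?N} {0..<?N} ?A)"
    by (rule walk.emeasure_CI[OF _ A]) simp
  also have "walk.PF.emb {0..<?N} {0..<?N} ?A = ?A"
    using A by (intro prod_emb_id) (auto simp: PiE_def)
  finally show ?thesis
    by (simp add: emeasure_walk_C prod.lessThan_Suc_shift prod_ennreal prod_nonneg pmf_return
        of_bool_def ennreal_mult' del: prod.lessThan_Suc walk.C.simps)
qed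

interpretation quenched: prob_space "quenched_law \<omega>" for \<omega>
proof -
  have "prob_space (walk.CI \<omega> {})"
    by (rule walk.PF.prob_space_P) auto
  then show "prob_space (quenched_law \<omega>)"
    unfolding quenched_law_eq walk.distr_lim[OF finite.emptyI, symmetric]
    by (rule prob_space_distrD[rotated])
       (auto simp: measurable_cong_sets[OF walk.PF.sets_lim refl] intro!: measurable_restrict)
qed

definition list_cylinder :: "site list \<Rightarrow> path set" where
  "list_cylinder xs = {X. \<forall>k<length xs. X k = xs ! k}"

lemma emeasure_quenched_list_cylinder:
  "emeasure (quenched_law \<omega>) (list_cylinder xs) = (if xs = [] then 1 else
     ennreal (of_bool (xs ! 0 = 0) * (\<Prod>k<length xs - 1. pmf (step_pmf \<omega> (xs ! k)) (xs ! Suc k))))"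
proof (cases xs)
  case Nil
  then show ?thesis
    using quenched.emeasure_space_1[of \<omega>] by (simp add: list_cylinder_def)
next
  case (Cons a as)
  then have "list_cylinder xs = {X. \<forall>k\<le>length as. X k = xs ! k}"
    by (simp add: list_cylinder_def less_Suc_eq_le)
  then show ?thesis
    using Cons emeasure_quenched_cylinder[of \<omega> "length as" "\<lambda>k. xs ! k"] by simp
qed

lemma measurable_path_component [measurable]:
  "(\<lambda>X. X k) \<in> path_space \<rightarrow>\<^sub>M count_space UNIV"
  unfolding path_space_def by (rule measurable_component_singleton) simp

lemma measurable_env_component [measurable]:
  "(\<lambda>\<omega>. \<omega> x d) \<in> borel_measurable env_space"
  unfolding env_space_def
  by (rule measurable_compose[where f = "\<lambda>\<omega>. \<omega> x" and g = "\<lambda>w. w d"])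
     (rule measurable_component_singleton; simp)+

lemma sets_path_space_cylinders: "sets path_space = sigma_sets UNIV (insert {} (range list_cylinder))"
proof
  let ?S = "sigma UNIV (insert {} (range list_cylinder))"
  have "(\<lambda>X. X) \<in> ?S \<rightarrow>\<^sub>M path_space"
    unfolding path_space_def
  proof (rule measurable_PiM_single')
    fix k
    show "(\<lambda>X. X k) \<in> ?S \<rightarrow>\<^sub>M count_space (UNIV :: site set)"
    proof (rule measurableI)
      fix A :: "site set"
      have "(\<lambda>X. X k) -` A \<inter> space ?S = (\<Union>xs\<in>{xs. length xs = Suc k \<and> xs ! k \<in> A}. list_cylinder xs)"
      proof (intro equalityI subsetI)
        fix X assume "X \<in> (\<lambda>X. X k) -` A \<inter> space ?S"
        then show "X \<in> (\<Union>xs\<in>{xs. length xs = Suc k \<and> xs ! k \<in> A}. list_cylinder xs)"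
          by (intro UN_I[of "map X [0..<Suc k]"])
             (auto simp: list_cylinder_def nth_append less_Suc_eq simp del: upt_Suc)
      qed (auto simp: list_cylinder_def)
      also have "\<dots> \<in> sets ?S"
        by (intro sets.countable_UN'') (auto intro: countableI_type)
      finally show "(\<lambda>X. X k) -` A \<inter> space ?S \<in> sets ?S" .
    qed auto
  qed auto
  then show "sets path_space \<subseteq> sigma_sets UNIV (insert {} (range list_cylinder))"
    by (auto dest: measurable_sets)
  have "list_cylinder xs \<in> sets path_space" for xs
  proof -
    have "{X \<in> space path_space. \<forall>k<length xs. X k = xs ! k} \<in> sets path_space"
      by measurable
    then show ?thesis by (simp add: list_cylinder_def)
  qed
  then show "sigma_sets UNIV (insert {} (range list_cylinder)) \<subseteq> sets path_space"
    using sets.sigma_sets_subset[of "insert {} (range list_cylinder)" path_space] by auto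
qed

lemma Int_stable_list_cylinders: "Int_stable (insert {} (range list_cylinder))"
proof -
  have *: "list_cylinder xs \<inter> list_cylinder ys \<in> insert {} (range list_cylinder)"
    if "length xs \<le> length ys" for xs ys
  proof (cases "list_cylinder xs \<inter> list_cylinder ys = {}")
    case False
    then obtain X where "X \<in> list_cylinder xs" "X \<in> list_cylinder ys" by auto
    with that have "list_cylinder xs \<inter> list_cylinder ys = list_cylinder ys"
      by (auto simp: list_cylinder_def)
    then show ?thesis by auto
  qed auto
  have "list_cylinder xs \<inter> list_cylinder ys \<in> insert {} (range list_cylinder)" for xs ys
    using *[of xs ys] *[of ys xs] by (cases "length xs \<le> length ys") (auto simp: Int_commute)
  then show ?thesis
    unfolding Int_stable_def by auto
qed

lemma borel_measurable_pmf_dir_pmf [measurable]: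
  "(\<lambda>\<omega>. pmf (dir_pmf (\<omega> x)) d) \<in> borel_measurable env_space"
proof -
  have "pmf (dir_pmf w) d = (if is_prob_vector w then w d else of_bool (d = PosE1))" for w
    by (auto simp: pmf_dir_pmf) (auto simp: dir_pmf_def pmf_return)
  moreover have "Measurable.pred env_space (\<lambda>\<omega>. is_prob_vector (\<omega> x))"
    unfolding is_prob_vector_def by measurable
  ultimately show ?thesis by simp
qed

lemma pmf_step_pmf: "pmf (step_pmf \<omega> x) y = (\<Sum>d\<in>{d. x + dir_vec d = y}. pmf (dir_pmf (\<omega> x)) d)"
  unfolding step_pmf_def by (simp add: pmf_map measure_measure_pmf_finite vimage_def)

lemma measurable_quenched_law [measurable]:
  "quenched_law \<in> env_space \<rightarrow>\<^sub>M prob_algebra path_space"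
proof (rule measurable_prob_algebra_generated[OF sets_path_space_cylinders Int_stable_list_cylinders])
  fix A assume "A \<in> insert {} (range list_cylinder)"
  moreover have "(\<lambda>\<omega>. emeasure (quenched_law \<omega>) (list_cylinder xs)) \<in> borel_measurable env_space" for xs
    unfolding emeasure_quenched_list_cylinder pmf_step_pmf by (cases "xs = []"; simp only: if_True if_False) measurable
  ultimately show "(\<lambda>\<omega>. emeasure (quenched_law \<omega>) A) \<in> borel_measurable env_space"
    by auto
qed (auto simp: quenched.prob_space_axioms)

lemma measurable_quenched_joint [measurable]:
  "(\<lambda>\<omega>. distr (quenched_law \<omega>) (env_space \<Otimes>\<^sub>M path_space) (Pair \<omega>))
     \<in> env_space \<rightarrow>\<^sub>M prob_algebra (env_space \<Otimes>\<^sub>M path_space)"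
  by (rule measurable_distr_prob_space2[where M = path_space]) measurable

context
  fixes E :: "env measure"
  assumes E: "prob_space E" "sets E = sets env_space"
begin

lemma E_in_prob_algebra: "E \<in> space (prob_algebra env_space)"
  using E by (simp add: space_prob_algebra)

lemma annealed_in_prob_algebra: "annealed_law E \<in> space (prob_algebra (env_space \<Otimes>\<^sub>M path_space))"
proof -
  have "(\<lambda>_. annealed_law E) \<in> count_space (UNIV :: unit set) \<rightarrow>\<^sub>M prob_algebra (env_space \<Otimes>\<^sub>M path_space)"
    unfolding annealed_law_def
    by (rule measurable_bind_prob_space[where N = env_space])
       (use E_in_prob_algebra measurable_quenched_joint in auto)
  then show ?thesis
    by (rule measurable_space) simp
qed

lemma sets_annealed_law: "sets (annealed_law E) = sets (env_space \<Otimes>\<^sub>M path_space)"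
  using annealed_in_prob_algebra by (simp add: space_prob_algebra)

lemma prob_space_annealed_law: "prob_space (annealed_law E)"
  using annealed_in_prob_algebra by (simp add: space_prob_algebra)

lemma emeasure_annealed_law:
  assumes A: "A \<in> sets (env_space \<Otimes>\<^sub>M path_space)"
  shows "emeasure (annealed_law E) A = (\<integral>\<^sup>+\<omega>. emeasure (quenched_law \<omega>) {X. (\<omega>, X) \<in> A} \<partial>E)"
proof -
  have "emeasure (annealed_law E) A =
      (\<integral>\<^sup>+\<omega>. emeasure (distr (quenched_law \<omega>) (env_space \<Otimes>\<^sub>M path_space) (Pair \<omega>)) A \<partial>E)"
    unfolding annealed_law_def
    by (rule emeasure_bind_prob_algebra[OF E_in_prob_algebra measurable_quenched_joint A])
  also have "\<dots> = (\<integral>\<^sup>+\<omega>. emeasure (quenched_law \<omega>) {X. (\<omega>, X) \<in> A} \<partial>E)"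
    using A by (intro nn_integral_cong) (simp add: emeasure_distr vimage_def)
  finally show ?thesis .
qed

end

lemma subalgebra_halfplane_algebra:
  assumes Q: "sets Q = sets (env_space \<Otimes>\<^sub>M path_space)"
  shows "subalgebra Q (halfplane_algebra y)"
proof -
  have "(\<lambda>(\<omega>, X). restrict \<omega> (left_halfplane y))
      \<in> env_space \<Otimes>\<^sub>M path_space \<rightarrow>\<^sub>M PiM (left_halfplane y) (\<lambda>_. PiM UNIV (\<lambda>_. borel))"
    unfolding env_space_def case_prod_unfold
    by (intro measurable_restrict) measurable
  then show ?thesis
    unfolding subalgebra_def halfplane_algebra_def
    using Q sets_eq_imp_space_eq[OF Q] sets_image_in_sets[OF refl] by simp
qed

lemma measurable_layered_env [measurable]:
  "layered_env \<in> PiM UNIV (\<lambda>_. borel) \<rightarrow>\<^sub>M env_space"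
  unfolding env_space_def
proof (intro measurable_PiM_single')
  fix z :: site and d
  show "(\<lambda>q. layered_env q z d) \<in> borel_measurable (PiM UNIV (\<lambda>_. borel))"
    by (cases z; cases d) simp_all
qed (auto simp: space_PiM)

lemma exit_time_eq_enat_iff: "exit_time A X = enat n \<longleftrightarrow> X n \<notin> A \<and> (\<forall>k<n. X k \<in> A)"
proof (cases "\<exists>n. X n \<notin> A")
  case True
  then have L: "X (LEAST n. X n \<notin> A) \<notin> A" by (rule LeastI_ex)
  then have "exit_time A X = enat (LEAST n. X n \<notin> A)"
    unfolding exit_time_def
    by (intro antisym INF_lower INF_greatest) (auto intro: Least_le)
  moreover have "(LEAST n. X n \<notin> A) = n \<longleftrightarrow> X n \<notin> A \<and> (\<forall>k<n. X k \<in> A)"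
    using L not_less_Least[of _ "\<lambda>n. X n \<notin> A"] by (metis linorder_neqE_nat)
  ultimately show ?thesis by simp
next
  case False
  then show ?thesis by (auto simp: exit_time_def top_enat_def)
qed

lemma less_hit_time_iff: "enat n < hit_time A X \<longleftrightarrow> (\<forall>k\<le>n. X k \<notin> A)"
proof
  assume *: "enat n < hit_time A X"
  show "\<forall>k\<le>n. X k \<notin> A"
  proof (intro allI impI notI)
    fix k assume "k \<le> n" "X k \<in> A"
    then have "hit_time A X \<le> enat k" unfolding hit_time_def by (intro INF_lower) auto
    with * \<open>k \<le> n\<close> show False by (meson enat_ord_simps(1) leD order_trans)
  qed
next
  assume *: "\<forall>k\<le>n. X k \<notin> A"
  have "enat (Suc n) \<le> hit_time A X"
    unfolding hit_time_def using * by (intro INF_greatest) (auto simp: not_less_eq_eq[symmetric])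
  then show "enat n < hit_time A X"
    by (meson enat_ord_simps(2) lessI less_le_trans)
qed

lemma bad_exit_event_eq:
  "bad_exit_event c L y = {(\<omega>, X). \<exists>n. X n \<notin> box c L \<and> X n \<notin> right_boundary c L \<and>
     (\<forall>k<n. X k \<in> box c L) \<and> (\<forall>k\<le>n. X k \<notin> left_halfplane y)}"
proof -
  have "(T < hit_time (left_halfplane y) X \<and> X (the_enat T) \<notin> right_boundary c L) \<longleftrightarrow>
     (\<exists>n. T = enat n \<and> enat n < hit_time (left_halfplane y) X \<and> X n \<notin> right_boundary c L)" for T X
    by (cases T) auto
  then show ?thesis
    unfolding bad_exit_event_def exit_time_eq_enat_iff less_hit_time_iff
    by (auto simp: exit_time_eq_enat_iff less_hit_time_iff)
qed

lemma sets_bad_exit_event: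
  "bad_exit_event c L y \<in> sets (env_space \<Otimes>\<^sub>M path_space)"
proof -
  have "{w \<in> space (env_space \<Otimes>\<^sub>M path_space). \<exists>n. snd w n \<notin> box c L \<and> snd w n \<notin> right_boundary c L \<and>
     (\<forall>k<n. snd w k \<in> box c L) \<and> (\<forall>k\<le>n. snd w k \<notin> left_halfplane y)}
     \<in> sets (env_space \<Otimes>\<^sub>M path_space)"
    by measurable
  then show ?thesis
    by (simp add: bad_exit_event_eq space_pair_measure case_prod_unfold)
qed

end

theory Submission
  imports Defs
begin

text \<open>
  The horizontal coordinate of the walk is a lazy one-dimensional walk in the environment \<open>p\<^sub>i\<close>, the
  vertical one a lazy simple random walk. Every quenched estimate comes from an explicit
  nonnegative supermartingale of the path: the scale function of the horizontal walk bounds the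
  probability of backtracking, its mean crossing times bound the hitting times, the square
  of the vertical coordinate bounds vertical displacements. Since \<open>E \<rho>\<^sup>s < 1\<close> for \<open>1/2 < s < \<kappa>\<close>,
  the bounds \<open>min 1 (\<Sum> a\<^sub>j) \<le> \<Sum> a\<^sub>j\<^sup>s\<close> turn into annealed estimates: backtracking over
  distance \<open>k\<close> has probability \<open>O(r\<^sup>k)\<close>, and the hitting time of level \<open>m\<close> exceeds \<open>n\<close> with
  probability \<open>O(m / n\<^sup>s)\<close>. As \<open>2 s > 1\<close>, the walk is beyond \<open>A \<surd>n\<close> at time \<open>n\<close> with high probability
  for each \<open>A\<close>, and a box of side \<open>L\<close> is left within time \<open>L\<^sup>2\<^sup>-\<^sup>\<delta>\<close>, too early for a vertical exit.
  The speed vanishes since \<open>E \<rho> \<ge> 1\<close> makes the mean crossing time infinite. The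
  conditioning in the polynomial condition is harmless: before entering the half plane the walk
  only sees layers independent of the conditioning.
\<close>

section \<open>Supermartingales of the quenched walk\<close>

text \<open>The exponent s lies strictly below \<kappa> because E \<rho>^\<kappa> = 1 gives no
  geometric decay for products of independent \<rho>. Convexity alone gives E \<rho>^s \<le> 1;
  strictness comes from the uniqueness of \<kappa>, as equality would make s a second root. The same
  convexity gives E \<rho> \<ge> 1.

  First moments are therefore useless after averaging: the annealed mean of a crossing time is
  infinite. So each quenched bound is truncated at 1, the trivial bound for a probability, before
  the environment is averaged, and s-th powers are taken term by term. Since crossing times may be
  infinite, the supermartingales take values in \<open>ennreal\<close> and their algebra avoids
  subtraction.

  For the polynomial condition, time is cut at L^(2 - \<delta>). A vertical exit before that time
  costs L^(-\<delta>), and failing to reach level L by then costs L^(1 - (2 - \<delta>) s). At s =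
  \<kappa> the two balance at \<delta> = (2 \<kappa> - 1) / (1 + \<kappa>), which exceeds \<kappa> -
  1/2 because \<kappa> < 1. Hence \<delta> = \<kappa> - 1/2 already works, with room for s slightly
  below \<kappa>.\<close>

primrec hist_pmf :: "env \<Rightarrow> nat \<Rightarrow> site list pmf" where
  "hist_pmf \<omega> 0 = return_pmf [0]"
| "hist_pmf \<omega> (Suc n) = hist_pmf \<omega> n \<bind> (\<lambda>xs. map_pmf (\<lambda>y. xs @ [y]) (step_pmf \<omega> (last xs)))"

abbreviation hist :: "nat \<Rightarrow> path \<Rightarrow> site list" where
  "hist n X \<equiv> map X [0..<Suc n]"

lemma pmf_hist_pmf:
  "pmf (hist_pmf \<omega> n) xs = (if length xs = Suc n then
     of_bool (xs ! 0 = 0) * (\<Prod>k<n. pmf (step_pmf \<omega> (xs ! k)) (xs ! Suc k)) else 0)"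
proof (induction n arbitrary: xs)
  case 0
  then show ?case
    by (cases xs) (auto simp: pmf_return)
next
  case (Suc n)
  \<comment> \<open>Appending a site is injective, so only the history \<open>butlast xs\<close>
    contributes to the mass of \<open>xs\<close>.\<close>
  have "pmf (map_pmf (\<lambda>y. zs @ [y]) (step_pmf \<omega> (last zs))) xs
     = indicator {butlast xs} zs * (if xs = [] then 0 else pmf (step_pmf \<omega> (last (butlast xs))) (last xs))" for zs
  proof (cases "xs \<noteq> [] \<and> zs = butlast xs")
    case True
    then have "xs = zs @ [last xs]" by simp
    then have "pmf (map_pmf (\<lambda>y. zs @ [y]) (step_pmf \<omega> (last zs))) xs = pmf (step_pmf \<omega> (last zs)) (last xs)"
      using pmf_map_inj'[of "\<lambda>y. zs @ [y]" "step_pmf \<omega> (last zs)" "last xs"] by (simp add: inj_def)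
    then show ?thesis using True by simp
  next
    case False
    then have "xs \<notin> range (\<lambda>y. zs @ [y])" by auto
    then have "pmf (map_pmf (\<lambda>y. zs @ [y]) (step_pmf \<omega> (last zs))) xs = 0"
      by (auto simp: pmf_eq_0_set_pmf)
    then show ?thesis using False by auto
  qed
  then have 2: "pmf (hist_pmf \<omega> (Suc n)) xs = pmf (hist_pmf \<omega> n) (butlast xs) *
      (if xs = [] then 0 else pmf (step_pmf \<omega> (last (butlast xs))) (last xs))"
    by (simp add: pmf_bind measure_pmf_single)
  show ?case
  proof (cases xs rule: rev_cases)
    case Nil
    then show ?thesis unfolding 2 by simp
  next
    case (snoc ys y)
    show ?thesis
    proof (cases "length ys = Suc n")
      case True
      then have "ys \<noteq> []" by auto
      then have "last ys = ys ! n"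
        using True by (simp add: last_conv_nth)
      moreover have "(\<Prod>k<n. pmf (step_pmf \<omega> ((ys @ [y]) ! k)) ((ys @ [y]) ! Suc k))
         = (\<Prod>k<n. pmf (step_pmf \<omega> (ys ! k)) (ys ! Suc k))"
        using True by (intro prod.cong) (auto simp: nth_append)
      ultimately show ?thesis
        unfolding 2 unfolding snoc using True by (simp add: Suc.IH nth_append)
    qed (unfold 2, unfold snoc, simp add: Suc.IH)
  qed
qed

lemma hist_vimage: "hist n -` {xs} = (if length xs = Suc n then list_cylinder xs else {})"
proof -
  have "map X [0..<Suc n] = xs \<longleftrightarrow> length xs = Suc n \<and> (\<forall>k<length xs. X k = xs ! k)" for X
    by (subst list_eq_iff_nth_eq) (auto simp del: upt_Suc)
  then show ?thesis by (auto simp: list_cylinder_def simp del: upt_Suc)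
qed

lemma measurable_hist [measurable]: "hist n \<in> path_space \<rightarrow>\<^sub>M count_space UNIV"
proof (rule measurableI)
  fix A :: "site list set"
  have "list_cylinder xs \<in> sets path_space" for xs
    unfolding sets_path_space_cylinders by (auto intro: sigma_sets.Basic)
  then have "(\<Union>xs\<in>A. hist n -` {xs}) \<in> sets path_space"
    unfolding hist_vimage by (intro sets.countable_UN'') (auto intro: countableI_type)
  then show "hist n -` A \<inter> space path_space \<in> sets path_space"
    by (simp add: vimage_eq_UN[symmetric])
qed auto

lemma distr_hist:
  "distr (quenched_law \<omega>) (count_space UNIV) (hist n) = measure_pmf (hist_pmf \<omega> n)"
proof (rule measure_eqI_countable[where A = UNIV])
  fix xs :: "site list"
  have "emeasure (distr (quenched_law \<omega>) (count_space UNIV) (hist n)) {xs}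
      = emeasure (quenched_law \<omega>) (hist n -` {xs})"
    by (simp add: emeasure_distr measurable_cong_sets[OF sets_quenched_law refl] del: upt_Suc)
  also have "\<dots> = ennreal (pmf (hist_pmf \<omega> n) xs)"
    unfolding hist_vimage pmf_hist_pmf by (auto simp: emeasure_quenched_list_cylinder)
  finally show "emeasure (distr (quenched_law \<omega>) (count_space UNIV) (hist n)) {xs}
      = emeasure (measure_pmf (hist_pmf \<omega> n)) {xs}"
    by (simp add: emeasure_pmf_single)
qed auto

text \<open>A function of the first n + 1 positions factors through the countable space of
  histories, where integration over the last step is an explicit bind. Positions beyond the end of
  the list have arbitrary values, which \<open>V\<close> ignores.\<close>

lemma nn_integral_adapted:
  assumes "\<And>X Y. (\<And>k. k \<le> n \<Longrightarrow> X k = Y k) \<Longrightarrow> V X = V Y"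
  shows "V \<in> borel_measurable path_space" 
    and "(\<integral>\<^sup>+X. V X \<partial>quenched_law \<omega>) = (\<integral>\<^sup>+xs. V (\<lambda>k. xs ! k) \<partial>hist_pmf \<omega> n)"
proof -
  have eq: "V = (\<lambda>X. V (\<lambda>k. hist n X ! k))"
    by (intro ext assms) (simp add: nth_append del: upt_Suc)
  show "V \<in> borel_measurable path_space"
    by (subst eq) (rule measurable_compose[OF measurable_hist], simp)
  show "(\<integral>\<^sup>+X. V X \<partial>quenched_law \<omega>) = (\<integral>\<^sup>+xs. V (\<lambda>k. xs ! k) \<partial>hist_pmf \<omega> n)"
    unfolding distr_hist[symmetric]
    by (subst eq, subst nn_integral_distr)
       (simp_all add: measurable_cong_sets[OF sets_quenched_law refl] del: upt_Suc)
qed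

text \<open>The supermartingale property is a pointwise inequality over the four continuations of a
  path, which replaces conditional expectations. The restriction to n < N admits processes that
  contain the remaining time N - n.\<close>

lemma nn_integral_supermartingale:
  fixes V :: "nat \<Rightarrow> path \<Rightarrow> ennreal"
  assumes ad: "\<And>n X Y. (\<And>k. k \<le> n \<Longrightarrow> X k = Y k) \<Longrightarrow> V n X = V n Y"
    and step: "\<And>n X. n < N \<Longrightarrow> X 0 = 0 \<Longrightarrow>
       (\<Sum>d\<in>UNIV. ennreal (pmf (dir_pmf (\<omega> (X n))) d) * V (Suc n) (X(Suc n := X n + dir_vec d))) \<le> V n X"
  shows "(\<integral>\<^sup>+X. V N X \<partial>quenched_law \<omega>) \<le> V 0 (\<lambda>_. 0)"
proof -
  have "n \<le> N \<Longrightarrow> (\<integral>\<^sup>+X. V n X \<partial>quenched_law \<omega>) \<le> V 0 (\<lambda>_. 0)" for n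
  proof (induction n)
    case 0
    have "V 0 (\<lambda>k. [0] ! k) = V 0 (\<lambda>_. 0)" by (rule ad) simp
    moreover have "(\<integral>\<^sup>+X. V 0 X \<partial>quenched_law \<omega>) = V 0 (\<lambda>k. [0] ! k)"
      by (subst nn_integral_adapted(2)[where n = 0, OF ad]) simp_all
    ultimately show ?case by simp
  next
    case (Suc n)
    have "(\<integral>\<^sup>+X. V (Suc n) X \<partial>quenched_law \<omega>)
        = (\<integral>\<^sup>+xs. (\<integral>\<^sup>+y. V (Suc n) (\<lambda>k. (xs @ [y]) ! k) \<partial>step_pmf \<omega> (last xs)) \<partial>hist_pmf \<omega> n)"
      by (subst nn_integral_adapted(2)[where n = "Suc n", OF ad]) simp_all
    also have "\<dots> \<le> (\<integral>\<^sup>+xs. V n (\<lambda>k. xs ! k) \<partial>hist_pmf \<omega> n)"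
    proof (rule nn_integral_mono_AE, rule AE_pmfI)
      fix xs assume "xs \<in> set_pmf (hist_pmf \<omega> n)"
      then have len: "length xs = Suc n" and xs0: "xs ! 0 = 0"
        by (auto simp: set_pmf_eq pmf_hist_pmf split: if_splits)
      then have "xs \<noteq> []" by auto
      then have last: "last xs = xs ! n" using len by (simp add: last_conv_nth)
      have "(\<integral>\<^sup>+y. V (Suc n) (\<lambda>k. (xs @ [y]) ! k) \<partial>step_pmf \<omega> (last xs))
         = (\<Sum>d\<in>UNIV. ennreal (pmf (dir_pmf (\<omega> (xs ! n))) d) * V (Suc n) (\<lambda>k. (xs @ [xs ! n + dir_vec d]) ! k))"
        unfolding step_pmf_def last nn_integral_map_pmf
        by (simp add: nn_integral_measure_pmf nn_integral_count_space_finite)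
      also have "\<dots> = (\<Sum>d\<in>UNIV. ennreal (pmf (dir_pmf (\<omega> (xs ! n))) d) *
          V (Suc n) ((\<lambda>k. xs ! k)(Suc n := xs ! n + dir_vec d)))"
        using len by (intro sum.cong arg_cong2[where f = "(*)"] refl ad) (auto simp: nth_append)
      also have "\<dots> \<le> V n (\<lambda>k. xs ! k)"
        using step[of n "\<lambda>k. xs ! k"] Suc.prems xs0 by simp
      finally show "(\<integral>\<^sup>+y. V (Suc n) (\<lambda>k. (xs @ [y]) ! k) \<partial>step_pmf \<omega> (last xs)) \<le> V n (\<lambda>k. xs ! k)" .
    qed
    also have "\<dots> = (\<integral>\<^sup>+X. V n X \<partial>quenched_law \<omega>)"
      by (subst nn_integral_adapted(2)[where n = n, OF ad]) simp_all
    finally show ?case using Suc by simp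
  qed
  then show ?thesis by simp
qed

text \<open>It suffices to treat finite histories: positive mass forces every step into the support
  of \<open>step_pmf\<close>. This is what makes the walk leave a box through its outer
  boundary.\<close>

lemma AE_nearest_neighbour: "AE X in quenched_law \<omega>. X 0 = 0 \<and> (\<forall>n. \<exists>d. X (Suc n) = X n + dir_vec d)"
proof -
  have "AE X in quenched_law \<omega>. X 0 = 0 \<and> (\<forall>k<n. \<exists>d. X (Suc k) = X k + dir_vec d)" (is "AE X in _. ?R n X") for n
  proof -
    let ?P = "\<lambda>xs :: site list. xs ! 0 = 0 \<and> (\<forall>k<n. \<exists>d. xs ! Suc k = xs ! k + dir_vec d)"
    have "AE xs in measure_pmf (hist_pmf \<omega> n). ?P xs"
    proof (rule AE_pmfI)
      fix xs assume "xs \<in> set_pmf (hist_pmf \<omega> n)"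
      then have "xs ! 0 = 0" "(\<Prod>k<n. pmf (step_pmf \<omega> (xs ! k)) (xs ! Suc k)) \<noteq> 0"
        by (auto simp: set_pmf_eq pmf_hist_pmf split: if_splits)
      then have "xs ! 0 = 0" "\<And>k. k < n \<Longrightarrow> xs ! Suc k \<in> set_pmf (step_pmf \<omega> (xs ! k))"
        by (auto simp: set_pmf_eq)
      then show "?P xs"
        by (auto simp: step_pmf_def)
    qed
    then have "AE X in quenched_law \<omega>. ?P (hist n X)"
      unfolding distr_hist[symmetric]
      by (subst (asm) AE_distr_iff) (simp_all add: measurable_cong_sets[OF sets_quenched_law refl] del: upt_Suc)
    moreover have "?P (hist n X) \<longleftrightarrow> ?R n X" for X
      by (simp add: nth_append del: upt_Suc)
    ultimately show ?thesis by (simp del: upt_Suc)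
  qed
  then have "AE X in quenched_law \<omega>. \<forall>n. ?R n X" unfolding AE_all_countable by blast
  then show ?thesis by (rule AE_mp) (auto intro!: AE_I2)
qed

section \<open>Quenched estimates in a layered environment\<close>

definition rho :: "(int \<Rightarrow> real) \<Rightarrow> int \<Rightarrow> real" where
  "rho q i = (1 - q i) / q i"

abbreviation layered_law :: "(int \<Rightarrow> real) \<Rightarrow> path measure" where
  "layered_law q \<equiv> quenched_law (layered_env q)"

lemma pmf_layered_env:
  assumes "\<And>i. 0 < q i \<and> q i < 1"
  shows "pmf (dir_pmf (layered_env q z)) d = layered_env q z d"
  using assms by (intro pmf_dir_pmf is_prob_vector_layered_env) (auto intro: less_imp_le)

lemma ex_le_Suc: "(\<exists>k\<le>Suc n. P k) \<longleftrightarrow> (\<exists>k\<le>n. P k) \<or> P (Suc n)"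
  by (auto simp: le_Suc_eq)

text \<open>A supermartingale step overwrites coordinate n + 1; whether a site set was visited then
  splits into the past and the new position.\<close>

lemma ex_le_Suc_upd:
  "(\<exists>k\<le>Suc n. Q ((X(Suc n := z)) k)) \<longleftrightarrow> (\<exists>k\<le>n. Q (X k)) \<or> Q z"
proof -
  have "k \<le> n \<and> Q ((X(Suc n := z)) k) \<longleftrightarrow> k \<le> n \<and> Q (X k)" for k
    by (cases "k = Suc n") simp_all
  then show ?thesis unfolding ex_le_Suc by simp
qed

lemma layered_supermartingale:
  fixes V :: "nat \<Rightarrow> path \<Rightarrow> ennreal"
  assumes q: "\<And>i. 0 < q i \<and> q i < 1"
    and ad: "\<And>n X Y. (\<And>k. k \<le> n \<Longrightarrow> X k = Y k) \<Longrightarrow> V n X = V n Y"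
    and step: "\<And>n X i j. n < N \<Longrightarrow> X 0 = 0 \<Longrightarrow> X n = (i, j) \<Longrightarrow>
         ennreal (q i / 2) * V (Suc n) (X(Suc n := (i + 1, j)))
       + ennreal (1 / 2 - q i / 2) * V (Suc n) (X(Suc n := (i - 1, j)))
       + (ennreal (1 / 4) * V (Suc n) (X(Suc n := (i, j + 1)))
       + ennreal (1 / 4) * V (Suc n) (X(Suc n := (i, j - 1)))) \<le> V n X"
  shows "(\<integral>\<^sup>+X. V N X \<partial>layered_law q) \<le> V 0 (\<lambda>_. 0)"
proof (rule nn_integral_supermartingale[OF ad])
  fix n and X :: path assume "n < N" "X 0 = 0"
  obtain i j where X: "X n = (i, j)" by fastforce
  show "(\<Sum>d\<in>UNIV. ennreal (pmf (dir_pmf (layered_env q (X n))) d) * V (Suc n) (X(Suc n := X n + dir_vec d))) \<le> V n X"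
    using step[OF \<open>n < N\<close> \<open>X 0 = 0\<close> X]
    by (simp add: UNIV_dir pmf_layered_env q X add.assoc)
qed

lemma layered_weights:
  fixes x :: real
  assumes "0 < x" "x < 1"
  shows "ennreal (x / 2) + ennreal (1 / 2 - x / 2) + (ennreal (1 / 4) + ennreal (1 / 4)) = 1"
proof -
  have "ennreal (x / 2) + ennreal (1 / 2 - x / 2) + (ennreal (1 / 4) + ennreal (1 / 4))
      = ennreal (x / 2 + (1 / 2 - x / 2) + (1 / 4 + 1 / 4))"
    using assms ennreal_plus[of "1/4" "1/4"] ennreal_plus[of "x / 2" "1 / 2 - x / 2"]
      ennreal_plus[of "x / 2 + (1 / 2 - x / 2)" "1 / 4 + 1 / 4"] by (simp only:)
  then show ?thesis by simp
qed

lemma layered_average: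
  fixes x :: real and a :: ennreal
  assumes "0 < x" "x < 1"
  shows "ennreal (x / 2) * a + ennreal (1 / 2 - x / 2) * a + (ennreal (1 / 4) * a + ennreal (1 / 4) * a) = a"
  using layered_weights[OF assms] by (simp only: distrib_right[symmetric] mult_1)

lemma ennreal_average:
  assumes "0 \<le> a" "0 \<le> b" "0 \<le> c" "0 \<le> d" "0 \<le> x" "0 \<le> y" "0 \<le> z" "0 \<le> w"
  shows "ennreal a * ennreal x + ennreal b * ennreal y + (ennreal c * ennreal z + ennreal d * ennreal w)
       = ennreal (a * x + b * y + (c * z + d * w))"
  using assms by (simp add: ennreal_mult)

section \<open>Measurable path events and Markov's inequality\<close>

lemma sets_path_space_at: "{X. P (X k)} \<in> sets path_space"
  using measurable_sets[OF measurable_path_component, of "{z. P z}" k] by (simp add: vimage_def)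

lemma sets_no_hit_paths: "{X. \<forall>k\<le>n. fst (X k) < m} \<in> sets path_space"
proof -
  have "{X :: path. \<forall>k\<le>n. fst (X k) < m} = (\<Inter>k\<in>{..n}. {X. fst (X k) < m})" by auto
  also have "\<dots> \<in> sets path_space"
    by (intro sets.finite_INT sets_path_space_at finite_atMost) auto
  finally show ?thesis .
qed

lemma sets_backtrack_paths: "{X. \<exists>k. \<exists>j\<le>k. m \<le> fst (X j) \<and> fst (X k) \<le> l} \<in> sets path_space"
proof -
  have "{X :: path. \<exists>k. \<exists>j\<le>k. m \<le> fst (X j) \<and> fst (X k) \<le> l} = (\<Union>k. \<Union>j\<in>{..k}. {X. m \<le> fst (X j)} \<inter> {X. fst (X k) \<le> l})"
    by auto
  also have "\<dots> \<in> sets path_space"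
    by (intro sets.countable_UN'' sets.finite_UN sets.Int sets_path_space_at finite_atMost) auto
  finally show ?thesis .
qed

lemma sets_vertical_paths: "{X. \<exists>k\<le>n. a \<le> \<bar>real_of_int (snd (X k))\<bar>} \<in> sets path_space"
proof -
  have "{X :: path. \<exists>k\<le>n. a \<le> \<bar>real_of_int (snd (X k))\<bar>} = (\<Union>k\<in>{..n}. {X. a \<le> \<bar>real_of_int (snd (X k))\<bar>})" by auto
  also have "\<dots> \<in> sets path_space"
    by (intro sets.finite_UN sets_path_space_at finite_atMost)
  finally show ?thesis .
qed

text \<open>Markov's inequality. A nonmeasurable \<open>A\<close> is covered because its
  \<open>emeasure\<close> is 0.\<close>

lemma emeasure_le_nn_integral:
  assumes "\<And>X. X \<in> A \<Longrightarrow> c \<le> V X" "V \<in> borel_measurable path_space"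
  shows "c * emeasure (quenched_law \<omega>) A \<le> (\<integral>\<^sup>+X. V X \<partial>quenched_law \<omega>)"
proof (cases "A \<in> sets path_space")
  case True
  then have "c * emeasure (quenched_law \<omega>) A = (\<integral>\<^sup>+X. c * indicator A X \<partial>quenched_law \<omega>)"
    by (simp add: nn_integral_cmult_indicator)
  also have "\<dots> \<le> (\<integral>\<^sup>+X. V X \<partial>quenched_law \<omega>)"
    using assms(1) by (intro nn_integral_mono) (auto split: split_indicator)
  finally show ?thesis .
next
  case False
  then show ?thesis by (simp add: emeasure_notin_sets)
qed

section \<open>Mean crossing times and the hitting of levels to the right\<close>

text \<open>The quenched mean time from x to x + 1, obtained by unrolling t x = 2 / q x + rho x * t
  (x - 1). The factor 2 comes from the laziness: a step is horizontal with probability 1/2. The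
  series may diverge, hence \<open>ennreal\<close>.\<close>

definition cross_time :: "(int \<Rightarrow> real) \<Rightarrow> int \<Rightarrow> ennreal" where
  "cross_time q x = (\<Sum>k. ennreal (2 / q (x - int k) * (\<Prod>i\<in>{x - int k<..x}. rho q i)))"

lemma cross_time_rec:
  assumes q: "\<And>i. 0 < q i \<and> q i < 1"
  shows "cross_time q x = ennreal (2 / q x) + ennreal (rho q x) * cross_time q (x - 1)"
proof -
  have r: "0 \<le> rho q i" for i using q[of i] by (simp add: rho_def)
  have p: "0 \<le> (\<Prod>i\<in>A. rho q i)" for A using r by (simp add: prod_nonneg)
  have *: "{x - int (Suc k)<..x} = insert x {x - 1 - int k<..x - 1}" for k by auto
  have "cross_time q x = ennreal (2 / q x) + (\<Sum>k. ennreal (2 / q (x - int (Suc k)) * (\<Prod>i\<in>{x - int (Suc k)<..x}. rho q i)))"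
    unfolding cross_time_def by (subst suminf_offset[where i = 1]) auto
  also have "(\<Sum>k. ennreal (2 / q (x - int (Suc k)) * (\<Prod>i\<in>{x - int (Suc k)<..x}. rho q i)))
     = (\<Sum>k. ennreal (rho q x) * ennreal (2 / q (x - 1 - int k) * (\<Prod>i\<in>{x - 1 - int k<..x - 1}. rho q i)))"
    unfolding * using r p q less_imp_le[OF conjunct1[OF q]]
    by (intro suminf_cong) (simp add: ennreal_mult[symmetric] algebra_simps)
  also have "\<dots> = ennreal (rho q x) * cross_time q (x - 1)"
    unfolding cross_time_def by (simp add: ennreal_suminf_cmult)
  finally show ?thesis .
qed

text \<open>The first-step equation, arranged without subtraction so that it also makes sense for
  infinite crossing times.\<close>

lemma cross_time_harmonic:
  assumes q: "\<And>i. 0 < q i \<and> q i < 1"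
  shows "ennreal (q x / 2) * cross_time q x = 1 + ennreal (1 / 2 - q x / 2) * cross_time q (x - 1)"
proof -
  have qx: "0 < q x" "q x < 1" using q by auto
  have "ennreal (q x / 2) * ennreal (2 / q x) = ennreal (q x / 2 * (2 / q x))"
    using qx by (intro ennreal_mult[symmetric]) auto
  moreover have "ennreal (q x / 2) * ennreal (rho q x) = ennreal (q x / 2 * rho q x)"
    using qx by (intro ennreal_mult[symmetric]) (auto simp: rho_def)
  moreover have "q x / 2 * (2 / q x) = 1" "q x / 2 * rho q x = 1 / 2 - q x / 2"
    using qx by (auto simp: rho_def field_simps)
  ultimately show ?thesis
    by (subst cross_time_rec[where x = x, OF q]) (simp only: distrib_left mult.assoc[symmetric] ennreal_1)
qed

text \<open>One step of n + g, with a, b, c the probabilities of right, left and each vertical move,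
  t and t' the crossing times of i and i - 1, and G the rest of the sum. Only semiring laws are
  used, because infinite values in \<open>ennreal\<close> cannot be cancelled.\<close>

lemma hitting_time_average:
  fixes a b c :: "'a :: comm_semiring_1"
  assumes "a + b + (c + c) = 1" and t: "a * t = 1 + b * t'"
  shows "a * (1 + N + G) + b * (1 + N + (t' + (t + G))) + (c * (1 + N + (t + G)) + c * (1 + N + (t + G)))
     = N + (t + G)"
proof -
  have "a * (1 + N + G) + b * (1 + N + (t' + (t + G))) + (c * (1 + N + (t + G)) + c * (1 + N + (t + G)))
     = (a + b + (c + c)) * (N + G) + (a + b + (c + c)) + b * t' + (b + (c + c)) * t"
    by (simp add: algebra_simps)
  also have "\<dots> = N + G + (1 + b * t') + (b + (c + c)) * t"
    unfolding assms(1) by (simp add: algebra_simps)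
  also have "\<dots> = N + G + (a + b + (c + c)) * t"
    unfolding t[symmetric] by (simp add: algebra_simps)
  finally show ?thesis unfolding assms(1) by (simp add: algebra_simps)
qed

text \<open>The analogue for the scale function: x and y are its increments across i - 1 and i, and
  the hypothesis on them is its harmonicity.\<close>

lemma backtrack_average:
  fixes a b c :: "'a :: comm_semiring_1"
  assumes "a + b + (c + c) = 1" and x: "b * x = a * y"
  shows "a * G + b * (x + (y + G)) + (c * (y + G) + c * (y + G)) = y + G"
proof -
  have "a * G + b * (x + (y + G)) + (c * (y + G) + c * (y + G))
     = (a + b + (c + c)) * G + (b * x + (b + (c + c)) * y)"
    by (simp add: algebra_simps)
  also have "b * x + (b + (c + c)) * y = (a + b + (c + c)) * y"
    unfolding x by (simp add: algebra_simps)
  finally show ?thesis unfolding assms(1) by (simp add: algebra_simps)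
qed

text \<open>With \<open>g x\<close> the sum of the crossing times of \<open>x, \<dots>, m - 1\<close>, the process
  \<open>n + g (X\<^sub>n \<bullet> e\<^sub>1)\<close>, stopped on reaching \<open>m\<close>, is a martingale.\<close>

lemma hitting_time_bound:
  assumes q: "\<And>i. 0 < q i \<and> q i < 1" and m: "0 < m"
  shows "of_nat n * emeasure (layered_law q) {X. \<forall>k\<le>n. fst (X k) < m} \<le> (\<Sum>y\<in>{0..<m}. cross_time q y)"
proof -
  define g where "g x = (\<Sum>y\<in>{x..<m}. cross_time q y)" for x
  \<comment> \<open>Dropping to 0 at level m, instead of freezing the elapsed time, only lowers the
    process. On the event that m is not yet reached the value is still at least n.\<close>
  define V where "V n X = (if \<exists>k\<le>n. m \<le> fst (X k) then 0 else of_nat n + g (fst (X n)))" for n and X :: path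
  have ad: "V n X = V n Y" if eq: "\<And>k. k \<le> n \<Longrightarrow> X k = Y k" for n X Y
  proof -
    have "(\<exists>k\<le>n. m \<le> fst (X k)) = (\<exists>k\<le>n. m \<le> fst (Y k))" using eq by auto
    then show ?thesis by (simp only: V_def eq order_refl)
  qed
  have "(\<integral>\<^sup>+X. V n X \<partial>layered_law q) \<le> V 0 (\<lambda>_. 0)"
  proof (rule layered_supermartingale[OF q ad])
    fix n and X :: path and i j
    assume X: "X n = (i, j)"
    have V: "V (Suc n) (X(Suc n := (a, b))) = (if (\<exists>k\<le>n. m \<le> fst (X k)) \<or> m \<le> a then 0 else of_nat (Suc n) + g a)" for a b
      unfolding V_def ex_le_Suc_upd[where Q = "\<lambda>z. m \<le> fst z"] by simp
    show "ennreal (q i / 2) * V (Suc n) (X(Suc n := (i + 1, j)))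
       + ennreal (1 / 2 - q i / 2) * V (Suc n) (X(Suc n := (i - 1, j)))
       + (ennreal (1 / 4) * V (Suc n) (X(Suc n := (i, j + 1)))
       + ennreal (1 / 4) * V (Suc n) (X(Suc n := (i, j - 1)))) \<le> V n X"
    proof (cases "\<exists>k\<le>n. m \<le> fst (X k)")
      case True
      then show ?thesis unfolding V unfolding V_def by simp
    next
      case False
      then have im: "i < m" using X by (metis fst_conv not_le order_refl)
      define t where "t = cross_time q i"
      define t' where "t' = cross_time q (i - 1)"
      define G where "G = g (i + 1)"
      have gi: "g i = t + G"
      proof -
        have "{i..<m} = insert i {i+1..<m}" using im by auto
        then show ?thesis by (simp add: g_def t_def G_def)
      qed
      have gi': "g (i - 1) = t' + (t + G)"
      proof -
        have "{i-1..<m} = insert (i-1) {i..<m}" using im by auto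
        then show ?thesis by (simp add: gi[symmetric]) (simp add: g_def t'_def)
      qed
      have qi: "0 < q i" "q i < 1" using q by auto
      let ?N = "1 + of_nat n :: ennreal"
      have "ennreal (q i / 2) * V (Suc n) (X(Suc n := (i + 1, j)))
       + ennreal (1 / 2 - q i / 2) * V (Suc n) (X(Suc n := (i - 1, j)))
       + (ennreal (1 / 4) * V (Suc n) (X(Suc n := (i, j + 1)))
       + ennreal (1 / 4) * V (Suc n) (X(Suc n := (i, j - 1))))
       \<le> ennreal (q i / 2) * (?N + G)
       + ennreal (1 / 2 - q i / 2) * (?N + (t' + (t + G)))
       + (ennreal (1 / 4) * (?N + (t + G))
       + ennreal (1 / 4) * (?N + (t + G)))"
        unfolding V using False im
        by (intro add_mono mult_left_mono) (auto simp: gi gi' G_def[symmetric])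
      also have "\<dots> = of_nat n + (t + G)"
        using layered_weights[OF qi] cross_time_harmonic[where x = i, OF q]
        unfolding t_def t'_def by (rule hitting_time_average)
      also have "\<dots> = V n X"
        unfolding V_def using False X by (simp only: if_False fst_conv gi)
      finally show ?thesis .
    qed
  qed
  also have "V 0 (\<lambda>_. 0) = (\<Sum>y\<in>{0..<m}. cross_time q y)"
    using m by (simp add: V_def g_def)
  finally have "(\<integral>\<^sup>+X. V n X \<partial>layered_law q) \<le> (\<Sum>y\<in>{0..<m}. cross_time q y)" .
  moreover have "of_nat n * emeasure (layered_law q) {X. \<forall>k\<le>n. fst (X k) < m} \<le> (\<integral>\<^sup>+X. V n X \<partial>layered_law q)"
  proof (rule emeasure_le_nn_integral)
    show "V n \<in> borel_measurable path_space" by (rule nn_integral_adapted(1)[OF ad])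
    fix X :: path assume "X \<in> {X. \<forall>k\<le>n. fst (X k) < m}"
    then have "\<not> (\<exists>k\<le>n. m \<le> fst (X k))" by (simp add: not_le[of m])
    then have "V n X = of_nat n + g (fst (X n))" unfolding V_def by (rule if_not_P)
    then show "of_nat n \<le> V n X" by simp
  qed
  ultimately show ?thesis by (rule order_trans[rotated])
qed

section \<open>Scale function and probability of backtracking\<close>

text \<open>The summand \<open>j\<close> belongs to the site \<open>m + j\<close>: as a function of \<open>m \<ge> l\<close> this is a scale function
  of the horizontal walk, with value at least \<open>1\<close> at \<open>l\<close>.\<close>

definition back_scale :: "(int \<Rightarrow> real) \<Rightarrow> int \<Rightarrow> int \<Rightarrow> ennreal" where
  "back_scale q l m = (\<Sum>j. ennreal (\<Prod>i\<in>{l<..m + int j}. rho q i))"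

lemma back_scale_step:
  "back_scale q l m = ennreal (\<Prod>i\<in>{l<..m}. rho q i) + back_scale q l (m + 1)"
  unfolding back_scale_def by (subst suminf_offset[where i = 1]) (auto simp: add_ac)

text \<open>The process waits at the constant W m until m is reached, then follows the scale
  function at the current site, and becomes 1 on returning to l. The last change does not raise it
  because W l \<ge> 1. Its expectation thus stays below W m and dominates the probability of a
  return by time n.\<close>

lemma backtrack_bound_finite:
  assumes q: "\<And>i. 0 < q i \<and> q i < 1" and m: "l < m" "0 \<le> m"
  shows "emeasure (layered_law q) {X. \<exists>k\<le>n. \<exists>j\<le>k. m \<le> fst (X j) \<and> fst (X k) \<le> l} \<le> back_scale q l m"
proof -
  define W where "W = back_scale q l"
  define ret where "ret n X \<longleftrightarrow> (\<exists>k\<le>n. \<exists>j\<le>k. m \<le> fst (X j) \<and> fst (X k) \<le> l)" for n and X :: path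
  define hit where "hit n X \<longleftrightarrow> (\<exists>k\<le>n. m \<le> fst (X k))" for n and X :: path
  define V where "V n X = (if ret n X then 1 else if hit n X then W (fst (X n)) else W m)" for n and X :: path
  have ret_cong: "ret n X = ret n Y" if eq: "\<And>k. k \<le> n \<Longrightarrow> X k = Y k" for n X Y
    unfolding ret_def using eq by (intro ex_cong conj_cong refl) auto
  have hit_cong: "hit n X = hit n Y" if eq: "\<And>k. k \<le> n \<Longrightarrow> X k = Y k" for n X Y
    unfolding hit_def using eq by auto
  have ad: "V n X = V n Y" if eq: "\<And>k. k \<le> n \<Longrightarrow> X k = Y k" for n X Y
  proof -
    have "ret n X = ret n Y" "hit n X = hit n Y"
      using eq by (auto intro!: ret_cong hit_cong)
    then show ?thesis by (simp add: V_def eq)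
  qed
  have "(\<integral>\<^sup>+X. V n X \<partial>layered_law q) \<le> V 0 (\<lambda>_. 0)"
  proof (rule layered_supermartingale[OF q ad])
    fix n and X :: path and i j
    assume X: "X n = (i, j)"
    have hit_Suc: "hit (Suc n) (X(Suc n := z)) \<longleftrightarrow> hit n X \<or> m \<le> fst z" for z
      unfolding hit_def ex_le_Suc_upd[where Q = "\<lambda>z. m \<le> fst z"] by simp
    have ret_Suc: "ret (Suc n) (X(Suc n := z)) \<longleftrightarrow> ret n X \<or> hit n X \<and> fst z \<le> l" for z
    proof -
      have "ret (Suc n) Y \<longleftrightarrow> ret n Y \<or> hit (Suc n) Y \<and> fst (Y (Suc n)) \<le> l" for Y
        unfolding ret_def hit_def ex_le_Suc[of n "\<lambda>k. \<exists>j\<le>k. m \<le> fst (Y j) \<and> fst (Y k) \<le> l"]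
        by (rule arg_cong2[where f = "(\<or>)"]) auto
      moreover have "ret n (X(Suc n := z)) = ret n X"
        by (rule ret_cong) simp
      ultimately have "ret (Suc n) (X(Suc n := z)) \<longleftrightarrow> ret n X \<or> hit (Suc n) (X(Suc n := z)) \<and> fst z \<le> l"
        by simp
      \<comment> \<open>If the new site is the first one at or beyond m, it is not also at or left
        of l, since l < m.\<close>
      then show ?thesis using m unfolding hit_Suc by auto
    qed
    have qi: "0 < q i" "q i < 1" using q by auto
    show "ennreal (q i / 2) * V (Suc n) (X(Suc n := (i + 1, j)))
       + ennreal (1 / 2 - q i / 2) * V (Suc n) (X(Suc n := (i - 1, j)))
       + (ennreal (1 / 4) * V (Suc n) (X(Suc n := (i, j + 1)))
       + ennreal (1 / 4) * V (Suc n) (X(Suc n := (i, j - 1)))) \<le> V n X"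
    proof (cases "ret n X \<or> \<not> hit n X")
      case True
      then show ?thesis
      proof
        assume "ret n X"
        then have "V (Suc n) (X(Suc n := z)) = 1" "V n X = 1" for z
          unfolding V_def ret_Suc by simp_all
        then show ?thesis using layered_average[OF qi, of 1] by simp
      next
        assume nh: "\<not> hit n X"
        then have "\<not> m \<le> fst (X n)" unfolding hit_def by blast
        then have "i < m" using X by simp
        have nb: "\<not> ret n X" using nh unfolding ret_def hit_def by (meson order_trans)
        \<comment> \<open>A first hit of m through a nearest-neighbour step lands on m itself, so
          the waiting value and the scale function agree there.\<close>
        have "V (Suc n) (X(Suc n := (a, b))) = W m" if "a \<le> m" for a b
          unfolding V_def ret_Suc hit_Suc using nh nb that by auto
        then have "V (Suc n) (X(Suc n := (i + 1, j))) = W m" "V (Suc n) (X(Suc n := (i - 1, j))) = W m"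
          "V (Suc n) (X(Suc n := (i, j + 1))) = W m" "V (Suc n) (X(Suc n := (i, j - 1))) = W m"
          using \<open>i < m\<close> by simp_all
        moreover have "V n X = W m" unfolding V_def using nh nb by simp
        ultimately show ?thesis using layered_average[OF qi, of "W m"] by simp
      qed
    next
      case False
      then have "\<not> fst (X n) \<le> l" unfolding ret_def hit_def by blast
      then have il: "l < i" using X by simp
      define a where "a = (\<Prod>i\<in>{l<..i - 1}. rho q i)"
      have a: "0 \<le> a" unfolding a_def using q less_imp_le[OF conjunct1[OF q]] less_imp_le[OF conjunct2[OF q]]
        by (intro prod_nonneg) (auto simp: rho_def)
      have "{l<..i} = insert i {l<..i - 1}" using il by auto
      then have Wi: "W i = ennreal (rho q i * a) + W (i + 1)"
        unfolding W_def a_def by (subst back_scale_step) simp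
      have Wi': "W (i - 1) = ennreal a + W i"
        unfolding W_def by (subst back_scale_step) (simp add: a_def)
      have VW: "V (Suc n) (X(Suc n := (b, c))) \<le> W b" if "b \<ge> i - 1" for b c
      proof (cases "b \<le> l")
        case True
        with that il have "b = l" by simp
        \<comment> \<open>The summand with index 0 is an empty product.\<close>
        have "1 \<le> W l" unfolding W_def by (subst back_scale_step) simp
        then show ?thesis using True \<open>b = l\<close> False by (simp add: V_def ret_Suc hit_Suc)
      next
        case nb: False
        then show ?thesis using False by (simp add: V_def ret_Suc hit_Suc)
      qed
      let ?G = "W (i + 1)"
      have "ennreal (q i / 2) * V (Suc n) (X(Suc n := (i + 1, j)))
       + ennreal (1 / 2 - q i / 2) * V (Suc n) (X(Suc n := (i - 1, j)))
       + (ennreal (1 / 4) * V (Suc n) (X(Suc n := (i, j + 1)))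
       + ennreal (1 / 4) * V (Suc n) (X(Suc n := (i, j - 1))))
       \<le> ennreal (q i / 2) * ?G
       + ennreal (1 / 2 - q i / 2) * (ennreal a + (ennreal (rho q i * a) + ?G))
       + (ennreal (1 / 4) * (ennreal (rho q i * a) + ?G)
       + ennreal (1 / 4) * (ennreal (rho q i * a) + ?G))"
        using VW[of "i+1" j] VW[of "i-1" j] VW[of i "j+1"] VW[of i "j-1"]
        unfolding Wi' unfolding Wi by (intro add_mono mult_left_mono) simp_all
      also have "\<dots> = ennreal (rho q i * a) + ?G"
      proof (rule backtrack_average[OF layered_weights[OF qi]])
        have "ennreal (1 / 2 - q i / 2) * ennreal a = ennreal ((1 / 2 - q i / 2) * a)"
          using qi a by (intro ennreal_mult[symmetric]) auto
        also have "(1 / 2 - q i / 2) * a = q i / 2 * (rho q i * a)"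
          using qi by (simp add: rho_def field_simps)
        also have "ennreal \<dots> = ennreal (q i / 2) * ennreal (rho q i * a)"
          using qi a by (intro ennreal_mult) (auto simp: rho_def)
        finally show "ennreal (1 / 2 - q i / 2) * ennreal a = ennreal (q i / 2) * ennreal (rho q i * a)" .
      qed
      also have "\<dots> = V n X"
        unfolding V_def Wi[symmetric] using False X by simp
      finally show ?thesis .
    qed
  qed
  also have "V 0 (\<lambda>_. 0) = W m"
  proof -
    have "\<not> ret 0 (\<lambda>_. 0)" using m by (simp add: ret_def)
    moreover have "hit 0 (\<lambda>_. 0) \<longleftrightarrow> m \<le> 0" by (simp add: hit_def)
    \<comment> \<open>If m = 0 the target is hit at time 0, and the initial value is W m all the
      same.\<close>
    moreover have "m \<le> 0 \<Longrightarrow> m = 0" using m by simp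
    ultimately show ?thesis by (cases "m \<le> 0") (simp_all add: V_def)
  qed
  finally have "(\<integral>\<^sup>+X. V n X \<partial>layered_law q) \<le> W m" .
  moreover have "1 * emeasure (layered_law q) {X. ret n X} \<le> (\<integral>\<^sup>+X. V n X \<partial>layered_law q)"
    by (rule emeasure_le_nn_integral[OF _ nn_integral_adapted(1)[OF ad]]) (simp add: V_def)
  ultimately have "emeasure (layered_law q) {X. ret n X} \<le> W m" by simp
  then show ?thesis by (simp add: ret_def W_def)
qed

lemma backtrack_bound:
  assumes q: "\<And>i. 0 < q i \<and> q i < 1" and m: "l < m" "0 \<le> m"
  shows "emeasure (layered_law q) {X. \<exists>k. \<exists>j\<le>k. m \<le> fst (X j) \<and> fst (X k) \<le> l} \<le> back_scale q l m"
proof -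
  let ?A = "\<lambda>n. {X :: path. \<exists>k\<le>n. \<exists>j\<le>k. m \<le> fst (X j) \<and> fst (X k) \<le> l}"
  have "?A n \<in> sets path_space" for n
  proof -
    have "?A n = (\<Union>k\<in>{..n}. \<Union>j\<in>{..k}. {X. m \<le> fst (X j)} \<inter> {X. fst (X k) \<le> l})"
      by auto
    also have "\<dots> \<in> sets path_space"
      by (intro sets.finite_UN sets.Int sets_path_space_at finite_atMost)
    finally show ?thesis .
  qed
  moreover have "incseq ?A"
  proof (rule incseq_SucI)
    have "{X. \<exists>k\<le>n. P k X} \<subseteq> {X. \<exists>k\<le>Suc n. P k X}" for n and P :: "nat \<Rightarrow> path \<Rightarrow> bool"
      by (blast intro: le_SucI)
    then show "?A n \<subseteq> ?A (Suc n)" for n .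
  qed
  ultimately have 1: "(SUP n. emeasure (layered_law q) (?A n)) = emeasure (layered_law q) (\<Union>n. ?A n)"
    by (intro SUP_emeasure_incseq) (simp_all add: image_subset_iff)
  have 2: "(\<Union>n. ?A n) = {X. \<exists>k. \<exists>j\<le>k. m \<le> fst (X j) \<and> fst (X k) \<le> l}"
  proof -
    have "(\<Union>n. {X. \<exists>k\<le>n. P k X}) = {X. \<exists>k. P k X}" for P :: "nat \<Rightarrow> path \<Rightarrow> bool"
      by blast
    then show ?thesis .
  qed
  show ?thesis
    unfolding 2[symmetric] 1[symmetric] by (rule SUP_least) (rule backtrack_bound_finite[OF q m])
qed

section \<open>Vertical displacements\<close>

text \<open>A maximal inequality through an explicit process. A step has vertical variance 1/2, so
  the squared height plus half the remaining time is a martingale starting at n / 2. Replacing it by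
  a^2 from the first time the height reaches a only lowers it, as the remaining time is
  nonnegative.\<close>

lemma vertical_maximal_bound:
  assumes q: "\<And>i. 0 < q i \<and> q i < 1" and a: "0 < a"
  shows "emeasure (layered_law q) {X. \<exists>k\<le>n. a \<le> \<bar>real_of_int (snd (X k))\<bar>} \<le> ennreal (real n / (2 * a\<^sup>2))"
proof -
  define V where "V k X = (if \<exists>j\<le>k. a \<le> \<bar>real_of_int (snd (X j))\<bar> then ennreal (a\<^sup>2)
      else ennreal ((real_of_int (snd (X k)))\<^sup>2 + (real n - real k) / 2))" for k and X :: path
  have ad: "V n X = V n Y" if eq: "\<And>k. k \<le> n \<Longrightarrow> X k = Y k" for n X Y
  proof -
    have "(\<exists>k\<le>n. a \<le> \<bar>real_of_int (snd (X k))\<bar>) = (\<exists>k\<le>n. a \<le> \<bar>real_of_int (snd (Y k))\<bar>)" using eq by auto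
    then show ?thesis by (simp only: V_def eq order_refl)
  qed
  have "(\<integral>\<^sup>+X. V n X \<partial>layered_law q) \<le> V 0 (\<lambda>_. 0)"
  proof (rule layered_supermartingale[OF q ad])
    fix k and X :: path and i j
    assume k: "k < n" and X: "X k = (i, j)"
    have V_Suc: "V (Suc k) (X(Suc k := (b, c))) = (if (\<exists>j\<le>k. a \<le> \<bar>real_of_int (snd (X j))\<bar>) \<or> a \<le> \<bar>real_of_int c\<bar>
        then ennreal (a\<^sup>2) else ennreal ((real_of_int c)\<^sup>2 + (real n - real (Suc k)) / 2))" for b c
      unfolding V_def ex_le_Suc_upd[where Q = "\<lambda>z. a \<le> \<bar>real_of_int (snd z)\<bar>"] by (simp only: fun_upd_same snd_conv)
    have qi: "0 < q i" "q i < 1" using q by auto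
    show "ennreal (q i / 2) * V (Suc k) (X(Suc k := (i + 1, j)))
       + ennreal (1 / 2 - q i / 2) * V (Suc k) (X(Suc k := (i - 1, j)))
       + (ennreal (1 / 4) * V (Suc k) (X(Suc k := (i, j + 1)))
       + ennreal (1 / 4) * V (Suc k) (X(Suc k := (i, j - 1)))) \<le> V k X"
    proof (cases "\<exists>j\<le>k. a \<le> \<bar>real_of_int (snd (X j))\<bar>")
      case True
      then show ?thesis
        unfolding V_Suc unfolding V_def
        using layered_average[OF qi, of "ennreal (a\<^sup>2)"] by (simp only: if_True simp_thms)
    next
      case False
      have r: "0 \<le> (real n - real (Suc k)) / 2" using k by simp
      have V_le: "V (Suc k) (X(Suc k := (b, c))) \<le> ennreal ((real_of_int c)\<^sup>2 + (real n - real (Suc k)) / 2)" for b c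
      proof (cases "a \<le> \<bar>real_of_int c\<bar>")
        case True
        then have "a\<^sup>2 \<le> (real_of_int c)\<^sup>2"
          using a by (metis abs_ge_zero abs_le_square_iff abs_of_pos)
        with r have "a\<^sup>2 \<le> (real_of_int c)\<^sup>2 + (real n - real (Suc k)) / 2" by linarith
        then show ?thesis
          unfolding V_Suc using True by (simp only: simp_thms if_True ennreal_leI)
      next
        case na: False
        then show ?thesis
          unfolding V_Suc using False by (simp only: if_False simp_thms order_refl)
      qed
      have "ennreal (q i / 2) * V (Suc k) (X(Suc k := (i + 1, j)))
       + ennreal (1 / 2 - q i / 2) * V (Suc k) (X(Suc k := (i - 1, j)))
       + (ennreal (1 / 4) * V (Suc k) (X(Suc k := (i, j + 1)))
       + ennreal (1 / 4) * V (Suc k) (X(Suc k := (i, j - 1))))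
       \<le> ennreal (q i / 2) * ennreal ((real_of_int j)\<^sup>2 + (real n - real (Suc k)) / 2)
       + ennreal (1 / 2 - q i / 2) * ennreal ((real_of_int j)\<^sup>2 + (real n - real (Suc k)) / 2)
       + (ennreal (1 / 4) * ennreal ((real_of_int (j + 1))\<^sup>2 + (real n - real (Suc k)) / 2)
       + ennreal (1 / 4) * ennreal ((real_of_int (j - 1))\<^sup>2 + (real n - real (Suc k)) / 2))"
        by (intro add_mono mult_left_mono V_le) auto
      also have "\<dots> = ennreal ((real_of_int j)\<^sup>2 + (real n - real k) / 2)"
      proof -
        define u where "u = (real n - real (Suc k)) / 2"
        have u: "0 \<le> u" "(real n - real k) / 2 = u + 1 / 2" using r by (simp_all add: u_def field_simps)
        have "q i / 2 * ((real_of_int j)\<^sup>2 + u) + (1 / 2 - q i / 2) * ((real_of_int j)\<^sup>2 + u)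
           + (1 / 4 * ((real_of_int (j + 1))\<^sup>2 + u) + 1 / 4 * ((real_of_int (j - 1))\<^sup>2 + u))
           = (real_of_int j)\<^sup>2 + (u + 1 / 2)"
          by (simp add: field_simps power2_eq_square)
        then show ?thesis
          unfolding u_def[symmetric] u(2) using qi u(1) by (subst ennreal_average) simp_all
      qed
      also have "\<dots> = V k X"
        unfolding V_def using False X by (simp only: if_False simp_thms snd_conv)
      finally show ?thesis .
    qed
  qed
  also have "V 0 (\<lambda>_. 0) = ennreal (real n / 2)"
    using a by (simp add: V_def)
  finally have "(\<integral>\<^sup>+X. V n X \<partial>layered_law q) \<le> ennreal (real n / 2)" .
  moreover have "ennreal (a\<^sup>2) * emeasure (layered_law q) {X. \<exists>k\<le>n. a \<le> \<bar>real_of_int (snd (X k))\<bar>}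
      \<le> (\<integral>\<^sup>+X. V n X \<partial>layered_law q)"
    by (rule emeasure_le_nn_integral[OF _ nn_integral_adapted(1)[OF ad]]) (auto simp: V_def)
  ultimately have *: "ennreal (a\<^sup>2) * emeasure (layered_law q) {X. \<exists>k\<le>n. a \<le> \<bar>real_of_int (snd (X k))\<bar>}
      \<le> ennreal (real n / 2)" by (rule order_trans[rotated])
  have "ennreal (a\<^sup>2) * measure (layered_law q) {X. \<exists>k\<le>n. a \<le> \<bar>real_of_int (snd (X k))\<bar>} \<le> ennreal (real n / 2)"
    using * by (simp add: quenched.emeasure_eq_measure)
  then have "a\<^sup>2 * measure (layered_law q) {X. \<exists>k\<le>n. a \<le> \<bar>real_of_int (snd (X k))\<bar>} \<le> real n / 2"
    by (simp add: ennreal_mult[symmetric])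
  then show ?thesis
    unfolding quenched.emeasure_eq_measure using a by (intro ennreal_leI) (simp add: field_simps)
qed

section \<open>Exponential bounds for functions of bounded increments\<close>

lemma exp_le_quadratic:
  fixes u :: real
  assumes "\<bar>u\<bar> \<le> 1"
  shows "exp u \<le> 1 + u + u\<^sup>2"
proof (cases "0 \<le> u")
  case True
  then show ?thesis using exp_bound[of u] assms by simp
next
  case False
  define v where "v = - u"
  have v: "0 < v" "v \<le> 1" using False assms by (auto simp: v_def)
  have "1 + v \<le> exp v" by simp
  \<comment> \<open>The product equals 1 + v^3.\<close>
  moreover have "1 \<le> (1 + v) * (1 - v + v\<^sup>2)"
    using v by (simp add: algebra_simps power2_eq_square)
  moreover have "0 \<le> 1 - v + v\<^sup>2" using v by simp
  ultimately have "1 \<le> exp v * (1 - v + v\<^sup>2)"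
    by (meson mult_right_mono order_trans)
  then show ?thesis by (simp add: v_def exp_minus field_simps)
qed

text \<open>An Azuma-type bound. With increments at most C and \<theta> C \<le> 1, the quadratic
  bound on exp makes exp (\<theta> F (X n) - c n) a supermartingale for c = \<theta> \<mu> +
  (\<theta> C)^2; Markov's inequality then gives the tail.\<close>

lemma drift_tail_bound:
  fixes F :: "site \<Rightarrow> real"
  assumes q: "\<And>i. 0 < q i \<and> q i < 1"
    and C: "\<And>z d. \<bar>F (z + dir_vec d) - F z\<bar> \<le> C"
    and F0: "F 0 = 0"
    and drift: "\<And>i j. q i / 2 * F (i + 1, j) + (1 / 2 - q i / 2) * F (i - 1, j)
        + 1 / 4 * F (i, j + 1) + 1 / 4 * F (i, j - 1) \<le> F (i, j) + \<mu>"
    and lam: "0 \<le> \<theta>" "\<theta> * C \<le> 1"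
  shows "emeasure (layered_law q) {X. (\<mu> + \<delta>) * real n \<le> F (X n)} \<le> ennreal (exp (- (\<theta> * \<delta> - (\<theta> * C)\<^sup>2) * real n))"
proof -
  define c where "c = \<theta> * \<mu> + (\<theta> * C)\<^sup>2"
  define V where "V n X = ennreal (exp (\<theta> * F (X n) - c * real n))" for n and X :: path
  have ad: "V n X = V n Y" if "\<And>k. k \<le> n \<Longrightarrow> X k = Y k" for n X Y
    using that by (simp add: V_def)
  have "(\<integral>\<^sup>+X. V n X \<partial>layered_law q) \<le> V 0 (\<lambda>_. 0)"
  proof (rule layered_supermartingale[OF q ad])
    fix k and X :: path and i j
    assume X: "X k = (i, j)"
    have qi: "0 < q i" "q i < 1" using q by auto
    define K where "K = \<theta> * F (i, j) - c * real (Suc k)"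
    define D where "D z = F z - F (i, j)" for z
    have D: "exp (\<theta> * D ((i, j) + dir_vec d)) \<le> 1 + \<theta> * D ((i, j) + dir_vec d) + (\<theta> * C)\<^sup>2" for d
    proof -
      have 1: "\<bar>\<theta> * D ((i, j) + dir_vec d)\<bar> \<le> \<theta> * C"
        unfolding D_def abs_mult using C lam by (simp add: mult_left_mono)
      then have "(\<theta> * D ((i, j) + dir_vec d))\<^sup>2 \<le> (\<theta> * C)\<^sup>2"
        by (metis abs_le_square_iff abs_ge_self order_trans)
      then show ?thesis using exp_le_quadratic[of "\<theta> * D ((i, j) + dir_vec d)"] 1 lam by simp
    qed
    have V_Suc: "V (Suc k) (X(Suc k := z)) = ennreal (exp K * exp (\<theta> * D z))" for z
      unfolding V_def K_def D_def by (simp add: exp_add[symmetric] algebra_simps)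
    have "q i / 2 * exp (\<theta> * D (i + 1, j)) + (1 / 2 - q i / 2) * exp (\<theta> * D (i - 1, j))
        + (1 / 4 * exp (\<theta> * D (i, j + 1)) + 1 / 4 * exp (\<theta> * D (i, j - 1)))
      \<le> q i / 2 * (1 + \<theta> * D (i + 1, j) + (\<theta> * C)\<^sup>2) + (1 / 2 - q i / 2) * (1 + \<theta> * D (i - 1, j) + (\<theta> * C)\<^sup>2)
        + (1 / 4 * (1 + \<theta> * D (i, j + 1) + (\<theta> * C)\<^sup>2) + 1 / 4 * (1 + \<theta> * D (i, j - 1) + (\<theta> * C)\<^sup>2))"
      using D[of PosE1] D[of NegE1] D[of PosE2] D[of NegE2] qi
      by (intro add_mono mult_left_mono) auto
    also have "\<dots> = 1 + (\<theta> * C)\<^sup>2 + \<theta> * (q i / 2 * F (i + 1, j) + (1 / 2 - q i / 2) * F (i - 1, j)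
        + 1 / 4 * F (i, j + 1) + 1 / 4 * F (i, j - 1) - F (i, j))"
      unfolding D_def by (simp add: field_simps)
    also have "\<dots> \<le> 1 + (\<theta> * C)\<^sup>2 + \<theta> * \<mu>"
      using drift[of i j] lam by (intro add_left_mono mult_left_mono) auto
    also have "\<dots> \<le> exp c"
      using exp_ge_add_one_self[of c] unfolding c_def by linarith
    finally have *: "q i / 2 * exp (\<theta> * D (i + 1, j)) + (1 / 2 - q i / 2) * exp (\<theta> * D (i - 1, j))
        + (1 / 4 * exp (\<theta> * D (i, j + 1)) + 1 / 4 * exp (\<theta> * D (i, j - 1))) \<le> exp c" .
    have "ennreal (q i / 2) * V (Suc k) (X(Suc k := (i + 1, j)))
       + ennreal (1 / 2 - q i / 2) * V (Suc k) (X(Suc k := (i - 1, j)))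
       + (ennreal (1 / 4) * V (Suc k) (X(Suc k := (i, j + 1)))
       + ennreal (1 / 4) * V (Suc k) (X(Suc k := (i, j - 1))))
      = ennreal (exp K * (q i / 2 * exp (\<theta> * D (i + 1, j)) + (1 / 2 - q i / 2) * exp (\<theta> * D (i - 1, j))
        + (1 / 4 * exp (\<theta> * D (i, j + 1)) + 1 / 4 * exp (\<theta> * D (i, j - 1)))))"
      unfolding V_Suc using qi by (subst ennreal_average) (auto simp: algebra_simps)
    also have "\<dots> \<le> ennreal (exp K * exp c)"
      using * by (intro ennreal_leI mult_left_mono) auto
    also have "\<dots> = V k X"
      unfolding V_def X K_def by (simp add: exp_add[symmetric] algebra_simps)
    finally show "ennreal (q i / 2) * V (Suc k) (X(Suc k := (i + 1, j)))
       + ennreal (1 / 2 - q i / 2) * V (Suc k) (X(Suc k := (i - 1, j)))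
       + (ennreal (1 / 4) * V (Suc k) (X(Suc k := (i, j + 1)))
       + ennreal (1 / 4) * V (Suc k) (X(Suc k := (i, j - 1)))) \<le> V k X" .
  qed
  also have "V 0 (\<lambda>_. 0) = 1"
    using F0 by (simp add: V_def)
  finally have "(\<integral>\<^sup>+X. V n X \<partial>layered_law q) \<le> 1" .
  moreover have "ennreal (exp ((\<theta> * \<delta> - (\<theta> * C)\<^sup>2) * real n)) * emeasure (layered_law q) {X. (\<mu> + \<delta>) * real n \<le> F (X n)}
      \<le> (\<integral>\<^sup>+X. V n X \<partial>layered_law q)"
  proof (rule emeasure_le_nn_integral[OF _ nn_integral_adapted(1)[OF ad]])
    fix X :: path assume "X \<in> {X. (\<mu> + \<delta>) * real n \<le> F (X n)}"
    then have "\<theta> * ((\<mu> + \<delta>) * real n) \<le> \<theta> * F (X n)"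
      using lam by (intro mult_left_mono) auto
    then show "ennreal (exp ((\<theta> * \<delta> - (\<theta> * C)\<^sup>2) * real n)) \<le> V n X"
      unfolding V_def c_def by (intro ennreal_leI) (simp add: algebra_simps)
  qed
  ultimately have "ennreal (exp ((\<theta> * \<delta> - (\<theta> * C)\<^sup>2) * real n)) * emeasure (layered_law q) {X. (\<mu> + \<delta>) * real n \<le> F (X n)} \<le> 1"
    by (rule order_trans[rotated])
  then have 1: "exp ((\<theta> * \<delta> - (\<theta> * C)\<^sup>2) * real n) * measure (layered_law q) {X. (\<mu> + \<delta>) * real n \<le> F (X n)} \<le> 1"
    by (simp add: quenched.emeasure_eq_measure ennreal_mult[symmetric] ennreal_le_1)
  have "measure (layered_law q) {X. (\<mu> + \<delta>) * real n \<le> F (X n)} \<le> 1 / exp ((\<theta> * \<delta> - (\<theta> * C)\<^sup>2) * real n)"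
    by (subst pos_le_divide_eq) (use 1 in \<open>simp_all only: exp_gt_zero mult.commute\<close>)
  also have "\<dots> = exp (- (\<theta> * \<delta> - (\<theta> * C)\<^sup>2) * real n)"
    by (simp only: exp_minus inverse_eq_divide minus_mult_left[symmetric])
  finally show ?thesis
    unfolding quenched.emeasure_eq_measure by (rule ennreal_leI)
qed

lemma AE_drift_bound:
  fixes F :: "site \<Rightarrow> real"
  assumes q: "\<And>i. 0 < q i \<and> q i < 1"
    and C: "\<And>z d. \<bar>F (z + dir_vec d) - F z\<bar> \<le> C"
    and F0: "F 0 = 0"
    and drift: "\<And>i j. q i / 2 * F (i + 1, j) + (1 / 2 - q i / 2) * F (i - 1, j)
        + 1 / 4 * F (i, j + 1) + 1 / 4 * F (i, j - 1) \<le> F (i, j) + \<mu>"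
    and \<delta>: "0 < \<delta>"
  shows "AE X in layered_law q. eventually (\<lambda>n. F (X n) < (\<mu> + \<delta>) * real n) sequentially"
proof -
  define C' where "C' = max C 1"
  have C': "0 < C'" "C \<le> C'" by (auto simp: C'_def)
  \<comment> \<open>The first entry gives \<theta> C' \<le> 1, the second (\<theta> C')^2 \<le>
    \<theta> \<delta> / 2, so the decay rate r is at least \<theta> \<delta> / 2. Enlarging C to C'
    keeps the denominators positive.\<close>
  define \<theta> where "\<theta> = min (1 / C') (\<delta> / (2 * C'\<^sup>2))"
  have l: "0 < \<theta>" "\<theta> \<le> 1 / C'" "\<theta> \<le> \<delta> / (2 * C'\<^sup>2)" using C' \<delta> by (auto simp: \<theta>_def)
  define r where "r = \<theta> * \<delta> - (\<theta> * C')\<^sup>2"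
  have "\<theta> * (\<theta> * C'\<^sup>2) \<le> \<theta> * (\<delta> / 2)"
    using l C' by (intro mult_left_mono) (auto simp: field_simps)
  moreover have "0 < \<theta> * \<delta>" using l \<delta> by simp
  ultimately have r: "0 < r"
    unfolding r_def by (simp add: power2_eq_square algebra_simps)
  let ?A = "\<lambda>n. {X :: path. (\<mu> + \<delta>) * real n \<le> F (X n)}"
  have bound: "emeasure (layered_law q) (?A n) \<le> ennreal (exp (- r) ^ n)" for n
  proof -
    have "emeasure (layered_law q) (?A n) \<le> ennreal (exp (- (\<theta> * \<delta> - (\<theta> * C')\<^sup>2) * real n))"
    proof (rule drift_tail_bound[OF q _ F0 drift])
      show "\<bar>F (z + dir_vec d) - F z\<bar> \<le> C'" for z d
        using C[of z d] C' by linarith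
      show "\<theta> * C' \<le> 1" using l C' by (simp add: field_simps)
    qed (use l in auto)
    moreover have "- (\<theta> * \<delta> - (\<theta> * C')\<^sup>2) * real n = real n * (- r)"
      by (simp add: r_def)
    ultimately show ?thesis by (simp only: exp_of_nat_mult)
  qed
  have meas: "?A n \<in> sets (layered_law q)" for n
    using sets_path_space_at[of "\<lambda>z. (\<mu> + \<delta>) * real n \<le> F z" n] by simp
  have "AE X in layered_law q. eventually (\<lambda>n. X \<in> space (layered_law q) - ?A n) sequentially"
  proof (rule borel_cantelli_AE1[OF meas])
    show "emeasure (layered_law q) (?A n) < \<infinity>" for n
      by (simp add: quenched.emeasure_eq_measure)
    have "summable (\<lambda>n. exp (- r) ^ n)"
      using r by (intro summable_geometric) simp
    then show "summable (\<lambda>n. measure (layered_law q) (?A n))"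
      by (rule summable_comparison_test'[where N = 0])
         (use bound in \<open>simp add: quenched.emeasure_eq_measure\<close>)
  qed
  then show ?thesis
    by (rule AE_mp) (auto intro!: AE_I2 elim!: eventually_mono simp: not_le)
qed

section \<open>Annealed estimates\<close>

text \<open>Either one summand exceeds 1 and alone dominates the left side, or no truncation is
  active.\<close>

lemma min_one_sum:
  fixes a :: "'b \<Rightarrow> ennreal"
  assumes "finite A"
  shows "min 1 (\<Sum>j\<in>A. a j) \<le> (\<Sum>j\<in>A. min 1 (a j))"
proof (cases "\<exists>j\<in>A. 1 < a j")
  case True
  then obtain j where j: "j \<in> A" "1 < a j" by auto
  have "min 1 (\<Sum>j\<in>A. a j) \<le> min 1 (a j)" using j by simp
  also have "\<dots> \<le> (\<Sum>j\<in>A. min 1 (a j))" using j assms by (intro member_le_sum) auto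
  finally show ?thesis .
next
  case False
  then have "(\<Sum>j\<in>A. min 1 (a j)) = (\<Sum>j\<in>A. a j)"
    by (intro sum.cong) (auto simp: not_less min_absorb2)
  then show ?thesis by simp
qed

lemma min_one_suminf:
  fixes a :: "nat \<Rightarrow> ennreal"
  shows "min 1 (\<Sum>j. a j) \<le> (\<Sum>j. min 1 (a j))"
proof (cases "\<exists>j. 1 < a j")
  case True
  then obtain j where j: "1 < a j" by auto
  have "min 1 (\<Sum>j. a j) \<le> min 1 (a j)" using j by simp
  also have "\<dots> = (\<Sum>j\<in>{j}. min 1 (a j))" by simp
  also have "\<dots> \<le> (\<Sum>j. min 1 (a j))" by (intro sum_le_suminf) auto
  finally show ?thesis .
next
  case False
  then have "(\<lambda>j. min 1 (a j)) = a"
    by (auto simp: not_less min_absorb2)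
  then show ?thesis by simp
qed

lemma min_one_le_powr:
  assumes "0 \<le> x" "0 < s" "s \<le> 1"
  shows "min 1 (ennreal x) \<le> ennreal (x powr s)"
proof (cases "x \<le> 1")
  case True
  have "x \<le> x powr s"
    using powr_mono'[of s 1 x] assms True by simp
  then show ?thesis by (simp add: min.coboundedI2 ennreal_leI)
next
  case False
  then have "1 powr s \<le> x powr s" using assms by (intro powr_mono2) auto
  then have "1 \<le> x powr s" by simp
  then show ?thesis by (intro min.coboundedI1) (simp add: ennreal_leI flip: ennreal_1)
qed

lemma powr_add_le:
  fixes a b s :: real
  assumes "0 \<le> a" "0 \<le> b" "0 < s" "s \<le> 1"
  shows "(a + b) powr s \<le> a powr s + b powr s"
proof (cases "a + b = 0")
  case True
  then show ?thesis using assms by (simp add: add_nonneg_eq_0_iff)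
next
  case False
  then have ab: "0 < a + b" using assms by simp
  \<comment> \<open>For t in [0, 1] and s \<le> 1, t \<le> t powr s. Here t is the share of x in a +
    b, and the two shares add up to 1.\<close>
  have *: "x / (a + b) * (a + b) powr s \<le> x powr s" if "0 \<le> x" "x \<le> a + b" for x
  proof -
    have "x / (a + b) \<le> (x / (a + b)) powr s"
      using powr_mono'[of s 1 "x / (a + b)"] that ab assms by simp
    then have "x / (a + b) * (a + b) powr s \<le> (x / (a + b)) powr s * (a + b) powr s"
      by (rule mult_right_mono) simp
    also have "\<dots> = x powr s" using that ab by (simp add: powr_divide)
    finally show ?thesis .
  qed
  have "(a + b) powr s = a / (a + b) * (a + b) powr s + b / (a + b) * (a + b) powr s"
    using ab by (simp add: distrib_right[symmetric] add_divide_distrib[symmetric])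
  also have "\<dots> \<le> a powr s + b powr s"
    using *[of a] *[of b] assms by (intro add_mono) auto
  finally show ?thesis .
qed

section \<open>Averaging over independent layers\<close>

text \<open>The copies agree with p in law only, so the range (0, 1) is available almost surely
  rather than everywhere.\<close>

locale iid_layers = prob_space \<Omega> for \<Omega> :: "'a measure" +
  fixes P :: "int \<Rightarrow> 'a \<Rightarrow> real"
  assumes indep: "indep_vars (\<lambda>_. borel) P UNIV"
    and ident: "\<And>i j. distr \<Omega> borel (P i) = distr \<Omega> borel (P j)"
    and AE_range: "AE \<xi> in \<Omega>. \<forall>i. 0 < P i \<xi> \<and> P i \<xi> < 1"
begin

definition Q :: "(env \<times> path) measure" where
  "Q = annealed_law (distr \<Omega> env_space (\<lambda>\<xi>. layered_env (\<lambda>i. P i \<xi>)))"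

abbreviation qlaw :: "'a \<Rightarrow> path measure" where
  "qlaw \<xi> \<equiv> layered_law (\<lambda>i. P i \<xi>)"

lemma measurable_P [measurable]: "P i \<in> borel_measurable \<Omega>"
  using indep unfolding indep_vars_def by auto

lemma measurable_layers [measurable]: "(\<lambda>\<xi>. layered_env (\<lambda>i. P i \<xi>)) \<in> \<Omega> \<rightarrow>\<^sub>M env_space"
  by (rule measurable_compose[OF _ measurable_layered_env])
     (rule measurable_PiM_single'; simp add: space_PiM)

lemma env_law: "prob_space (distr \<Omega> env_space (\<lambda>\<xi>. layered_env (\<lambda>i. P i \<xi>)))"
  "sets (distr \<Omega> env_space (\<lambda>\<xi>. layered_env (\<lambda>i. P i \<xi>))) = sets env_space"
  by (auto intro: prob_space_distr)

lemma sets_Q [simp, measurable_cong]: "sets Q = sets (env_space \<Otimes>\<^sub>M path_space)"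
  unfolding Q_def by (rule sets_annealed_law[OF env_law])

lemma space_Q [simp]: "space Q = UNIV"
  using sets_eq_imp_space_eq[OF sets_Q] by (simp add: space_pair_measure)

sublocale annealed: prob_space Q
  unfolding Q_def by (rule prob_space_annealed_law[OF env_law])

lemma emeasure_Q:
  assumes "A \<in> sets (env_space \<Otimes>\<^sub>M path_space)"
  shows "emeasure Q A = (\<integral>\<^sup>+\<xi>. emeasure (qlaw \<xi>) {X. (layered_env (\<lambda>i. P i \<xi>), X) \<in> A} \<partial>\<Omega>)"
proof -
  have "(\<lambda>\<omega>. emeasure (distr (quenched_law \<omega>) (env_space \<Otimes>\<^sub>M path_space) (Pair \<omega>)) A) \<in> borel_measurable env_space"
    by (rule measurable_compose[OF measurable_prob_algebraD[OF measurable_quenched_joint]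
          measurable_emeasure_subprob_algebra[OF assms]])
  then have "(\<lambda>\<omega>. emeasure (quenched_law \<omega>) {X. (\<omega>, X) \<in> A}) \<in> borel_measurable env_space"
    using assms by (simp add: emeasure_distr vimage_def)
  then show ?thesis
    unfolding Q_def emeasure_annealed_law[OF env_law assms]
    by (subst nn_integral_distr) simp_all
qed

lemma path_event: "B \<in> sets path_space \<Longrightarrow> {(\<omega>, X). X \<in> B} \<in> sets (env_space \<Otimes>\<^sub>M path_space)"
proof -
  assume [measurable]: "B \<in> sets path_space"
  have "{w \<in> space (env_space \<Otimes>\<^sub>M path_space). snd w \<in> B} \<in> sets (env_space \<Otimes>\<^sub>M path_space)"
    by measurable
  then show ?thesis by (simp add: space_pair_measure case_prod_unfold)
qed

lemma emeasure_Q_path: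
  assumes "B \<in> sets path_space"
  shows "emeasure Q {(\<omega>, X). X \<in> B} = (\<integral>\<^sup>+\<xi>. emeasure (qlaw \<xi>) B \<partial>\<Omega>)"
  by (subst emeasure_Q[OF path_event[OF assms]]) simp

lemma AE_Q:
  assumes "{X. R X} \<in> sets path_space"
    and "AE \<xi> in \<Omega>. AE X in qlaw \<xi>. R X"
  shows "AE (\<omega>, X) in Q. R X"
proof -
  have B: "{X. \<not> R X} \<in> sets path_space"
    using sets.compl_sets[OF assms(1)] by (simp add: Collect_neg_eq Compl_eq_Diff_UNIV)
  have "AE \<xi> in \<Omega>. emeasure (qlaw \<xi>) {X. \<not> R X} = 0"
    using assms(2)
  proof (rule AE_mp, intro AE_I2 impI)
    fix \<xi> assume "AE X in qlaw \<xi>. R X"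
    then show "emeasure (qlaw \<xi>) {X. \<not> R X} = 0"
      using B by (subst (asm) AE_iff_measurable[OF _ refl]) auto
  qed
  then have "emeasure Q {(\<omega>, X). X \<in> {X. \<not> R X}} = 0"
    unfolding emeasure_Q_path[OF B] by (subst nn_integral_cong_AE[where v = "\<lambda>_. 0"]) auto
  then show ?thesis
    using path_event[OF B] by (intro AE_I[where N = "{(\<omega>, X). X \<in> {X. \<not> R X}}"]) auto
qed

text \<open>The minimum with 1 costs nothing, as quenched probabilities are at most 1, but it keeps
  the average finite when f has infinite mean.\<close>

lemma emeasure_Q_path_le:
  assumes "B \<in> sets path_space"
    and "\<And>q. (\<And>i. 0 < q i \<and> q i < 1) \<Longrightarrow> emeasure (layered_law q) B \<le> f q"
  shows "emeasure Q {(\<omega>, X). X \<in> B} \<le> (\<integral>\<^sup>+\<xi>. min 1 (f (\<lambda>i. P i \<xi>)) \<partial>\<Omega>)"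
  unfolding emeasure_Q_path[OF assms(1)]
proof (rule nn_integral_mono_AE)
  show "AE \<xi> in \<Omega>. emeasure (qlaw \<xi>) B \<le> min 1 (f (\<lambda>i. P i \<xi>))"
    using AE_range by (rule AE_mp) (auto intro!: AE_I2 assms(2) quenched.measure_le_1)
qed

lemma ident_nn_integral:
  assumes "f \<in> borel_measurable borel"
  shows "(\<integral>\<^sup>+\<xi>. f (P i \<xi>) \<partial>\<Omega>) = (\<integral>\<^sup>+\<xi>. f (P 0 \<xi>) \<partial>\<Omega>)"
  using assms nn_integral_distr[of "P i" \<Omega> borel f] nn_integral_distr[of "P 0" \<Omega> borel f] ident[of i 0]
  by simp

lemma nn_integral_prod_layers:
  fixes f :: "real \<Rightarrow> ennreal"
  assumes "finite A" and f: "f \<in> borel_measurable borel"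
  shows "(\<integral>\<^sup>+\<xi>. (\<Prod>i\<in>A. f (P i \<xi>)) \<partial>\<Omega>) = (\<integral>\<^sup>+\<xi>. f (P 0 \<xi>) \<partial>\<Omega>) ^ card A"
proof -
  have "indep_vars (\<lambda>_. borel) P A" using indep by (rule indep_vars_subset) simp
  then have "indep_vars (\<lambda>_. borel) (\<lambda>i \<xi>. f (P i \<xi>)) A"
    by (rule indep_vars_compose2) (rule f)
  then have "(\<integral>\<^sup>+\<xi>. (\<Prod>i\<in>A. f (P i \<xi>)) \<partial>\<Omega>) = (\<Prod>i\<in>A. \<integral>\<^sup>+\<xi>. f (P i \<xi>) \<partial>\<Omega>)"
    using assms(1) by (intro indep_vars_nn_integral) auto
  also have "\<dots> = (\<Prod>i\<in>A. \<integral>\<^sup>+\<xi>. f (P 0 \<xi>) \<partial>\<Omega>)"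
    by (intro prod.cong refl ident_nn_integral f)
  finally show ?thesis by simp
qed

end

text \<open>The single moment condition behind all annealed estimates. The exponent s stays a
  parameter because different conclusions use different values below \<kappa>.\<close>

locale contracting_layers = iid_layers +
  fixes s r :: real
  assumes s: "0 < s" "s \<le> 1" and r: "0 \<le> r" "r < 1"
    and moment: "(\<integral>\<^sup>+\<xi>. ennreal (rho (\<lambda>i. P i \<xi>) 0 powr s) \<partial>\<Omega>) = ennreal r"
begin

lemma nn_integral_prod_rho:
  assumes "finite A"
  shows "(\<integral>\<^sup>+\<xi>. ennreal ((\<Prod>i\<in>A. rho (\<lambda>i. P i \<xi>) i) powr s) \<partial>\<Omega>) = ennreal (r ^ card A)"
proof -
  have "(\<integral>\<^sup>+\<xi>. ennreal ((\<Prod>i\<in>A. rho (\<lambda>i. P i \<xi>) i) powr s) \<partial>\<Omega>)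
      = (\<integral>\<^sup>+\<xi>. (\<Prod>i\<in>A. ennreal (((1 - P i \<xi>) / P i \<xi>) powr s)) \<partial>\<Omega>)"
  proof (rule nn_integral_cong_AE, rule AE_mp[OF AE_range], intro AE_I2 impI)
    fix \<xi> assume "\<forall>i. 0 < P i \<xi> \<and> P i \<xi> < 1"
    then have "\<And>i. 0 \<le> (1 - P i \<xi>) / P i \<xi>" by (simp add: less_imp_le)
    then show "ennreal ((\<Prod>i\<in>A. rho (\<lambda>i. P i \<xi>) i) powr s) = (\<Prod>i\<in>A. ennreal (((1 - P i \<xi>) / P i \<xi>) powr s))"
      by (simp add: rho_def prod_ennreal prod_powr_distrib)
  qed
  also have "\<dots> = (\<integral>\<^sup>+\<xi>. ennreal (((1 - P 0 \<xi>) / P 0 \<xi>) powr s) \<partial>\<Omega>) ^ card A"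
    by (rule nn_integral_prod_layers[OF assms, where f = "\<lambda>x. ennreal (((1 - x) / x) powr s)"]) measurable
  also have "\<dots> = ennreal (r ^ card A)"
    using moment r by (simp add: rho_def ennreal_power)
  finally show ?thesis .
qed

lemma measurable_rho [measurable]: "(\<lambda>\<xi>. rho (\<lambda>i. P i \<xi>) j) \<in> borel_measurable \<Omega>"
  unfolding rho_def by measurable

lemma suminf_power_ennreal: "(\<Sum>k. ennreal (c * r ^ k)) = ennreal (c / (1 - r))" if "0 \<le> c"
proof -
  have "(\<lambda>k. c * r ^ k) sums (c * (1 / (1 - r)))"
    using r by (intro sums_mult geometric_sums) simp
  then show ?thesis using r that by (intro suminf_ennreal_eq) auto
qed

text \<open>Summand j of the scale function is a product over m - l + j independent layers, so its
  s-th power has mean r^(m - l) * r^j, and the sum over j is geometric.\<close>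

lemma annealed_backtrack:
  assumes m: "l < m" "0 \<le> m"
  shows "emeasure Q {(\<omega>, X). \<exists>k. \<exists>j\<le>k. m \<le> fst (X j) \<and> fst (X k) \<le> l} \<le> ennreal (r ^ nat (m - l) / (1 - r))"
proof -
  let ?B = "{X :: path. \<exists>k. \<exists>j\<le>k. m \<le> fst (X j) \<and> fst (X k) \<le> l}"
  have B: "?B \<in> sets path_space" by (rule sets_backtrack_paths)
  have "emeasure Q {(\<omega>, X). X \<in> ?B} \<le> (\<integral>\<^sup>+\<xi>. min 1 (back_scale (\<lambda>i. P i \<xi>) l m) \<partial>\<Omega>)"
    by (rule emeasure_Q_path_le[OF B]) (rule backtrack_bound[OF _ m])
  also have "\<dots> \<le> (\<integral>\<^sup>+\<xi>. (\<Sum>j. ennreal ((\<Prod>i\<in>{l<..m + int j}. rho (\<lambda>i. P i \<xi>) i) powr s)) \<partial>\<Omega>)"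
  proof (rule nn_integral_mono_AE, rule AE_mp[OF AE_range], intro AE_I2 impI)
    fix \<xi> assume *: "\<forall>i. 0 < P i \<xi> \<and> P i \<xi> < 1"
    have "min 1 (back_scale (\<lambda>i. P i \<xi>) l m) \<le> (\<Sum>j. min 1 (ennreal (\<Prod>i\<in>{l<..m + int j}. rho (\<lambda>i. P i \<xi>) i)))"
      unfolding back_scale_def by (rule min_one_suminf)
    also have "\<dots> \<le> (\<Sum>j. ennreal ((\<Prod>i\<in>{l<..m + int j}. rho (\<lambda>i. P i \<xi>) i) powr s))"
      using * s by (intro suminf_le summableI min_one_le_powr prod_nonneg) (auto simp: rho_def less_imp_le)
    finally show "min 1 (back_scale (\<lambda>i. P i \<xi>) l m) \<le> (\<Sum>j. ennreal ((\<Prod>i\<in>{l<..m + int j}. rho (\<lambda>i. P i \<xi>) i) powr s))" .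
  qed
  also have "\<dots> = (\<Sum>j. \<integral>\<^sup>+\<xi>. ennreal ((\<Prod>i\<in>{l<..m + int j}. rho (\<lambda>i. P i \<xi>) i) powr s) \<partial>\<Omega>)"
    by (rule nn_integral_suminf) measurable
  also have "\<dots> = (\<Sum>j. ennreal (r ^ nat (m - l) * r ^ j))"
  proof (rule suminf_cong)
    fix j
    have "card {l<..m + int j} = nat (m - l) + j" using m by simp
    then show "(\<integral>\<^sup>+\<xi>. ennreal ((\<Prod>i\<in>{l<..m + int j}. rho (\<lambda>i. P i \<xi>) i) powr s) \<partial>\<Omega>) = ennreal (r ^ nat (m - l) * r ^ j)"
      by (simp only: nn_integral_prod_rho finite_greaterThanAtMost_int power_add)
  qed
  also have "\<dots> = ennreal (r ^ nat (m - l) / (1 - r))"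
    using r by (intro suminf_power_ennreal) simp
  finally show ?thesis by simp
qed

text \<open>Since 1 / P = 1 + \<rho>, subadditivity of the s-th power splits each summand into two
  products of \<rho>, with k and k + 1 factors. The constant 4 is 2 powr s \<le> 2 times the 2 from
  r^k + r^(k + 1) \<le> 2 r^k.\<close>

lemma cross_time_moment:
  assumes n: "0 < n"
  shows "(\<integral>\<^sup>+\<xi>. ennreal ((2 / P (y - int k) \<xi> * (\<Prod>i\<in>{y - int k<..y}. rho (\<lambda>i. P i \<xi>) i) / real n) powr s) \<partial>\<Omega>)
    \<le> ennreal (4 * real n powr - s * r ^ k)"
proof -
  let ?R = "\<lambda>\<xi>. rho (\<lambda>i. P i \<xi>)"
  have "(\<integral>\<^sup>+\<xi>. ennreal ((2 / P (y - int k) \<xi> * (\<Prod>i\<in>{y - int k<..y}. ?R \<xi> i) / real n) powr s) \<partial>\<Omega>)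
    \<le> (\<integral>\<^sup>+\<xi>. ennreal (2 * real n powr - s) * (ennreal ((\<Prod>i\<in>{y - int k<..y}. ?R \<xi> i) powr s)
        + ennreal ((\<Prod>i\<in>{y - int k..y}. ?R \<xi> i) powr s)) \<partial>\<Omega>)"
  proof (rule nn_integral_mono_AE, rule AE_mp[OF AE_range], intro AE_I2 impI)
    fix \<xi> assume *: "\<forall>i. 0 < P i \<xi> \<and> P i \<xi> < 1"
    define a where "a = (\<Prod>i\<in>{y - int k<..y}. ?R \<xi> i)"
    define b where "b = ?R \<xi> (y - int k)"
    have R: "0 \<le> ?R \<xi> i" for i using * by (simp add: rho_def less_imp_le)
    have a: "0 \<le> a" unfolding a_def using R by (intro prod_nonneg) auto
    have b: "0 \<le> b" unfolding b_def by (rule R)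
    have "{y - int k..y} = insert (y - int k) {y - int k<..y}" by auto
    then have ab: "(\<Prod>i\<in>{y - int k..y}. ?R \<xi> i) = b * a" by (simp add: a_def b_def)
    have Pb: "1 / P (y - int k) \<xi> = 1 + b"
      using *[rule_format, of "y - int k"] by (simp add: b_def rho_def diff_divide_distrib)
    have "(2 / P (y - int k) \<xi> * a / real n) powr s = (2 * (1 + b) * (a * inverse (real n))) powr s"
      using Pb by (simp add: divide_inverse algebra_simps)
    also have "\<dots> = 2 powr s * (1 + b) powr s * (a powr s * inverse (real n) powr s)"
      by (simp only: powr_mult)
    also have "inverse (real n) powr s = real n powr - s"
      using n by (simp add: powr_minus inverse_powr)
    also have "2 powr s * (1 + b) powr s * (a powr s * real n powr - s) \<le> 2 * (1 + b powr s) * (a powr s * real n powr - s)"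
    proof (rule mult_right_mono[OF mult_mono])
      show "2 powr s \<le> (2::real)" using powr_mono[of s 1 2] s by simp
      show "(1 + b) powr s \<le> 1 + b powr s" using powr_add_le[of 1 b s] b s by simp
    qed auto
    also have "\<dots> = 2 * real n powr - s * (a powr s + (b * a) powr s)"
      using a b by (simp add: powr_mult algebra_simps)
    finally have "ennreal ((2 / P (y - int k) \<xi> * a / real n) powr s) \<le> ennreal (2 * real n powr - s * (a powr s + (b * a) powr s))"
      by (rule ennreal_leI)
    also have "\<dots> = ennreal (2 * real n powr - s) * (ennreal (a powr s) + ennreal ((b * a) powr s))"
      by (simp add: ennreal_mult)
    finally show "ennreal ((2 / P (y - int k) \<xi> * (\<Prod>i\<in>{y - int k<..y}. ?R \<xi> i) / real n) powr s)
       \<le> ennreal (2 * real n powr - s) * (ennreal ((\<Prod>i\<in>{y - int k<..y}. ?R \<xi> i) powr s)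
        + ennreal ((\<Prod>i\<in>{y - int k..y}. ?R \<xi> i) powr s))"
      unfolding ab a_def .
  qed
  also have "\<dots> = ennreal (2 * real n powr - s) * (ennreal (r ^ k) + ennreal (r ^ Suc k))"
    by (subst nn_integral_cmult, measurable, subst nn_integral_add, measurable, subst (1 2) nn_integral_prod_rho)
       (simp_all add: nat_add_distrib)
  also have "\<dots> = ennreal (2 * real n powr - s * (r ^ k + r ^ Suc k))"
    using r by (simp add: ennreal_mult)
  also have "\<dots> \<le> ennreal (4 * real n powr - s * r ^ k)"
  proof (rule ennreal_leI)
    have "r ^ Suc k \<le> r ^ k" using r by (simp add: mult_left_le_one_le)
    then have "2 * real n powr - s * (r ^ k + r ^ Suc k) \<le> 2 * real n powr - s * (2 * r ^ k)"
      by (intro mult_left_mono) auto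
    then show "2 * real n powr - s * (r ^ k + r ^ Suc k) \<le> 4 * real n powr - s * r ^ k"
      by (simp add: algebra_simps)
  qed
  finally show ?thesis .
qed

text \<open>The average of \<open>cross_time\<close> may be infinite, so the quenched Markov bound
  is truncated first. After that each of the m levels contributes a geometric series of total 4 / (1
  - r) * n powr - s.\<close>

lemma annealed_hitting:
  assumes m: "0 < m" and n: "0 < n"
  shows "emeasure Q {(\<omega>, X). \<forall>k\<le>n. fst (X k) < m} \<le> ennreal (4 / (1 - r) * real_of_int m * real n powr - s)"
proof -
  let ?B = "{X :: path. \<forall>k\<le>n. fst (X k) < m}"
  let ?a = "\<lambda>\<xi> y k. 2 / P (y - int k) \<xi> * (\<Prod>i\<in>{y - int k<..y}. rho (\<lambda>i. P i \<xi>) i)"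
  have B: "?B \<in> sets path_space" by (rule sets_no_hit_paths)
  have "emeasure Q {(\<omega>, X). X \<in> ?B} \<le> (\<integral>\<^sup>+\<xi>. min 1 ((\<Sum>y\<in>{0..<m}. cross_time (\<lambda>i. P i \<xi>) y) / of_nat n) \<partial>\<Omega>)"
  proof (rule emeasure_Q_path_le[OF B, where f = "\<lambda>q. (\<Sum>y\<in>{0..<m}. cross_time q y) / of_nat n"])
    fix q :: "int \<Rightarrow> real" assume q: "\<And>i. 0 < q i \<and> q i < 1"
    have "of_nat n * emeasure (layered_law q) ?B / of_nat n \<le> (\<Sum>y\<in>{0..<m}. cross_time q y) / of_nat n"
      by (rule divide_right_mono_ennreal[OF hitting_time_bound[OF q m]])
    then show "emeasure (layered_law q) ?B \<le> (\<Sum>y\<in>{0..<m}. cross_time q y) / of_nat n"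
      using n by (simp add: mult_divide_eq_ennreal mult.commute[of "of_nat n"])
  qed
  also have "\<dots> \<le> (\<integral>\<^sup>+\<xi>. (\<Sum>y\<in>{0..<m}. \<Sum>k. ennreal ((?a \<xi> y k / real n) powr s)) \<partial>\<Omega>)"
  proof (rule nn_integral_mono_AE, rule AE_mp[OF AE_range], intro AE_I2 impI)
    fix \<xi> assume *: "\<forall>i. 0 < P i \<xi> \<and> P i \<xi> < 1"
    have R: "0 \<le> rho (\<lambda>i. P i \<xi>) i" for i using * by (simp add: rho_def less_imp_le)
    have a: "0 \<le> ?a \<xi> y k" for y k using R *[rule_format, of "y - int k"] by (intro mult_nonneg_nonneg prod_nonneg) auto
    have "(\<Sum>y\<in>{0..<m}. cross_time (\<lambda>i. P i \<xi>) y) / of_nat n = (\<Sum>y\<in>{0..<m}. \<Sum>k. ennreal (?a \<xi> y k / real n))"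
    proof -
      have "ennreal (?a \<xi> y k) / of_nat n = ennreal (?a \<xi> y k / real n)" for y k
        using n unfolding ennreal_of_nat_eq_real_of_nat by (intro divide_ennreal a) simp
      then have "cross_time (\<lambda>i. P i \<xi>) y / of_nat n = (\<Sum>k. ennreal (?a \<xi> y k / real n))" for y
        unfolding cross_time_def ennreal_suminf_divide[symmetric] by (simp only:)
      then show ?thesis
        by (simp only: divide_ennreal_def sum_distrib_right)
    qed
    then have "min 1 ((\<Sum>y\<in>{0..<m}. cross_time (\<lambda>i. P i \<xi>) y) / of_nat n) \<le> (\<Sum>y\<in>{0..<m}. min 1 (\<Sum>k. ennreal (?a \<xi> y k / real n)))"
      by (simp add: min_one_sum)
    also have "\<dots> \<le> (\<Sum>y\<in>{0..<m}. \<Sum>k. min 1 (ennreal (?a \<xi> y k / real n)))"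
      by (intro sum_mono min_one_suminf)
    also have "\<dots> \<le> (\<Sum>y\<in>{0..<m}. \<Sum>k. ennreal ((?a \<xi> y k / real n) powr s))"
      using s by (intro sum_mono suminf_le summableI min_one_le_powr divide_nonneg_nonneg a) auto
    finally show "min 1 ((\<Sum>y\<in>{0..<m}. cross_time (\<lambda>i. P i \<xi>) y) / of_nat n)
       \<le> (\<Sum>y\<in>{0..<m}. \<Sum>k. ennreal ((?a \<xi> y k / real n) powr s))" .
  qed
  also have "\<dots> = (\<Sum>y\<in>{0..<m}. \<Sum>k. \<integral>\<^sup>+\<xi>. ennreal ((?a \<xi> y k / real n) powr s) \<partial>\<Omega>)"
    by (subst nn_integral_sum, measurable) (intro sum.cong refl nn_integral_suminf, measurable)
  also have "\<dots> \<le> (\<Sum>y\<in>{0..<m}. \<Sum>k. ennreal (4 * real n powr - s * r ^ k))"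
    by (intro sum_mono suminf_le summableI cross_time_moment n)
  also have "\<dots> = (\<Sum>y\<in>{0..<m}. ennreal (4 * real n powr - s / (1 - r)))"
    by (subst suminf_power_ennreal) auto
  also have "\<dots> = ennreal (4 / (1 - r) * real_of_int m * real n powr - s)"
    using m r by (simp add: ennreal_of_nat_eq_real_of_nat ennreal_mult[symmetric] algebra_simps)
  finally show ?thesis by simp
qed

end

lemma (in iid_layers) annealed_vertical:
  assumes "0 < a"
  shows "emeasure Q {(\<omega>, X). \<exists>k\<le>n. a \<le> \<bar>real_of_int (snd (X k))\<bar>} \<le> ennreal (real n / (2 * a\<^sup>2))"
proof -
  let ?B = "{X :: path. \<exists>k\<le>n. a \<le> \<bar>real_of_int (snd (X k))\<bar>}"
  have B: "?B \<in> sets path_space" by (rule sets_vertical_paths)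
  have "emeasure Q {(\<omega>, X). X \<in> ?B} \<le> (\<integral>\<^sup>+\<xi>. min 1 (ennreal (real n / (2 * a\<^sup>2))) \<partial>\<Omega>)"
    by (rule emeasure_Q_path_le[OF B]) (rule vertical_maximal_bound[OF _ assms])
  also have "\<dots> \<le> ennreal (real n / (2 * a\<^sup>2))"
    by (simp add: emeasure_space_1)
  finally show ?thesis by simp
qed

section \<open>Transience and asymptotic direction\<close>

context contracting_layers
begin

lemma measure_Q_le: "emeasure Q A \<le> ennreal c \<Longrightarrow> 0 \<le> c \<Longrightarrow> measure Q A \<le> c"
  by (simp add: annealed.emeasure_eq_measure)

lemma sets_no_hit: "{(\<omega>, X). \<forall>k\<le>n. fst (X k) < m} \<in> sets Q"
  using path_event[OF sets_no_hit_paths] by simp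

lemma sets_backtrack: "{(\<omega>, X). \<exists>k. \<exists>j\<le>k. m \<le> fst (X j) \<and> fst (X k) \<le> l} \<in> sets Q"
  using path_event[OF sets_backtrack_paths] by simp

text \<open>The event of never reaching m lies in every no-hit event up to time n, whose probability
  tends to 0.\<close>

lemma AE_hits_all: "AE (\<omega>, X) in Q. \<forall>m. \<exists>k. m \<le> fst (X k)"
proof -
  have pos: "AE (\<omega>, X) in Q. \<exists>k. m \<le> fst (X k)" if m: "0 < m" for m
  proof -
    let ?N = "\<lambda>n. {(\<omega> :: env, X :: path). \<forall>k\<le>n. fst (X k) < m}"
    have le: "emeasure Q (\<Inter>n. ?N n) \<le> ennreal (4 / (1 - r) * real_of_int m * real n powr - s)" if "0 < n" for n
    proof -
      have "emeasure Q (\<Inter>n. ?N n) \<le> emeasure Q (?N n)"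
        by (intro emeasure_mono sets_no_hit INF_lower UNIV_I)
      also note annealed_hitting[OF m that]
      finally show ?thesis .
    qed
    have "(\<lambda>n. real n powr - s) \<longlonglongrightarrow> 0"
      using s by (intro tendsto_neg_powr filterlim_real_sequentially) auto
    from tendsto_mult_left[OF this, of "4 / (1 - r) * real_of_int m"]
    have lim: "(\<lambda>n. ennreal (4 / (1 - r) * real_of_int m * real n powr - s)) \<longlonglongrightarrow> ennreal 0"
      by (intro tendsto_ennrealI) simp
    have "emeasure Q (\<Inter>n. ?N n) \<le> ennreal 0"
    proof (rule tendsto_lowerbound[OF lim _ sequentially_bot])
      show "\<forall>\<^sub>F n in sequentially. emeasure Q (\<Inter>n. ?N n) \<le> ennreal (4 / (1 - r) * real_of_int m * real n powr - s)"
        using eventually_gt_at_top[of 0] by eventually_elim (rule le)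
    qed
    then have null: "emeasure Q (\<Inter>n. ?N n) = 0" by simp
    show ?thesis
    proof (rule AE_I[OF _ null])
      show "(\<Inter>n. ?N n) \<in> sets Q" by (rule sets.countable_INT[OF image_subsetI[OF sets_no_hit]]) simp
      have "w \<in> ?N n" if "\<not> (case w of (\<omega>, X) \<Rightarrow> \<exists>k. m \<le> fst (X k))" for w n
        using that by (cases w) (simp add: linorder_not_le[of m])
      then show "{w \<in> space Q. \<not> (case w of (\<omega>, X) \<Rightarrow> \<exists>k. m \<le> fst (X k))} \<subseteq> (\<Inter>n. ?N n)"
        by blast
    qed
  qed
  have "AE w in Q. \<forall>m::nat. \<exists>k. int (Suc m) \<le> fst (snd w k)"
    unfolding AE_all_countable using pos[of "int (Suc _)"] by (simp add: case_prod_unfold)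
  then show ?thesis
  proof (rule AE_mp, intro AE_I2 impI)
    fix w assume *: "\<forall>m::nat. \<exists>k. int (Suc m) \<le> fst (snd w k)"
    have "\<exists>k. m \<le> fst (snd w k)" for m
    proof -
      obtain k where "int (Suc (nat m)) \<le> fst (snd w k)" using * by blast
      then have "m \<le> fst (snd w k)" by linarith
      then show ?thesis ..
    qed
    then show "case w of (\<omega>, X) \<Rightarrow> \<forall>m. \<exists>k. m \<le> fst (X k)" by (simp add: case_prod_unfold)
  qed
qed

theorem transient_right: "AE (\<omega>, X) in Q. filterlim (\<lambda>n. fst (X n)) at_top sequentially"
proof -
  \<comment> \<open>Doubling the level makes the retreat to half of it m + 1 sites long, so these
    events have summable probabilities.\<close>
  let ?A = "\<lambda>m. {(\<omega> :: env, X :: path). \<exists>k. \<exists>j\<le>k. 2 * int (Suc m) \<le> fst (X j) \<and> fst (X k) \<le> int (Suc m)}"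
  have "AE w in Q. eventually (\<lambda>m. w \<in> space Q - ?A m) sequentially"
  proof (rule borel_cantelli_AE1[OF sets_backtrack])
    show "emeasure Q (?A m) < \<infinity>" for m by (simp add: annealed.emeasure_eq_measure)
    have "measure Q (?A m) \<le> r / (1 - r) * r ^ m" for m
    proof (rule measure_Q_le)
      have "nat (2 * int (Suc m) - int (Suc m)) = Suc m" by simp
      then show "emeasure Q (?A m) \<le> ennreal (r / (1 - r) * r ^ m)"
        using annealed_backtrack[of "int (Suc m)" "2 * int (Suc m)"] by (simp del: of_nat_Suc)
    qed (use r in auto)
    then have "norm (measure Q (?A m)) \<le> r / (1 - r) * r ^ m" for m
      unfolding real_norm_def abs_of_nonneg[OF measure_nonneg] .
    moreover have "summable (\<lambda>m. r / (1 - r) * r ^ m)"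
      using r by (intro summable_mult summable_geometric) simp
    ultimately show "summable (\<lambda>m. measure Q (?A m))"
      by (rule summable_comparison_test'[rotated])
  qed
  moreover note AE_hits_all
  ultimately show ?thesis
  proof (eventually_elim)
    case (elim w)
    obtain \<omega> X where w: "w = (\<omega>, X)" by (cases w)
    have "\<exists>N. \<forall>k\<ge>N. M \<le> fst (X k)" for M
    proof -
      obtain m0 where m0: "\<And>m. m0 \<le> m \<Longrightarrow> w \<notin> ?A m"
        using elim(1) by (auto simp: eventually_sequentially)
      define m where "m = max m0 (nat M)"
      obtain j where j: "2 * int (Suc m) \<le> fst (X j)" using elim(2) w by auto
      have "M \<le> fst (X k)" if "j \<le> k" for k
      proof -
        have "w \<notin> ?A m" using m0[of m] by (simp add: m_def)
        then have "\<not> (\<exists>k. \<exists>j\<le>k. 2 * int (Suc m) \<le> fst (X j) \<and> fst (X k) \<le> int (Suc m))"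
          unfolding w by (simp only: mem_Collect_eq prod.case simp_thms)
        then have "\<not> fst (X k) \<le> int (Suc m)" using j that by blast
        then show ?thesis unfolding m_def by linarith
      qed
      then show ?thesis by blast
    qed
    then show ?case
      unfolding w prod.case filterlim_at_top eventually_sequentially by blast
  qed
qed

end

section \<open>Asymptotic direction\<close>

text \<open>With N the norm of (x, y), x \<le> N \<le> x + |y|; hence both coordinates of the
  difference are at most |y| / x in absolute value.\<close>

lemma direction_estimate:
  fixes x y :: real
  assumes "0 < x"
  shows "norm ((1 / norm (x, y)) *\<^sub>R (x, y) - (1, 0)) \<le> 2 * \<bar>y\<bar> / x"
proof -
  define N where "N = norm (x, y)"
  have N: "x \<le> N" "N \<le> x + \<bar>y\<bar>"
    using norm_fst_le[of x y] norm_Pair_le[of x y] assms by (simp_all add: N_def)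
  have "norm ((1 / N) *\<^sub>R (x, y) - (1, 0)) = norm (x / N - 1, y / N)"
    by (simp add: minus_prod_def scaleR_prod_def)
  also have "\<dots> \<le> \<bar>x / N - 1\<bar> + \<bar>y / N\<bar>"
    using norm_Pair_le[of "x / N - 1" "y / N"] by simp
  also have "x / N - 1 = - ((N - x) / N)" using N assms by (simp add: field_simps)
  also have "\<bar>- ((N - x) / N)\<bar> + \<bar>y / N\<bar> \<le> \<bar>y\<bar> / x + \<bar>y\<bar> / x"
  proof (rule add_mono)
    have "(N - x) / N \<le> \<bar>y\<bar> / x" using N assms by (intro frac_le) auto
    then show "\<bar>- ((N - x) / N)\<bar> \<le> \<bar>y\<bar> / x" using N assms by simp
    have "\<bar>y\<bar> / N \<le> \<bar>y\<bar> / x" using N assms by (intro frac_le) auto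
    then show "\<bar>y / N\<bar> \<le> \<bar>y\<bar> / x" using N assms by simp
  qed
  finally show ?thesis by (simp add: N_def)
qed

context contracting_layers
begin

text \<open>Off three rare events, level 2 l is reached by time n, the walk does not fall back to l
  afterwards, and the height is below B \<surd>n. Then the first coordinate exceeds l at time n, and
  \<open>direction_estimate\<close> applies. The gap between l and 2 l pays for
  backtracking.\<close>

lemma direction_bound:
  assumes n: "0 < n" and \<epsilon>: "0 < \<epsilon>" and B: "0 < B" and l: "2 * B / \<epsilon> * sqrt (real n) \<le> real_of_int l" "0 < l"
  shows "measure Q {(\<omega>, X) \<in> space Q. norm ((1 / norm (to_plane (X n))) *\<^sub>R to_plane (X n) - (1, 0)) > \<epsilon>}
    \<le> 1 / (2 * B\<^sup>2) + 4 / (1 - r) * real_of_int (2 * l) * real n powr - s + r ^ nat l / (1 - r)"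
proof -
  let ?V = "{(\<omega> :: env, X :: path). \<exists>k\<le>n. B * sqrt (real n) \<le> \<bar>real_of_int (snd (X k))\<bar>}"
  let ?H = "{(\<omega> :: env, X :: path). \<forall>k\<le>n. fst (X k) < 2 * l}"
  let ?R = "{(\<omega> :: env, X :: path). \<exists>k. \<exists>j\<le>k. 2 * l \<le> fst (X j) \<and> fst (X k) \<le> l}"
  have V: "?V \<in> sets Q"
    using path_event[OF sets_vertical_paths] by simp
  have "{(\<omega>, X) \<in> space Q. norm ((1 / norm (to_plane (X n))) *\<^sub>R to_plane (X n) - (1, 0)) > \<epsilon>} \<subseteq> ?V \<union> ?H \<union> ?R"
  proof (rule subsetI, rule ccontr)
    fix w assume w: "w \<in> {(\<omega>, X) \<in> space Q. norm ((1 / norm (to_plane (X n))) *\<^sub>R to_plane (X n) - (1, 0)) > \<epsilon>}"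
      and nw: "w \<notin> ?V \<union> ?H \<union> ?R"
    obtain \<omega> X where wX: "w = (\<omega>, X)" by (cases w)
    define x y where "x = real_of_int (fst (X n))" and "y = real_of_int (snd (X n))"
    have nV: "\<not> (\<exists>k\<le>n. B * sqrt (real n) \<le> \<bar>real_of_int (snd (X k))\<bar>)"
      and nH: "\<not> (\<forall>k\<le>n. fst (X k) < 2 * l)"
      and nR: "\<not> (\<exists>k. \<exists>j\<le>k. 2 * l \<le> fst (X j) \<and> fst (X k) \<le> l)"
      using nw unfolding wX Un_iff mem_Collect_eq prod.case de_Morgan_disj by - (elim conjE; assumption)+
    have "\<not> B * sqrt (real n) \<le> \<bar>y\<bar>" using nV unfolding y_def by blast
    then have y: "\<bar>y\<bar> < B * sqrt (real n)" by simp
    obtain j where "j \<le> n" "\<not> fst (X j) < 2 * l" using nH by blast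
    then have "\<not> fst (X n) \<le> l" using nR not_less by blast
    then have "l < fst (X n)" by simp
    then have lx: "real_of_int l < x" by (simp add: x_def)
    then have x: "0 < x" using l by linarith
    have "2 * \<bar>y\<bar> \<le> 2 * (B * sqrt (real n))" using y by simp
    also have "\<dots> = \<epsilon> * (2 * B / \<epsilon> * sqrt (real n))" using \<epsilon> by simp
    also have "\<dots> \<le> \<epsilon> * x" using l lx \<epsilon> by (intro mult_left_mono) auto
    finally have "2 * \<bar>y\<bar> / x \<le> \<epsilon>" using x by (simp add: field_simps)
    then have "norm ((1 / norm (x, y)) *\<^sub>R (x, y) - (1, 0)) \<le> \<epsilon>"
      using direction_estimate[OF x, of y] by simp
    then show False using w unfolding wX to_plane_def x_def y_def by auto
  qed
  then have "measure Q {(\<omega>, X) \<in> space Q. norm ((1 / norm (to_plane (X n))) *\<^sub>R to_plane (X n) - (1, 0)) > \<epsilon>}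
      \<le> measure Q (?V \<union> ?H \<union> ?R)"
    using V sets_no_hit sets_backtrack by (intro annealed.finite_measure_mono) auto
  also have "\<dots> \<le> measure Q (?V \<union> ?H) + measure Q ?R"
    by (rule measure_Un_le) (use V sets_no_hit sets_backtrack in auto)
  also have "\<dots> \<le> measure Q ?V + measure Q ?H + measure Q ?R"
    by (intro add_right_mono measure_Un_le) (use V sets_no_hit sets_backtrack in auto)
  also have "\<dots> \<le> 1 / (2 * B\<^sup>2) + 4 / (1 - r) * real_of_int (2 * l) * real n powr - s + r ^ nat l / (1 - r)"
  proof (intro add_mono measure_Q_le)
    have "real n / (2 * (B * sqrt (real n))\<^sup>2) = 1 / (2 * B\<^sup>2)"
      using n B by (simp add: power_mult_distrib)
    then show "emeasure Q ?V \<le> ennreal (1 / (2 * B\<^sup>2))"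
      using annealed_vertical[of "B * sqrt (real n)" n] n B by simp
    show "emeasure Q ?H \<le> ennreal (4 / (1 - r) * real_of_int (2 * l) * real n powr - s)"
      using annealed_hitting[of "2 * l" n] l n by simp
    show "emeasure Q ?R \<le> ennreal (r ^ nat l / (1 - r))"
      using annealed_backtrack[of l "2 * l"] l by simp
  qed (use r l in auto)
  finally show ?thesis .
qed

theorem direction_in_probability:
  assumes s_half: "1 / 2 < s" and \<epsilon>: "0 < \<epsilon>"
  shows "(\<lambda>n. measure Q {(\<omega>, X) \<in> space Q.
        norm ((1 / norm (to_plane (X n))) *\<^sub>R to_plane (X n) - (1, 0)) > \<epsilon>}) \<longlonglongrightarrow> 0"
proof (rule tendstoI)
  fix \<eta> :: real assume \<eta>: "0 < \<eta>"
  \<comment> \<open>This makes the vertical term equal to \<eta> / 2.\<close>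
  define B where "B = 1 / sqrt \<eta>"
  have B: "0 < B" "1 / (2 * B\<^sup>2) = \<eta> / 2" using \<eta> by (simp_all add: B_def power_divide)
  define A where "A = 2 * B / \<epsilon>"
  have A: "0 < A" using B \<epsilon> by (simp add: A_def)
  \<comment> \<open>The level is of order \<surd>n, so the hitting term has order n^(1/2 - s) and
    vanishes because s > 1/2. Adding 1 keeps the level positive at n = 0.\<close>
  define l where "l n = \<lceil>A * sqrt (real n)\<rceil> + 1" for n
  have l: "A * sqrt (real n) \<le> real_of_int (l n)" "0 < l n" "real_of_int (l n) \<le> A * sqrt (real n) + 2" for n
  proof -
    have "0 \<le> A * sqrt (real n)" using A by simp
    then have "0 \<le> \<lceil>A * sqrt (real n)\<rceil>" by simp
    then show "0 < l n" by (simp add: l_def)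
  qed (unfold l_def, linarith+)
  define g where "g n = 4 / (1 - r) * (2 * (A * sqrt (real n) + 2)) * real n powr - s + r ^ nat (l n) / (1 - r)" for n
  have "(\<lambda>n. 4 / (1 - r) * (2 * (A * sqrt (real n) + 2)) * real n powr - s) \<longlonglongrightarrow> 0"
  proof -
    have "(\<lambda>n. real n powr - (s - 1 / 2)) \<longlonglongrightarrow> 0" "(\<lambda>n. real n powr - s) \<longlonglongrightarrow> 0"
      using s_half by (intro tendsto_neg_powr filterlim_real_sequentially; simp)+
    then have "(\<lambda>n. 8 * A / (1 - r) * real n powr - (s - 1 / 2) + 16 / (1 - r) * real n powr - s) \<longlonglongrightarrow> 8 * A / (1 - r) * 0 + 16 / (1 - r) * 0"
      by (intro tendsto_intros)
    moreover have "real n powr - (s - 1 / 2) = sqrt (real n) * real n powr - s" for n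
      by (simp add: powr_half_sqrt[symmetric] powr_add[symmetric])
    ultimately show ?thesis by (simp add: algebra_simps)
  qed
  moreover have "(\<lambda>n. r ^ nat (l n) / (1 - r)) \<longlonglongrightarrow> 0 / (1 - r)"
  proof (rule tendsto_divide[OF _ tendsto_const])
    have "filterlim (\<lambda>n. A * sqrt (real n)) at_top sequentially"
      by (intro filterlim_tendsto_pos_mult_at_top[OF tendsto_const A]
          filterlim_compose[OF sqrt_at_top filterlim_real_sequentially])
    then have "filterlim (\<lambda>n. real (nat (l n))) at_top sequentially"
      by (rule filterlim_at_top_mono) (use l in \<open>auto intro!: always_eventually simp: less_imp_le\<close>)
    then have "filterlim (\<lambda>n. nat (l n)) at_top sequentially"
      by (simp add: filterlim_sequentially_iff_filterlim_real)
    then show "(\<lambda>n. r ^ nat (l n)) \<longlonglongrightarrow> 0"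
      using r by (intro filterlim_compose[OF LIMSEQ_power_zero]) auto
  qed (use r in auto)
  ultimately have "g \<longlonglongrightarrow> 0 + 0 / (1 - r)"
    unfolding g_def by (rule tendsto_add)
  then have "eventually (\<lambda>n. g n < \<eta> / 2) sequentially"
    using \<eta> by (intro order_tendstoD) auto
  with eventually_gt_at_top[of 0]
  show "\<forall>\<^sub>F n in sequentially. dist (measure Q {(\<omega>, X) \<in> space Q.
        norm ((1 / norm (to_plane (X n))) *\<^sub>R to_plane (X n) - (1, 0)) > \<epsilon>}) 0 < \<eta>"
  proof eventually_elim
    case (elim n)
    let ?S = "{(\<omega>, X) \<in> space Q. norm ((1 / norm (to_plane (X n))) *\<^sub>R to_plane (X n) - (1, 0)) > \<epsilon>}"
    have "measure Q ?S \<le> 1 / (2 * B\<^sup>2) + 4 / (1 - r) * real_of_int (2 * l n) * real n powr - s + r ^ nat (l n) / (1 - r)"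
      using l[of n] elim B \<epsilon> unfolding A_def by (intro direction_bound) auto
    also have "\<dots> \<le> \<eta> / 2 + g n"
    proof -
      have "4 / (1 - r) * real_of_int (2 * l n) * real n powr - s \<le> 4 / (1 - r) * (2 * (A * sqrt (real n) + 2)) * real n powr - s"
        using l(3)[of n] r by (intro mult_right_mono mult_left_mono) auto
      then show ?thesis unfolding B(2) g_def by simp
    qed
    also have "\<dots> < \<eta>" using elim by simp
    finally show ?case by (simp add: dist_real_def)
  qed
qed

end

section \<open>Zero speed\<close>

text \<open>The mean crossing times \<open>t x\<close> satisfy \<open>t x = 2 / q x + rho x * t (x - 1)\<close>. The lower bound \<open>cell\<close>
  is capped at \<open>C\<close> and forgets the past at the multiples of \<open>B\<close>, so that its sums over blocks of
  length \<open>B\<close> are bounded and independent; its potential still has drift at most \<open>1\<close> along the walk.\<close>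

primrec block_cell :: "real \<Rightarrow> (nat \<Rightarrow> real) \<Rightarrow> nat \<Rightarrow> real" where
  "block_cell C a 0 = min C 2"
| "block_cell C a (Suc k) = min C (2 + a (Suc k) * block_cell C a k)"

lemma block_cell_bounds:
  assumes "0 \<le> C" "\<And>i. 0 \<le> a i"
  shows "0 \<le> block_cell C a k" "block_cell C a k \<le> C"
proof -
  show "0 \<le> block_cell C a k" using assms by (induction k) auto
  show "block_cell C a k \<le> C" by (cases k) auto
qed

lemma block_cell_cong: "(\<And>i. i \<le> k \<Longrightarrow> a i = b i) \<Longrightarrow> block_cell C a k = block_cell C b k"
  by (induction k) auto

definition cell :: "nat \<Rightarrow> real \<Rightarrow> (int \<Rightarrow> real) \<Rightarrow> int \<Rightarrow> real" where
  "cell B C a x = block_cell C (\<lambda>k. a (x - x mod int B + int k)) (nat (x mod int B))"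

lemma cell_bounds:
  assumes "0 \<le> C" "\<And>i. 0 \<le> a i"
  shows "0 \<le> cell B C a x" "cell B C a x \<le> C"
  unfolding cell_def using assms by (auto intro!: block_cell_bounds)

text \<open>The crossing-time recursion as an inequality, which is all that the drift estimate uses.
  The cap lowers the left side, and at a multiple of B the forgotten term is nonnegative.\<close>

lemma cell_le:
  assumes C: "0 \<le> C" and a: "\<And>i. 0 \<le> a i" and B: "0 < B"
  shows "cell B C a x \<le> 2 + a x * cell B C a (x - 1)"
proof (cases "nat (x mod int B)")
  case 0
  have "0 \<le> a x * cell B C a (x - 1)"
    using a by (intro mult_nonneg_nonneg cell_bounds(1) C) auto
  then show ?thesis unfolding cell_def[of B C a x] 0 by simp
next
  case (Suc k)
  define b where "b = x - x mod int B"
  have x: "x mod int B = int (Suc k)" using Suc by linarith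
  have "int (Suc k) < int B" using x pos_mod_bound[of "int B" x] B by simp
  have "x - 1 = int k + x div int B * int B"
    using x div_mult_mod_eq[of x "int B"] by simp
  moreover have "(int k + x div int B * int B) mod int B = int k"
    using \<open>int (Suc k) < int B\<close> by (simp only: mod_mult_self1) simp
  ultimately have x': "(x - 1) mod int B = int k" by metis
  have "x - 1 - (x - 1) mod int B = b" using x x' by (simp add: b_def)
  then have "cell B C a (x - 1) = block_cell C (\<lambda>k. a (b + int k)) k"
    unfolding cell_def using x' by simp
  moreover have "b + int (Suc k) = x" using x by (simp add: b_def)
  ultimately show ?thesis
    unfolding cell_def[of B C a x] Suc b_def[symmetric] by simp
qed

section \<open>Potentials along the walk\<close>

text \<open>The oriented sum from 0 to x, so that the step identity holds on the negative sites as
  well.\<close>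

definition potential :: "(int \<Rightarrow> real) \<Rightarrow> int \<Rightarrow> real" where
  "potential f x = (\<Sum>y\<in>{0..<x}. f y) - (\<Sum>y\<in>{x..<0}. f y)"

lemma potential_0 [simp]: "potential f 0 = 0"
  by (simp add: potential_def)

lemma potential_step: "potential f (x + 1) = potential f x + f x"
proof (cases "0 \<le> x")
  case True
  then have "{0..<x + 1} = insert x {0..<x}" by auto
  then show ?thesis using True by (simp add: potential_def)
next
  case False
  then have "{x..<0} = insert x {x + 1..<0}" by auto
  then show ?thesis using False by (simp add: potential_def)
qed

text \<open>Multiplying \<open>cell_le\<close> by q / 2 shows that a step raises the potential by at
  most 1 on average. The cap C bounds the increments, as the exponential tail estimate
  requires.\<close>

lemma potential_drift:
  assumes q: "\<And>i. 0 < q i \<and> q i < 1" and C: "0 \<le> C" and B: "0 < B"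
  defines "F \<equiv> (\<lambda>z :: site. potential (cell B C (rho q)) (fst z))"
  shows "AE X in layered_law q. eventually (\<lambda>n. F (X n) < 2 * real n) sequentially"
proof -
  have r: "0 \<le> rho q i" for i using q[of i] by (simp add: rho_def)
  let ?c = "cell B C (rho q)"
  have c: "0 \<le> ?c x" "?c x \<le> C" for x using cell_bounds[where a = "rho q", OF C r] by auto
  have minus: "potential ?c (x - 1) = potential ?c x - ?c (x - 1)" for x
    using potential_step[of ?c "x - 1"] by simp
  \<comment> \<open>The first 1 is the drift, the second the slack \<delta>.\<close>
  have "AE X in layered_law q. eventually (\<lambda>n. F (X n) < (1 + 1) * real n) sequentially"
  proof (rule AE_drift_bound[OF q])
    show "\<bar>F (z + dir_vec d) - F z\<bar> \<le> C" for z d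
      using c C by (cases d) (auto simp: F_def potential_step minus)
    show "F 0 = 0" by (simp add: F_def)
    fix i j :: int
    have qi: "0 < q i" "q i < 1" using q by auto
    have "?c i \<le> 2 + rho q i * ?c (i - 1)"
      by (rule cell_le[OF C r B])
    then have "q i / 2 * ?c i \<le> q i / 2 * (2 + rho q i * ?c (i - 1))"
      using qi by (intro mult_left_mono) auto
    also have "\<dots> = q i + (1 / 2 - q i / 2) * ?c (i - 1)"
      using qi by (simp add: rho_def field_simps)
    finally have "q i / 2 * ?c i \<le> 1 + (1 / 2 - q i / 2) * ?c (i - 1)" using qi by simp
    then show "q i / 2 * F (i + 1, j) + (1 / 2 - q i / 2) * F (i - 1, j)
        + 1 / 4 * F (i, j + 1) + 1 / 4 * F (i, j - 1) \<le> F (i, j) + 1"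
      unfolding F_def fst_conv potential_step minus by (simp add: algebra_simps)
  qed simp
  then show ?thesis by simp
qed

lemma vertical_drift:
  assumes q: "\<And>i. 0 < q i \<and> q i < 1" and \<delta>: "0 < \<delta>"
  shows "AE X in layered_law q. eventually (\<lambda>n. \<bar>real_of_int (snd (X n))\<bar> < \<delta> * real n) sequentially"
proof -
  \<comment> \<open>The height has drift 0; the sign e covers both directions.\<close>
  have "AE X in layered_law q. eventually (\<lambda>n. e * real_of_int (snd (X n)) < (0 + \<delta>) * real n) sequentially"
    if e: "\<bar>e\<bar> = 1" for e :: real
  proof (rule AE_drift_bound[OF q _ _ _ \<delta>, where C = 1])
    show "\<bar>e * real_of_int (snd (z + dir_vec d)) - e * real_of_int (snd z)\<bar> \<le> 1" for z d
      unfolding right_diff_distrib[symmetric] abs_mult e by (cases d) auto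
  qed (auto simp: field_simps)
  from this[of 1] this[of "- 1"]
  have "AE X in layered_law q. eventually (\<lambda>n. real_of_int (snd (X n)) < \<delta> * real n) sequentially"
    "AE X in layered_law q. eventually (\<lambda>n. - real_of_int (snd (X n)) < \<delta> * real n) sequentially"
    by simp_all
  then show ?thesis
  proof eventually_elim
    case (elim X)
    then show ?case by eventually_elim (simp add: abs_less_iff)
  qed
qed

section \<open>Block sums as bounded i.i.d. variables\<close>

text \<open>Stated for the vector of layer parameters of one block, so that all blocks are the same
  measurable function of equally distributed vectors.\<close>

definition block_sum :: "nat \<Rightarrow> real \<Rightarrow> (nat \<Rightarrow> real) \<Rightarrow> real" where
  "block_sum B C u = (\<Sum>k<B. block_cell C (\<lambda>i. (1 - u i) / u i) k)"

lemma potential_blocks: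
  assumes B: "0 < B"
  shows "potential (cell B C (rho q)) (int (N * B)) = (\<Sum>j<N. block_sum B C (\<lambda>k. q (int (j * B + k))))"
proof (induction N)
  case (Suc N)
  have "potential f (x + int k) = potential f x + (\<Sum>i<k. f (x + int i))" for f x k
  proof (induction k)
    case (Suc k)
    have "potential f (x + int (Suc k)) = potential f (x + int k) + f (x + int k)"
      using potential_step[of f "x + int k"] by (simp add: algebra_simps)
    then show ?case using Suc by simp
  qed simp
  from this[of "cell B C (rho q)" "int (N * B)" B]
  have "potential (cell B C (rho q)) (int (Suc N * B)) = potential (cell B C (rho q)) (int (N * B))
      + (\<Sum>k<B. cell B C (rho q) (int (N * B) + int k))"
    by (simp add: algebra_simps)
  also have "(\<Sum>k<B. cell B C (rho q) (int (N * B) + int k)) = block_sum B C (\<lambda>k. q (int (N * B + k)))"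
    unfolding block_sum_def
  proof (rule sum.cong[OF refl])
    fix k assume "k \<in> {..<B}"
    then have "(int (N * B) + int k) mod int B = int k" by simp
    then show "cell B C (rho q) (int (N * B) + int k)
        = block_cell C (\<lambda>i. (1 - q (int (N * B + i))) / q (int (N * B + i))) k"
      unfolding cell_def by (simp add: rho_def)
  qed
  finally show ?case using Suc by simp
qed simp

lemma measurable_block_sum [measurable]: "block_sum B C \<in> borel_measurable (PiM {..<B} (\<lambda>_. borel))"
proof -
  have "(\<lambda>u. block_cell C (\<lambda>i. (1 - u i) / u i) k) \<in> borel_measurable (PiM {..<B} (\<lambda>_. borel))" if "k < B" for k
    using that
  proof (induction k)
    case (Suc k)
    have [measurable]: "(\<lambda>u. u (Suc k)) \<in> borel_measurable (PiM {..<B} (\<lambda>_. borel :: real measure))"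
      using Suc.prems by (intro measurable_component_singleton) simp
    have [measurable]: "(\<lambda>u. block_cell C (\<lambda>i. (1 - u i) / u i) k) \<in> borel_measurable (PiM {..<B} (\<lambda>_. borel))"
      using Suc by simp
    show ?case by simp
  qed simp
  then show ?thesis unfolding block_sum_def[abs_def] by (intro borel_measurable_sum) auto
qed

lemma block_sum_restrict: "block_sum B C (restrict u {..<B}) = block_sum B C u"
  unfolding block_sum_def by (intro sum.cong refl block_cell_cong) auto

text \<open>The limit is the uncapped recursion unrolled. A converging sequence is bounded, so the
  growing cap is eventually inactive at each position.\<close>

lemma block_cell_limit:
  assumes a: "\<And>i. 0 \<le> a i"
  shows "(\<lambda>n. block_cell (real n) a k) \<longlonglongrightarrow> (\<Sum>j\<le>k. 2 * (\<Prod>i\<in>{j<..k}. a i))"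
proof (induction k)
  case 0
  have "eventually (\<lambda>n. min (real n) 2 = 2) sequentially"
    using eventually_ge_at_top[of 2] by eventually_elim simp
  then show ?case by (simp add: tendsto_eventually)
next
  case (Suc k)
  define L where "L = (\<Sum>j\<le>k. 2 * (\<Prod>i\<in>{j<..k}. a i))"
  have "{j<..Suc k} = insert (Suc k) {j<..k}" if "j \<le> k" for j using that by auto
  then have L: "(\<Sum>j\<le>Suc k. 2 * (\<Prod>i\<in>{j<..Suc k}. a i)) = 2 + a (Suc k) * L"
    unfolding L_def by (simp add: sum_distrib_left mult_ac)
  have lim: "(\<lambda>n. 2 + a (Suc k) * block_cell (real n) a k) \<longlonglongrightarrow> 2 + a (Suc k) * L"
    using Suc unfolding L_def by (intro tendsto_intros)
  then have "eventually (\<lambda>n. 2 + a (Suc k) * block_cell (real n) a k < 2 + a (Suc k) * L + 1) sequentially"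
    by (intro order_tendstoD) auto
  moreover have "eventually (\<lambda>n. 2 + a (Suc k) * L + 1 \<le> real n) sequentially"
    using eventually_ge_at_top[of "nat \<lceil>2 + a (Suc k) * L + 1\<rceil>"] by eventually_elim linarith
  ultimately have "eventually (\<lambda>n. block_cell (real n) a (Suc k) = 2 + a (Suc k) * block_cell (real n) a k) sequentially"
    by eventually_elim simp
  then show ?case
    unfolding L by (rule Lim_transform_eventually[OF lim, rotated, OF eventually_mono]) simp
qed

context iid_layers
begin

lemma indep_shifted: "indep_vars (\<lambda>_. borel) (\<lambda>k. P (b + int k)) L"
proof -
  have "indep_vars (\<lambda>k. PiM {b + int k} (\<lambda>_. borel)) (\<lambda>k \<xi>. restrict (\<lambda>i. P i \<xi>) {b + int k}) L"
    by (rule indep_vars_restrict[OF indep]) (auto simp: disjoint_family_on_def)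
  then have "indep_vars (\<lambda>_. borel) (\<lambda>k \<xi>. (restrict (\<lambda>i. P i \<xi>) {b + int k}) (b + int k)) L"
    by (rule indep_vars_compose2[where Y = "\<lambda>k f. f (b + int k)"]) measurable
  then show ?thesis by simp
qed

lemma distr_block:
  assumes B: "0 < B"
  shows "distr \<Omega> (PiM {..<B} (\<lambda>_. borel)) (\<lambda>\<xi>. \<lambda>k\<in>{..<B}. P (b + int k) \<xi>) = PiM {..<B} (\<lambda>_. distr \<Omega> borel (P 0))"
proof -
  have "distr \<Omega> (PiM {..<B} (\<lambda>_. borel)) (\<lambda>\<xi>. \<lambda>k\<in>{..<B}. P (b + int k) \<xi>) = PiM {..<B} (\<lambda>k. distr \<Omega> borel (P (b + int k)))"
    using indep_shifted[of b "{..<B}"] B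
    by (subst (asm) indep_vars_iff_distr_eq_PiM) auto
  also have "\<dots> = PiM {..<B} (\<lambda>_. distr \<Omega> borel (P 0))"
    by (intro PiM_cong ident refl)
  finally show ?thesis .
qed

definition block :: "nat \<Rightarrow> real \<Rightarrow> nat \<Rightarrow> 'a \<Rightarrow> real" where
  "block B C j \<xi> = block_sum B C (\<lambda>k. P (int (j * B + k)) \<xi>)"

lemma block_restrict: "block B C j \<xi> = block_sum B C (\<lambda>k\<in>{..<B}. P (int (j * B) + int k) \<xi>)"
  unfolding block_def by (simp add: block_sum_restrict)

lemma measurable_block [measurable]: "block B C j \<in> borel_measurable \<Omega>"
  unfolding block_restrict[abs_def]
  by (rule measurable_compose[OF _ measurable_block_sum]) measurable

lemma expectation_block:
  assumes B: "0 < B"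
  shows "expectation (block B C j) = expectation (block B C 0)"
proof -
  have "expectation (block B C j) = integral\<^sup>L (PiM {..<B} (\<lambda>_. distr \<Omega> borel (P 0))) (block_sum B C)" for j
    unfolding distr_block[OF B, of "int (j * B)", symmetric] block_restrict[abs_def]
    by (subst integral_distr) measurable
  then show ?thesis by metis
qed

lemma indep_block:
  assumes B: "0 < B"
  shows "indep_vars (\<lambda>_. borel) (block B C) L"
proof -
  let ?K = "\<lambda>j. {int (j * B)..<int (j * B) + int B}"
  have disj: "disjoint_family_on ?K L"
    unfolding disjoint_family_on_def
  proof (intro ballI impI)
    fix i j :: nat assume "i \<noteq> j"
    show "?K i \<inter> ?K j = {}"
    proof (rule ccontr)
      assume "?K i \<inter> ?K j \<noteq> {}"
      then obtain x where "x \<in> ?K i" "x \<in> ?K j" by blast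
      then have "int (i * B) < int (Suc j * B)" "int (j * B) < int (Suc i * B)" by auto
      then have "i < Suc j" "j < Suc i"
        unfolding of_nat_less_iff mult_less_cancel2 by auto
      then show False using \<open>i \<noteq> j\<close> by simp
    qed
  qed
  have "indep_vars (\<lambda>j. PiM (?K j) (\<lambda>_. borel)) (\<lambda>j \<xi>. restrict (\<lambda>i. P i \<xi>) (?K j)) L"
    by (rule indep_vars_restrict[OF indep _ disj]) simp
  then have "indep_vars (\<lambda>_. borel) (\<lambda>j \<xi>. block_sum B C (\<lambda>k\<in>{..<B}. restrict (\<lambda>i. P i \<xi>) (?K j) (int (j * B) + int k))) L"
  proof (rule indep_vars_compose2[where Y = "\<lambda>j f. block_sum B C (\<lambda>k\<in>{..<B}. f (int (j * B) + int k))"])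
    fix j
    show "(\<lambda>f. block_sum B C (\<lambda>k\<in>{..<B}. f (int (j * B) + int k))) \<in> borel_measurable (PiM (?K j) (\<lambda>_. borel))"
      by (rule measurable_compose[OF measurable_restrict measurable_block_sum])
         (auto intro!: measurable_component_singleton)
  qed
  moreover have "block_sum B C (\<lambda>k\<in>{..<B}. restrict (\<lambda>i. P i \<xi>) (?K j) (int (j * B) + int k)) = block B C j \<xi>" for j \<xi>
    unfolding block_restrict by (rule arg_cong[where f = "block_sum B C"]) (auto simp: restrict_def)
  ultimately show ?thesis by simp
qed

lemma block_bounds:
  assumes "0 \<le> C" "\<forall>i. 0 < P i \<xi> \<and> P i \<xi> < 1"
  shows "block B C j \<xi> \<in> {0..real B * C}"
proof -
  have "0 \<le> (1 - P i \<xi>) / P i \<xi>" for i using assms(2) by (simp add: less_imp_le)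
  then have "0 \<le> block_cell C (\<lambda>i. (1 - P (int (j * B + i)) \<xi>) / P (int (j * B + i)) \<xi>) k"
    "block_cell C (\<lambda>i. (1 - P (int (j * B + i)) \<xi>) / P (int (j * B + i)) \<xi>) k \<le> C" for k
    using assms(1) by (auto intro!: block_cell_bounds)
  then show ?thesis
    unfolding block_def block_sum_def using sum_bounded_above[of "{..<B}" _ C] by (auto intro!: sum_nonneg)
qed

text \<open>A lower bound by half the mean is enough, so Hoeffding's inequality with Borel-Cantelli
  does the work of a law of large numbers. The cap supplies the bounded range.\<close>

lemma AE_block_sums:
  assumes B: "0 < B" and C: "0 < C" and \<mu>: "0 < expectation (block B C 0)"
  shows "AE \<xi> in \<Omega>. eventually (\<lambda>N. real N * (expectation (block B C 0) / 2) < (\<Sum>j<N. block B C j \<xi>)) sequentially"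
proof -
  define \<mu> where "\<mu> = expectation (block B C 0)"
  have mu: "0 < \<mu>" using \<mu> by (simp add: \<mu>_def)
  define D where "D = real B * C"
  have D: "0 < D" using B C by (simp add: D_def)
  let ?A = "\<lambda>N. {\<xi> \<in> space \<Omega>. (\<Sum>j\<in>{..<N}. block B C j \<xi>) \<le> real N * (\<mu> / 2)}"
  have prob: "prob (?A N) \<le> exp (- (\<mu>\<^sup>2 / (2 * D\<^sup>2))) ^ N" if N: "0 < N" for N
  proof -
    interpret indep_interval_bounded_random_variables \<Omega> "{..<N}" "block B C" "\<lambda>_. 0" "\<lambda>_. D"
    proof unfold_locales
      show "finite {..<N}" by simp
      show "indep_vars (\<lambda>_. borel) (block B C) {..<N}" by (rule indep_block[OF B])
      show "AE \<xi> in \<Omega>. block B C j \<xi> \<in> {0..D}" for j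
        using AE_range
      proof eventually_elim
        case (elim \<xi>)
        then show ?case unfolding D_def by (rule block_bounds[OF less_imp_le[OF C]])
      qed
    qed
    interpret Hoeffding_ineq \<Omega> "{..<N}" "block B C" "\<lambda>_. 0" "\<lambda>_. D" "real N * \<mu>"
    proof unfold_locales
      have "(\<Sum>j<N. expectation (block B C j)) = (\<Sum>j<N. \<mu>)"
        unfolding \<mu>_def by (intro sum.cong refl expectation_block B)
      then show "real N * \<mu> \<equiv> (\<Sum>j<N. expectation (block B C j))"
        by (simp add: eq_reflection)
    qed
    have "prob {\<xi> \<in> space \<Omega>. (\<Sum>j\<in>{..<N}. block B C j \<xi>) \<le> real N * \<mu> - real N * (\<mu> / 2)}
       \<le> exp (- 2 * (real N * (\<mu> / 2))\<^sup>2 / (\<Sum>j\<in>{..<N}. (D - 0)\<^sup>2))"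
      by (rule Hoeffding_ineq_le) (use mu N D in auto)
    also have "real N * \<mu> - real N * (\<mu> / 2) = real N * (\<mu> / 2)" by simp
    \<comment> \<open>Deviation N \<mu> / 2 over N variables of range D gives an exponent linear in
      N, hence summable probabilities.\<close>
    also have "- 2 * (real N * (\<mu> / 2))\<^sup>2 / (\<Sum>j\<in>{..<N}. (D - 0)\<^sup>2) = real N * - (\<mu>\<^sup>2 / (2 * D\<^sup>2))"
      using N D by (simp add: field_simps power2_eq_square)
    finally show ?thesis by (simp only: exp_of_nat_mult)
  qed
  have "AE \<xi> in \<Omega>. eventually (\<lambda>N. \<xi> \<in> space \<Omega> - ?A N) sequentially"
  proof (rule borel_cantelli_AE1)
    show "?A N \<in> sets \<Omega>" for N by measurable
    show "emeasure \<Omega> (?A N) < \<infinity>" for N by (simp add: emeasure_eq_measure)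
    have "norm (prob (?A N)) \<le> exp (- (\<mu>\<^sup>2 / (2 * D\<^sup>2))) ^ N" if "1 \<le> N" for N
      using prob[of N] that unfolding real_norm_def abs_of_nonneg[OF measure_nonneg] by simp
    moreover have "summable (\<lambda>N. exp (- (\<mu>\<^sup>2 / (2 * D\<^sup>2))) ^ N)"
      using mu D by (intro summable_geometric) simp
    ultimately show "summable (\<lambda>N. prob (?A N))"
      by (rule summable_comparison_test'[rotated])
  qed
  then show ?thesis
    using AE_space by eventually_elim (auto elim!: eventually_mono simp: \<mu>_def not_le)
qed

text \<open>Without the cap, the block mean is a sum of 2 (E \<rho>)^(k - j) over j \<le> k < B,
  which is at least B (B + 1) because E \<rho> \<ge> 1. Fatou's lemma in the cap transfers this to
  some finite C. The mean per site thus exceeds B, which is what rules out positive speed.\<close>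

lemma block_mean_large:
  assumes mean: "1 \<le> (\<integral>\<^sup>+\<xi>. ennreal (rho (\<lambda>i. P i \<xi>) 0) \<partial>\<Omega>)" and B: "0 < B"
  shows "\<exists>C>0. real B * real B < expectation (block B C 0)"
proof -
  define low where "low \<xi> = (\<Sum>k<B. \<Sum>j\<le>k. 2 * (\<Prod>i\<in>{int j<..int k}. rho (\<lambda>i. P i \<xi>) i))" for \<xi>
  have lim: "AE \<xi> in \<Omega>. (\<lambda>n. block B (real n) 0 \<xi>) \<longlonglongrightarrow> low \<xi>"
    using AE_range
  proof eventually_elim
    case (elim \<xi>)
    have a: "0 \<le> (1 - P (int i) \<xi>) / P (int i) \<xi>" for i using elim by (simp add: less_imp_le)
    have "(\<Prod>i\<in>{j<..k}. (1 - P (int i) \<xi>) / P (int i) \<xi>) = (\<Prod>i\<in>{int j<..int k}. rho (\<lambda>i. P i \<xi>) i)" for j k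
      by (rule prod.reindex_bij_witness[where i = nat and j = int]) (auto simp: rho_def)
    then show ?case
      unfolding block_def block_sum_def low_def
      using tendsto_sum[OF block_cell_limit[where a = "\<lambda>i. (1 - P (int i) \<xi>) / P (int i) \<xi>", OF a], of "\<lambda>k. k" "{..<B}"] by simp
  qed
  have low_mean: "ennreal (real B * (real B + 1)) \<le> (\<integral>\<^sup>+\<xi>. ennreal (low \<xi>) \<partial>\<Omega>)"
  proof -
    have one: "1 \<le> (\<integral>\<^sup>+\<xi>. ennreal (\<Prod>i\<in>A. rho (\<lambda>i. P i \<xi>) i) \<partial>\<Omega>)" if "finite A" for A
    proof -
      have "(\<integral>\<^sup>+\<xi>. (\<Prod>i\<in>A. ennreal ((1 - P i \<xi>) / P i \<xi>)) \<partial>\<Omega>) = (\<integral>\<^sup>+\<xi>. ennreal ((1 - P 0 \<xi>) / P 0 \<xi>) \<partial>\<Omega>) ^ card A"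
        by (rule nn_integral_prod_layers[OF that, where f = "\<lambda>x. ennreal ((1 - x) / x)"]) measurable
      also have "(\<integral>\<^sup>+\<xi>. (\<Prod>i\<in>A. ennreal ((1 - P i \<xi>) / P i \<xi>)) \<partial>\<Omega>) = (\<integral>\<^sup>+\<xi>. ennreal (\<Prod>i\<in>A. rho (\<lambda>i. P i \<xi>) i) \<partial>\<Omega>)"
        by (rule nn_integral_cong_AE, rule AE_mp[OF AE_range])
           (auto intro!: AE_I2 prod_ennreal simp: rho_def less_imp_le)
      finally show ?thesis using mean by (simp add: rho_def one_le_power)
    qed
    have "ennreal (real B * (real B + 1)) = (\<Sum>k<B. \<Sum>j\<le>k. 2 * 1)"
    proof -
      have "(\<Sum>k<B. 2 * (real k + 1)) = real B * (real B + 1)"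
        by (induction B) (auto simp: algebra_simps)
      moreover have "(\<Sum>k<B. \<Sum>j\<le>k. 2 * 1 :: ennreal) = ennreal (\<Sum>k<B. 2 * (real k + 1))"
        by (simp add: ennreal_of_nat_eq_real_of_nat ennreal_mult' algebra_simps flip: sum_ennreal)
      ultimately show ?thesis by simp
    qed
    also have "\<dots> \<le> (\<Sum>k<B. \<Sum>j\<le>k. 2 * (\<integral>\<^sup>+\<xi>. ennreal (\<Prod>i\<in>{int j<..int k}. rho (\<lambda>i. P i \<xi>) i) \<partial>\<Omega>))"
      by (intro sum_mono mult_left_mono one) auto
    also have "\<dots> = (\<integral>\<^sup>+\<xi>. (\<Sum>k<B. \<Sum>j\<le>k. 2 * ennreal (\<Prod>i\<in>{int j<..int k}. rho (\<lambda>i. P i \<xi>) i)) \<partial>\<Omega>)"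
      unfolding rho_def by (subst nn_integral_sum, measurable) (simp add: nn_integral_sum nn_integral_cmult)
    also have "\<dots> = (\<integral>\<^sup>+\<xi>. ennreal (low \<xi>) \<partial>\<Omega>)"
    proof (rule nn_integral_cong_AE, rule AE_mp[OF AE_range], intro AE_I2 impI)
      fix \<xi> assume "\<forall>i. 0 < P i \<xi> \<and> P i \<xi> < 1"
      then have "0 \<le> (\<Prod>i\<in>A. rho (\<lambda>i. P i \<xi>) i)" for A by (intro prod_nonneg) (auto simp: rho_def less_imp_le)
      then show "(\<Sum>k<B. \<Sum>j\<le>k. 2 * ennreal (\<Prod>i\<in>{int j<..int k}. rho (\<lambda>i. P i \<xi>) i)) = ennreal (low \<xi>)"
        unfolding low_def by (simp add: ennreal_mult'[symmetric] sum_nonneg flip: sum_ennreal ennreal_numeral)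
    qed
    finally show ?thesis .
  qed
  \<comment> \<open>Giving up the term B leaves a strict inequality, which passes from the liminf to
    some finite cap.\<close>
  have "ennreal (real B * real B) < ennreal (real B * (real B + 1))"
    using B by (intro ennreal_lessI mult_strict_left_mono mult_pos_pos) auto
  also have "\<dots> \<le> (\<integral>\<^sup>+\<xi>. ennreal (low \<xi>) \<partial>\<Omega>)" by (rule low_mean)
  also have "\<dots> = (\<integral>\<^sup>+\<xi>. liminf (\<lambda>n. ennreal (block B (real n) 0 \<xi>)) \<partial>\<Omega>)"
  proof (rule nn_integral_cong_AE)
    show "AE \<xi> in \<Omega>. ennreal (low \<xi>) = liminf (\<lambda>n. ennreal (block B (real n) 0 \<xi>))"
      using lim
      by eventually_elim (rule lim_imp_Liminf[OF sequentially_bot tendsto_ennrealI, symmetric])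
  qed
  also have "\<dots> \<le> liminf (\<lambda>n. \<integral>\<^sup>+\<xi>. ennreal (block B (real n) 0 \<xi>) \<partial>\<Omega>)"
    by (rule nn_integral_liminf) measurable
  finally have "eventually (\<lambda>n. ennreal (real B * real B) < (\<integral>\<^sup>+\<xi>. ennreal (block B (real n) 0 \<xi>) \<partial>\<Omega>)) sequentially"
    by (rule less_LiminfD)
  then obtain n where n: "0 < n" "ennreal (real B * real B) < (\<integral>\<^sup>+\<xi>. ennreal (block B (real n) 0 \<xi>) \<partial>\<Omega>)"
    using eventually_conj[OF _ eventually_gt_at_top[of 0]] eventually_happens'[OF sequentially_bot] by blast
  have bnd: "AE \<xi> in \<Omega>. block B (real n) 0 \<xi> \<in> {0..real B * real n}"
    using AE_range by eventually_elim (rule block_bounds; simp)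
  have "AE \<xi> in \<Omega>. norm (block B (real n) 0 \<xi>) \<le> real B * real n"
    using bnd by eventually_elim simp
  then have "integrable \<Omega> (block B (real n) 0)"
    by (rule integrable_const_bound) measurable
  then have "(\<integral>\<^sup>+\<xi>. ennreal (block B (real n) 0 \<xi>) \<partial>\<Omega>) = ennreal (expectation (block B (real n) 0))"
    using bnd by (intro nn_integral_eq_integral) (auto elim!: eventually_mono)
  then have "real B * real B < expectation (block B (real n) 0)"
    using n by (simp add: ennreal_less_iff)
  then show ?thesis using n by (intro exI[of _ "real n"]) simp
qed

section \<open>Vanishing speed\<close>

lemma sets_eventually: "{X. eventually (\<lambda>n. R n (X n)) sequentially} \<in> sets path_space"
proof -
  have "{X. eventually (\<lambda>n. R n (X n)) sequentially} = (\<Union>N. \<Inter>n\<in>{N..}. {X. R n (X n)})"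
    by (auto simp: eventually_sequentially)
  also have "\<dots> \<in> sets path_space"
    by (intro sets.countable_UN sets.countable_INT image_subsetI sets_path_space_at) auto
  finally show ?thesis .
qed

text \<open>By \<open>potential_drift\<close> the potential of the walk is at most \<open>2 n\<close>, while it grows at rate at least
  \<open>B / 2\<close> in space; here \<open>B\<close> is arbitrary.\<close>

lemma sublinear_right:
  assumes mean: "1 \<le> (\<integral>\<^sup>+\<xi>. ennreal (rho (\<lambda>i. P i \<xi>) 0) \<partial>\<Omega>)" and B: "0 < B"
  shows "AE \<xi> in \<Omega>. AE X in qlaw \<xi>. eventually (\<lambda>n. real B * real_of_int (fst (X n)) \<le> 8 * real n) sequentially"
proof -
  obtain C where C: "0 < C" "real B * real B < expectation (block B C 0)"
    using block_mean_large[OF mean B] by blast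
  have mu: "0 < expectation (block B C 0)" using C(2) by (rule le_less_trans[rotated]) simp
  show ?thesis
    using AE_block_sums[OF B C(1) mu] AE_range
  proof eventually_elim
    case (elim \<xi>)
    let ?c = "cell B C (rho (\<lambda>i. P i \<xi>))"
    have q: "\<And>i. 0 < P i \<xi> \<and> P i \<xi> < 1" using elim by simp
    have r: "0 \<le> rho (\<lambda>i. P i \<xi>) i" for i using q[of i] by (simp add: rho_def)
    obtain N0 where N0: "\<And>N. N0 \<le> N \<Longrightarrow> real N * (expectation (block B C 0) / 2) < (\<Sum>j<N. block B C j \<xi>)"
      using elim(1) by (auto simp: eventually_sequentially)
    define x0 where "x0 = int (max N0 2 * B)"
    \<comment> \<open>The factor 4 combines x \<le> 2 N B with the loss of half the mean, which
      exceeds B^2. Together with the bound 2 n for the potential this yields 8 n.\<close>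
    have large: "real B * real_of_int x \<le> 4 * potential ?c x" if "x0 \<le> x" for x
    proof -
      have x_ge: "int (max N0 2) * int B \<le> x" using that by (simp add: x0_def)
      define N where "N = nat (x div int B)"
      have "int (max N0 2) \<le> x div int B"
        using zdiv_mono1[OF x_ge, of "int B"] B by simp
      then have N: "max N0 2 \<le> N" "int N = x div int B" by (auto simp: N_def)
      have x: "int (N * B) \<le> x" "x < int (N * B) + int B"
      proof -
        have "x = int (N * B) + x mod int B"
          unfolding of_nat_mult N(2) by simp
        moreover have "0 \<le> x mod int B" "x mod int B < int B" using B by simp_all
        ultimately show "int (N * B) \<le> x" "x < int (N * B) + int B" by linarith+
      qed
      have "real_of_int x \<le> 2 * real (N * B)"
      proof -
        have "B \<le> N * B" using N(1) by simp
        then have "int B \<le> int (N * B)" by (simp only: of_nat_le_iff)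
        then have "x \<le> 2 * int (N * B)" using x(2) by linarith
        then have "real_of_int x \<le> real_of_int (2 * int (N * B))" by (simp only: of_int_le_iff)
        then show ?thesis by simp
      qed
      then have "real B * real_of_int x \<le> real B * (2 * real (N * B))"
        by (intro mult_left_mono) auto
      also have "\<dots> = 4 * (real N * ((real B * real B) / 2))" by simp
      also have "\<dots> \<le> 4 * (real N * (expectation (block B C 0) / 2))"
        using C by (intro mult_left_mono divide_right_mono) auto
      also have "\<dots> \<le> 4 * (\<Sum>j<N. block B C j \<xi>)"
        using N0[of N] N by simp
      also have "(\<Sum>j<N. block B C j \<xi>) = potential ?c (int (N * B))"
        unfolding potential_blocks[OF B] block_def ..
      also have "4 * potential ?c (int (N * B)) \<le> 4 * potential ?c x"
      proof -
        have "{0..<int (N * B)} \<subseteq> {0..<x}" using x by auto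
        then have "(\<Sum>y\<in>{0..<int (N * B)}. ?c y) \<le> (\<Sum>y\<in>{0..<x}. ?c y)"
          by (intro sum_mono2) (auto intro!: cell_bounds r less_imp_le[OF C(1)])
        moreover have "0 \<le> x" using x(1) by (rule order_trans[OF of_nat_0_le_iff])
        ultimately show ?thesis by (simp add: potential_def)
      qed
      finally show ?thesis .
    qed
    have "AE X in qlaw \<xi>. eventually (\<lambda>n. potential ?c (fst (X n)) < 2 * real n) sequentially"
      by (rule potential_drift[OF q less_imp_le[OF C(1)] B])
    then show ?case
    proof eventually_elim
      case (elim X)
      have "eventually (\<lambda>n. real B * real_of_int x0 \<le> real n) sequentially"
        using eventually_ge_at_top[of "nat \<lceil>real B * real_of_int x0\<rceil>"] by eventually_elim linarith
      with elim show ?case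
      proof eventually_elim
        case (elim n)
        show ?case
        proof (cases "x0 \<le> fst (X n)")
          case True
          then show ?thesis using large[of "fst (X n)"] elim by linarith
        next
          \<comment> \<open>Left of the fixed site x0, including all negative sites, the claim holds
            as soon as n is large.\<close>
          case False
          then have "real B * real_of_int (fst (X n)) \<le> real B * real_of_int x0"
            by (intro mult_left_mono) auto
          then show ?thesis using elim by linarith
        qed
      qed
    qed
  qed
qed

end

theorem (in contracting_layers) zero_speed:
  assumes mean: "1 \<le> (\<integral>\<^sup>+\<xi>. ennreal (rho (\<lambda>i. P i \<xi>) 0) \<partial>\<Omega>)"
  shows "AE (\<omega>, X) in Q. (\<lambda>n. (1 / real n) *\<^sub>R to_plane (X n)) \<longlonglongrightarrow> 0"
proof -
  let ?H = "\<lambda>B X. eventually (\<lambda>n. real (Suc B) * real_of_int (fst (X n)) \<le> 8 * real n) sequentially"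
  let ?V = "\<lambda>B X. eventually (\<lambda>n. \<bar>real_of_int (snd (X n))\<bar> < 1 / real (Suc B) * real n) sequentially"
  have "AE w in Q. \<forall>B. ?H B (snd w)"
    unfolding AE_all_countable
    using AE_Q[OF sets_eventually sublinear_right[OF mean zero_less_Suc]] by (simp add: case_prod_unfold)
  moreover have "AE w in Q. \<forall>B. ?V B (snd w)"
    unfolding AE_all_countable
  proof
    fix B
    have "AE (\<omega>, X) in Q. ?V B X"
      using sets_eventually AE_range
      by (rule AE_Q[OF _ AE_mp]) (intro AE_I2 impI vertical_drift; simp)
    then show "AE w in Q. ?V B (snd w)" by (simp add: case_prod_unfold)
  qed
  moreover note transient_right
  ultimately show ?thesis
  proof eventually_elim
    case (elim w)
    obtain \<omega> X where w: "w = (\<omega>, X)" by (cases w)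
    have "(\<lambda>n. (1 / real n) *\<^sub>R to_plane (X n)) \<longlonglongrightarrow> 0"
    proof (rule tendstoI)
      fix e :: real assume e: "0 < e"
      \<comment> \<open>10 leaves room above 8 + 1, the contributions of the two
        coordinates.\<close>
      obtain B where B: "10 / e < real (Suc B)" using reals_Archimedean2[of "10 / e"] by (metis less_Suc_eq of_nat_less_iff order.strict_trans)
      have B': "10 / real (Suc B) < e" using B e by (simp add: field_simps)
      \<comment> \<open>The drift argument bounds the first coordinate from above only; transience
        supplies the other side.\<close>
      have "eventually (\<lambda>n. 0 \<le> fst (X n)) sequentially"
        using elim(3) unfolding w prod.case filterlim_at_top by blast
      moreover have "?H B X" "?V B X" using elim(1,2) unfolding w snd_conv by blast+
      moreover note eventually_gt_at_top[of 0]
      ultimately show "eventually (\<lambda>n. dist ((1 / real n) *\<^sub>R to_plane (X n)) 0 < e) sequentially"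
      proof eventually_elim
        case (elim n)
        have "norm (to_plane (X n)) \<le> \<bar>real_of_int (fst (X n))\<bar> + \<bar>real_of_int (snd (X n))\<bar>"
          unfolding to_plane_def using norm_Pair_le[of "real_of_int (fst (X n))" "real_of_int (snd (X n))"] by simp
        also have "\<bar>real_of_int (fst (X n))\<bar> \<le> 8 / real (Suc B) * real n"
          using elim by (simp add: field_simps)
        also have "8 / real (Suc B) * real n + \<bar>real_of_int (snd (X n))\<bar> \<le> 8 / real (Suc B) * real n + 1 / real (Suc B) * real n"
          using elim by simp
        also have "\<dots> \<le> 10 / real (Suc B) * real n"
        proof -
          have "8 / b * t + 1 / b * t \<le> 10 / b * t" if "0 < b" "0 \<le> t" for b t :: real
            using that by (simp add: field_simps)
          then show ?thesis by simp
        qed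
        also have "\<dots> < e * real n" using B' elim by (intro mult_strict_right_mono) auto
        finally show ?case using elim by (simp add: field_simps)
      qed
    qed
    then show ?case by (simp add: w)
  qed
qed

section \<open>The polynomial condition\<close>

text \<open>The bad event is a countable union of cylinders, one for each path up to its exit. Exit
  times are unique, so the cylinders are disjoint. Their paths avoid the half plane, so their
  probabilities involve only the environment outside it.\<close>

lemma quenched_bad_cong:
  assumes "\<And>z. z \<notin> left_halfplane y \<Longrightarrow> \<omega> z = \<omega>' z"
  shows "emeasure (quenched_law \<omega>) {X. (\<eta>, X) \<in> bad_exit_event c L y}
       = emeasure (quenched_law \<omega>') {X. (\<eta>, X) \<in> bad_exit_event c L y}"
proof -
  define exits where "exits X n \<longleftrightarrow> X n \<notin> box c L \<and> X n \<notin> right_boundary c L \<and>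
     (\<forall>k<n. X k \<in> box c L) \<and> (\<forall>k\<le>n. X k \<notin> left_halfplane y)" for X :: path and n
  define I where "I = {xs :: site list. \<exists>n. length xs = Suc n \<and> exits (\<lambda>k. xs ! k) n}"
  have exits_cong: "exits X n \<longleftrightarrow> exits X' n" if "\<And>k. k \<le> n \<Longrightarrow> X k = X' k" for X X' n
    unfolding exits_def using that by (metis less_imp_le_nat order_refl)
  have exits_unique: "n = n'" if "exits X n" "exits X n'" for X n n'
    using that unfolding exits_def by (metis linorder_neqE_nat)
  have eq: "{X. (\<eta>, X) \<in> bad_exit_event c L y} = (\<Union>xs\<in>I. list_cylinder xs)"
  proof (rule set_eqI)
    fix X :: path
    have "(\<eta>, X) \<in> bad_exit_event c L y \<longleftrightarrow> (\<exists>n. exits X n)"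
      unfolding bad_exit_event_eq exits_def by simp
    also have "\<dots> \<longleftrightarrow> (\<exists>xs\<in>I. X \<in> list_cylinder xs)"
    proof
      assume "\<exists>n. exits X n"
      then obtain n where n: "exits X n" ..
      have "exits (\<lambda>k. map X [0..<Suc n] ! k) n"
        using n by (subst exits_cong[of n _ X]) (simp_all add: nth_append del: upt_Suc)
      moreover have "X \<in> list_cylinder (map X [0..<Suc n])"
        by (simp add: list_cylinder_def del: upt_Suc)
      ultimately show "\<exists>xs\<in>I. X \<in> list_cylinder xs"
        by (intro bexI[of _ "map X [0..<Suc n]"]) (auto simp: I_def simp del: upt_Suc)
    next
      assume "\<exists>xs\<in>I. X \<in> list_cylinder xs"
      then obtain xs n where "length xs = Suc n" "exits (\<lambda>k. xs ! k) n" "X \<in> list_cylinder xs"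
        unfolding I_def by blast
      then have "exits X n"
        by (subst exits_cong[of n X "\<lambda>k. xs ! k"]) (auto simp: list_cylinder_def)
      then show "\<exists>n. exits X n" ..
    qed
    finally show "X \<in> {X. (\<eta>, X) \<in> bad_exit_event c L y} \<longleftrightarrow> X \<in> (\<Union>xs\<in>I. list_cylinder xs)" by simp
  qed
  have disj: "disjoint_family_on list_cylinder I"
    unfolding disjoint_family_on_def
  proof (intro ballI impI)
    fix xs ys assume "xs \<in> I" "ys \<in> I" "xs \<noteq> ys"
    show "list_cylinder xs \<inter> list_cylinder ys = {}"
    proof (rule ccontr)
      assume "list_cylinder xs \<inter> list_cylinder ys \<noteq> {}"
      then obtain X where X: "X \<in> list_cylinder xs" "X \<in> list_cylinder ys" by blast
      obtain n n' where n: "length xs = Suc n" "exits (\<lambda>k. xs ! k) n" and n': "length ys = Suc n'" "exits (\<lambda>k. ys ! k) n'"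
        using \<open>xs \<in> I\<close> \<open>ys \<in> I\<close> unfolding I_def by blast
      have "exits X n"
        using n X(1) by (subst exits_cong[of n X "\<lambda>k. xs ! k"]) (auto simp: list_cylinder_def)
      moreover have "exits X n'"
        using n' X(2) by (subst exits_cong[of n' X "\<lambda>k. ys ! k"]) (auto simp: list_cylinder_def)
      ultimately have "n = n'" by (rule exits_unique)
      then have "xs = ys" using X n n' by (intro nth_equalityI) (auto simp: list_cylinder_def)
      then show False using \<open>xs \<noteq> ys\<close> by contradiction
    qed
  qed
  have cyl: "list_cylinder xs \<in> sets (quenched_law \<omega>)" for xs \<omega>
    unfolding sets_quenched_law sets_path_space_cylinders by (auto intro: sigma_sets.Basic)
  have "emeasure (quenched_law \<omega>) (list_cylinder xs) = emeasure (quenched_law \<omega>') (list_cylinder xs)" if xs: "xs \<in> I" for xs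
  proof -
    obtain n where n: "length xs = Suc n" "exits (\<lambda>k. xs ! k) n" using xs unfolding I_def by blast
    have "step_pmf \<omega> (xs ! k) = step_pmf \<omega>' (xs ! k)" if "k < n" for k
    proof -
      \<comment> \<open>Only the starting sites of the steps enter the product, and all of them
        precede the exit.\<close>
      have "xs ! k \<notin> left_halfplane y" using n(2) that unfolding exits_def by simp
      then show ?thesis by (simp add: step_pmf_def assms)
    qed
    then show ?thesis using n(1) by (simp add: emeasure_quenched_list_cylinder)
  qed
  then show ?thesis
    unfolding eq emeasure_UN_countable[OF cyl countableI_type disj]
    by (auto intro!: nn_integral_cong)
qed

context iid_layers
begin

text \<open>The half plane is a union of layers. A is decided by the layers left of y, the quenched
  probability of the bad event by the others, and these two groups are independent.\<close>

lemma bad_exit_independent: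
  assumes A: "A \<in> sets (halfplane_algebra y)"
  shows "emeasure Q (A \<inter> bad_exit_event c L y) = emeasure Q A * emeasure Q (bad_exit_event c L y)"
proof -
  let ?H = "left_halfplane y" and ?bad = "bad_exit_event c L y"
  obtain B where B: "B \<in> sets (PiM ?H (\<lambda>_. PiM UNIV (\<lambda>_. borel)))"
    and A_eq: "A = {(\<omega>, X). restrict \<omega> ?H \<in> B}"
  proof -
    have "(\<lambda>(\<omega>, X). restrict \<omega> ?H) \<in> space (env_space \<Otimes>\<^sub>M path_space) \<rightarrow> space (PiM ?H (\<lambda>_. PiM UNIV (\<lambda>_. borel)))"
      by (auto simp: space_PiM)
    from sets_vimage_algebra2[OF this] A obtain B where "B \<in> sets (PiM ?H (\<lambda>_. PiM UNIV (\<lambda>_. borel)))"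
      "A = (\<lambda>(\<omega>, X). restrict \<omega> ?H) -` B \<inter> space (env_space \<Otimes>\<^sub>M path_space)"
      unfolding halfplane_algebra_def by auto
    then show thesis
      by (intro that[of B]) (auto simp: space_pair_measure)
  qed
  have A': "A \<in> sets (env_space \<Otimes>\<^sub>M path_space)"
    using A subalgebra_halfplane_algebra[of Q y] unfolding subalgebra_def by auto
  note bad' = sets_bad_exit_event[of c L y]
  \<comment> \<open>Filling the missing layers with 1/2 turns each group into a full environment
    that depends on that group only.\<close>
  define left :: "(int \<Rightarrow> real) \<Rightarrow> int \<Rightarrow> real" where "left f i = (if i < fst y then f i else 1 / 2)" for f i
  define right :: "(int \<Rightarrow> real) \<Rightarrow> int \<Rightarrow> real" where "right f i = (if i < fst y then 1 / 2 else f i)" for f i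
  \<comment> \<open>The index b selects the group, so that independence of a two-element family
    applies. \<open>undefined\<close> stands for the environment component, which does not affect
    membership in the bad event.\<close>
  define G where "G b f = (if b then indicator B (restrict (layered_env (left f)) ?H)
      else emeasure (layered_law (right f)) {X. (undefined, X) \<in> ?bad})" for b f
  define K where "K b = (if b then {..<fst y} else {fst y..})" for b
  have left_restrict: "left (restrict f (K True)) = left f" and right_restrict: "right (restrict f (K False)) = right f" for f
    by (auto simp: left_def right_def K_def fun_eq_iff)
  have G_meas: "G b \<in> borel_measurable (PiM (K b) (\<lambda>_. borel))" for b
  proof (cases b)
    case True
    have "left \<in> PiM (K True) (\<lambda>_. borel) \<rightarrow>\<^sub>M PiM UNIV (\<lambda>_. borel)"
    proof (rule measurable_PiM_single')
      fix i
      show "(\<lambda>f. left f i) \<in> borel_measurable (PiM (K True) (\<lambda>_. borel))"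
        by (cases "i < fst y") (auto simp: left_def K_def intro!: measurable_component_singleton)
    qed (auto simp: space_PiM)
    moreover have "(\<lambda>\<omega>. restrict \<omega> ?H) \<in> env_space \<rightarrow>\<^sub>M PiM ?H (\<lambda>_. PiM UNIV (\<lambda>_. borel))"
      unfolding env_space_def by (rule measurable_restrict_subset) simp
    ultimately have "(\<lambda>f. restrict (layered_env (left f)) ?H) \<in> PiM (K True) (\<lambda>_. borel) \<rightarrow>\<^sub>M PiM ?H (\<lambda>_. PiM UNIV (\<lambda>_. borel))"
      by (intro measurable_compose[OF measurable_compose[OF _ measurable_layered_env]])
    then show ?thesis
      using True B by (simp add: G_def[abs_def] measurable_compose[OF _ borel_measurable_indicator])
  next
    case False
    have "right \<in> PiM (K False) (\<lambda>_. borel) \<rightarrow>\<^sub>M PiM UNIV (\<lambda>_. borel)"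
    proof (rule measurable_PiM_single')
      fix i
      show "(\<lambda>f. right f i) \<in> borel_measurable (PiM (K False) (\<lambda>_. borel))"
        by (cases "i < fst y") (auto simp: right_def K_def intro!: measurable_component_singleton)
    qed (auto simp: space_PiM)
    then have "(\<lambda>f. layered_law (right f)) \<in> PiM (K False) (\<lambda>_. borel) \<rightarrow>\<^sub>M subprob_algebra path_space"
      by (intro measurable_compose[OF measurable_compose[OF _ measurable_layered_env] measurable_prob_algebraD[OF measurable_quenched_law]])
    moreover have "{X. (undefined, X) \<in> ?bad} \<in> sets path_space"
      using measurable_sets[OF measurable_Pair1', of undefined env_space ?bad path_space] bad' by (simp add: vimage_def)
    ultimately show ?thesis
      using False by (simp add: G_def[abs_def] measurable_compose[OF _ measurable_emeasure_subprob_algebra])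
  qed
  have G_True: "G True (restrict (\<lambda>i. P i \<xi>) (K True)) = indicator A (layered_env (\<lambda>i. P i \<xi>), X)" for \<xi> X
  proof -
    have "restrict (layered_env (left f)) ?H = restrict (layered_env f) ?H" for f
    proof (intro ext)
      fix z d
      show "restrict (layered_env (left f)) ?H z d = restrict (layered_env f) ?H z d"
        by (cases z; cases d) (auto simp: left_def left_halfplane_def restrict_def)
    qed
    then show ?thesis
      unfolding G_def left_restrict A_eq by (simp add: indicator_def)
  qed
  have G_False: "G False (restrict (\<lambda>i. P i \<xi>) (K False)) = emeasure (qlaw \<xi>) {X. (layered_env (\<lambda>i. P i \<xi>), X) \<in> ?bad}" for \<xi>
  proof -
    have "layered_env (right f) z = layered_env f z" if "z \<notin> ?H" for f z
    proof (rule ext)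
      fix d show "layered_env (right f) z d = layered_env f z d"
        using that by (cases z; cases d) (auto simp: right_def left_halfplane_def)
    qed
    then have "G False (restrict (\<lambda>i. P i \<xi>) (K False)) = emeasure (qlaw \<xi>) {X. (undefined, X) \<in> ?bad}"
      unfolding G_def right_restrict by (simp, intro quenched_bad_cong) simp
    also have "{X. (undefined, X) \<in> ?bad} = {X. (layered_env (\<lambda>i. P i \<xi>), X) \<in> ?bad}"
      by (simp add: bad_exit_event_eq)
    finally show ?thesis .
  qed
  have "indep_vars (\<lambda>b. PiM (K b) (\<lambda>_. borel)) (\<lambda>b \<xi>. restrict (\<lambda>i. P i \<xi>) (K b)) UNIV"
    by (rule indep_vars_restrict[OF indep]) (auto simp: disjoint_family_on_def K_def)
  then have "indep_vars (\<lambda>_. borel) (\<lambda>b \<xi>. G b (restrict (\<lambda>i. P i \<xi>) (K b))) UNIV"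
    by (rule indep_vars_compose2) (rule G_meas)
  then have "(\<integral>\<^sup>+\<xi>. (\<Prod>b\<in>UNIV. G b (restrict (\<lambda>i. P i \<xi>) (K b))) \<partial>\<Omega>) = (\<Prod>b\<in>UNIV. \<integral>\<^sup>+\<xi>. G b (restrict (\<lambda>i. P i \<xi>) (K b)) \<partial>\<Omega>)"
    by (intro indep_vars_nn_integral) auto
  then have prod: "(\<integral>\<^sup>+\<xi>. G True (restrict (\<lambda>i. P i \<xi>) (K True)) * G False (restrict (\<lambda>i. P i \<xi>) (K False)) \<partial>\<Omega>)
     = (\<integral>\<^sup>+\<xi>. G True (restrict (\<lambda>i. P i \<xi>) (K True)) \<partial>\<Omega>) * (\<integral>\<^sup>+\<xi>. G False (restrict (\<lambda>i. P i \<xi>) (K False)) \<partial>\<Omega>)"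
    by (simp add: UNIV_bool mult.commute)
  have A_env: "(\<omega>, X) \<in> A \<longleftrightarrow> (\<omega>, X') \<in> A" for \<omega> X X' by (simp add: A_eq)
  have "emeasure Q (A \<inter> ?bad) = (\<integral>\<^sup>+\<xi>. G True (restrict (\<lambda>i. P i \<xi>) (K True)) * G False (restrict (\<lambda>i. P i \<xi>) (K False)) \<partial>\<Omega>)"
    unfolding emeasure_Q[OF sets.Int[OF A' bad']] G_False
  proof (rule nn_integral_cong)
    fix \<xi>
    show "emeasure (qlaw \<xi>) {X. (layered_env (\<lambda>i. P i \<xi>), X) \<in> A \<inter> ?bad}
        = G True (restrict (\<lambda>i. P i \<xi>) (K True)) * emeasure (qlaw \<xi>) {X. (layered_env (\<lambda>i. P i \<xi>), X) \<in> ?bad}"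
      unfolding G_True[of _ undefined]
      using A_env[of "layered_env (\<lambda>i. P i \<xi>)" _ undefined] by (cases "(layered_env (\<lambda>i. P i \<xi>), undefined) \<in> A") auto
  qed
  moreover have "emeasure Q A = (\<integral>\<^sup>+\<xi>. G True (restrict (\<lambda>i. P i \<xi>) (K True)) \<partial>\<Omega>)"
    unfolding emeasure_Q[OF A']
  proof (rule nn_integral_cong)
    fix \<xi>
    show "emeasure (qlaw \<xi>) {X. (layered_env (\<lambda>i. P i \<xi>), X) \<in> A} = G True (restrict (\<lambda>i. P i \<xi>) (K True))"
      unfolding G_True[of _ undefined]
      using A_env[of "layered_env (\<lambda>i. P i \<xi>)" _ undefined] quenched.emeasure_space_1[of "layered_env (\<lambda>i. P i \<xi>)"]
      by (cases "(layered_env (\<lambda>i. P i \<xi>), undefined) \<in> A") auto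
  qed
  moreover have "emeasure Q ?bad = (\<integral>\<^sup>+\<xi>. G False (restrict (\<lambda>i. P i \<xi>) (K False)) \<partial>\<Omega>)"
    unfolding emeasure_Q[OF bad'] G_False ..
  ultimately show ?thesis using prod by simp
qed

text \<open>By independence the conditional probability is constant, so the essential supremum in
  the polynomial condition reduces to an unconditional probability.\<close>

lemma cond_exp_bad_exit:
  "AE w in Q. real_cond_exp Q (halfplane_algebra y) (indicator (bad_exit_event c L y)) w = measure Q (bad_exit_event c L y)"
proof -
  let ?bad = "bad_exit_event c L y"
  interpret sub: finite_measure_subalgebra Q "halfplane_algebra y"
    by unfold_locales (rule subalgebra_halfplane_algebra[OF sets_Q])
  show ?thesis
  proof (rule sub.real_cond_exp_charact)
    fix A assume A: "A \<in> sets (halfplane_algebra y)"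
    then have A': "A \<in> sets Q" using sub.subalg unfolding subalgebra_def by auto
    have bad: "?bad \<in> sets Q" using sets_bad_exit_event by simp
    have "(\<integral>w\<in>A. indicator ?bad w \<partial>Q) = measure Q (A \<inter> ?bad)"
      unfolding set_lebesgue_integral_def using A' bad by (simp flip: indicator_inter_arith)
    also have "\<dots> = measure Q A * measure Q ?bad"
      using bad_exit_independent[OF A, of c L]
      by (simp add: annealed.emeasure_eq_measure ennreal_mult[symmetric])
    also have "\<dots> = (\<integral>w\<in>A. measure Q ?bad \<partial>Q)"
      unfolding set_lebesgue_integral_def using A' by simp
    finally show "(\<integral>w\<in>A. indicator ?bad w \<partial>Q) = (\<integral>w\<in>A. measure Q ?bad \<partial>Q)" .
  qed (use sets_bad_exit_event[of c L y] in \<open>auto simp: annealed.emeasure_eq_measure\<close>)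
qed

lemma esssup_cond_exp_bad_exit:
  "esssup Q (\<lambda>w. ereal (real_cond_exp Q (halfplane_algebra y) (indicator (bad_exit_event c L y)) w))
     = ereal (measure Q (bad_exit_event c L y))"
proof -
  have "esssup Q (\<lambda>w. ereal (real_cond_exp Q (halfplane_algebra y) (indicator (bad_exit_event c L y)) w))
     = esssup Q (\<lambda>w. ereal (measure Q (bad_exit_event c L y)))"
    using cond_exp_bad_exit[of y c L] by (intro esssup_AE_cong) (auto elim!: eventually_mono)
  then show ?thesis
    using annealed.emeasure_space_1 by (simp add: esssup_const)
qed

lemma AE_annealed_nearest_neighbour: "AE (\<omega>, X) in Q. X 0 = 0 \<and> (\<forall>n. \<exists>d. X (Suc n) = X n + dir_vec d)"
proof (rule AE_Q)
  have "{X :: path. X 0 = 0 \<and> (\<forall>n. \<exists>d. X (Suc n) = X n + dir_vec d)}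
     = {X. X 0 = 0} \<inter> (\<Inter>n. \<Union>z. \<Union>d. {X. X n = z} \<inter> {X. X (Suc n) = z + dir_vec d})" by auto
  also have "\<dots> \<in> sets path_space"
    by (intro sets.Int sets.countable_INT sets.countable_UN sets.finite_UN image_subsetI sets_path_space_at) auto
  finally show "{X :: path. X 0 = 0 \<and> (\<forall>n. \<exists>d. X (Suc n) = X n + dir_vec d)} \<in> sets path_space" .
qed (intro AE_I2 AE_nearest_neighbour)

end

section \<open>Exits from a box\<close>

lemma neighbour_in_outer_boundary:
  assumes "z \<in> A" "z + dir_vec d \<notin> A"
  shows "z + dir_vec d \<in> outer_boundary A"
  using assms unfolding outer_boundary_def by (intro CollectI conjI bexI[of _ z]) (cases d; auto)+

text \<open>An exit that is not on the right is on the left or vertical. A left exit is a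
  backtracking from level 0, occupied at time 0. A vertical exit by time N is a large height; if the
  exit comes after N, the walk is still in the box, so level \<lceil>L\<rceil> has not been
  reached.\<close>

lemma bad_exit_cases:
  assumes L: "0 < L" and X: "X 0 = 0" "\<And>n. \<exists>d. X (Suc n) = X n + dir_vec d"
    and bad: "(\<omega>, X) \<in> bad_exit_event 1 L y"
  shows "(\<exists>k. \<exists>j\<le>k. 0 \<le> fst (X j) \<and> fst (X k) \<le> - \<lceil>L\<rceil>)
     \<or> (\<forall>k\<le>N. fst (X k) < \<lceil>L\<rceil>) \<or> (\<exists>k\<le>N. L \<le> \<bar>real_of_int (snd (X k))\<bar>)"
proof -
  obtain n where n: "X n \<notin> box 1 L" "X n \<notin> right_boundary 1 L" "\<And>k. k < n \<Longrightarrow> X k \<in> box 1 L"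
    using bad unfolding bad_exit_event_eq by auto
  have "X 0 \<in> box 1 L" using X L by (simp add: box_def)
  then obtain m where m: "n = Suc m" using n(1) by (cases n) auto
  obtain d where d: "X n = X m + dir_vec d" using X(2) m by blast
  \<comment> \<open>For a site of the outer boundary, missing \<open>right_boundary\<close> means
    that its first coordinate is below L.\<close>
  have "X n \<in> outer_boundary (box 1 L)"
    unfolding d by (rule neighbour_in_outer_boundary) (use n m d in auto)
  then have "real_of_int (fst (X n)) < L" using n(2) unfolding right_boundary_def by auto
  with n(1) have "real_of_int (fst (X n)) \<le> - L \<or> L \<le> \<bar>real_of_int (snd (X n))\<bar>"
    by (auto simp: box_def)
  then consider "real_of_int (fst (X n)) \<le> - L" | "N < n" | "n \<le> N" "L \<le> \<bar>real_of_int (snd (X n))\<bar>"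
    by linarith
  then show ?thesis
  proof cases
    case 1
    then have "fst (X n) \<le> - \<lceil>L\<rceil>" by linarith
    moreover have "0 \<le> fst (X 0)" using X by simp
    ultimately show ?thesis by blast
  next
    case 2
    have "fst (X k) < \<lceil>L\<rceil>" if "k \<le> N" for k
    proof -
      have "X k \<in> box 1 L" using n(3) that 2 by simp
      then have "real_of_int (fst (X k)) < L" by (simp add: box_def)
      then show ?thesis by linarith
    qed
    then show ?thesis by blast
  next
    case 3
    then show ?thesis by blast
  qed
qed

context contracting_layers
begin

text \<open>Dropping the half-plane constraint only enlarges the event and makes the bound uniform
  in y.\<close>

lemma measure_bad_exit_le:
  assumes L: "0 < L" and N: "0 < N"
  shows "measure Q (bad_exit_event 1 L y)
    \<le> r ^ nat \<lceil>L\<rceil> / (1 - r) + 4 / (1 - r) * real_of_int \<lceil>L\<rceil> * real N powr - s + real N / (2 * L\<^sup>2)"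
proof -
  let ?R = "{(\<omega> :: env, X :: path). \<exists>k. \<exists>j\<le>k. 0 \<le> fst (X j) \<and> fst (X k) \<le> - \<lceil>L\<rceil>}"
  let ?H = "{(\<omega> :: env, X :: path). \<forall>k\<le>N. fst (X k) < \<lceil>L\<rceil>}"
  let ?V = "{(\<omega> :: env, X :: path). \<exists>k\<le>N. L \<le> \<bar>real_of_int (snd (X k))\<bar>}"
  have L': "0 < \<lceil>L\<rceil>" using L by simp
  have V: "?V \<in> sets Q"
    using path_event[OF sets_vertical_paths] by simp
  have "AE w in Q. w \<in> bad_exit_event 1 L y \<longrightarrow> w \<in> ?R \<union> ?H \<union> ?V"
    using AE_annealed_nearest_neighbour
  proof eventually_elim
    case (elim w)
    obtain \<omega> X where w: "w = (\<omega>, X)" by (cases w)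
    show ?case
      unfolding w Un_iff mem_Collect_eq prod.case disj_assoc
      using elim bad_exit_cases[OF L, of X \<omega> y N] unfolding w by blast
  qed
  then have "measure Q (bad_exit_event 1 L y) \<le> measure Q (?R \<union> ?H \<union> ?V)"
    using V sets_no_hit sets_backtrack by (intro annealed.finite_measure_mono_AE) auto
  also have "\<dots> \<le> measure Q (?R \<union> ?H) + measure Q ?V"
    by (rule measure_Un_le) (use V sets_no_hit sets_backtrack in auto)
  also have "\<dots> \<le> measure Q ?R + measure Q ?H + measure Q ?V"
    by (intro add_right_mono measure_Un_le) (use V sets_no_hit sets_backtrack in auto)
  also have "\<dots> \<le> r ^ nat \<lceil>L\<rceil> / (1 - r) + 4 / (1 - r) * real_of_int \<lceil>L\<rceil> * real N powr - s + real N / (2 * L\<^sup>2)"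
  proof (intro add_mono measure_Q_le)
    show "emeasure Q ?R \<le> ennreal (r ^ nat \<lceil>L\<rceil> / (1 - r))"
      using annealed_backtrack[of "- \<lceil>L\<rceil>" 0] L' by simp
    show "emeasure Q ?H \<le> ennreal (4 / (1 - r) * real_of_int \<lceil>L\<rceil> * real N powr - s)"
      by (rule annealed_hitting[OF L' N])
    show "emeasure Q ?V \<le> ennreal (real N / (2 * L\<^sup>2))"
      by (rule annealed_vertical[OF L])
  qed (use r L' L in auto)
  finally show ?thesis .
qed

lemma tendsto_powr_times_power:
  assumes M: "M \<le> 1"
  shows "((\<lambda>L::real. L powr M * r ^ nat \<lceil>L\<rceil>) \<longlongrightarrow> 0) at_top"
proof -
  \<comment> \<open>Raising r to at least 1/2 makes the logarithm meaningful also for r = 0.\<close>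
  define a where "a = max r (1 / 2)"
  have a: "0 < a" "a < 1" "r \<le> a" using r by (auto simp: a_def)
  define c where "c = - ln a"
  have c: "0 < c" using a by (simp add: c_def)
  have "((\<lambda>L::real. 1 / c * ((c * L) ^ 1 / exp (c * L))) \<longlongrightarrow> 1 / c * 0) at_top"
    by (intro tendsto_mult_left filterlim_compose[OF tendsto_power_div_exp_0]
        filterlim_tendsto_pos_mult_at_top[OF tendsto_const c] filterlim_ident)
  then have lim: "((\<lambda>L::real. 1 / c * ((c * L) ^ 1 / exp (c * L))) \<longlongrightarrow> 0) at_top" by simp
  show ?thesis
  proof (rule tendsto_sandwich[OF _ _ tendsto_const lim])
    show "eventually (\<lambda>L::real. 0 \<le> L powr M * r ^ nat \<lceil>L\<rceil>) at_top"
      using r by (intro always_eventually) simp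
    show "eventually (\<lambda>L::real. L powr M * r ^ nat \<lceil>L\<rceil> \<le> 1 / c * ((c * L) ^ 1 / exp (c * L))) at_top"
      using eventually_ge_at_top[of 1]
    proof eventually_elim
      case (elim L)
      have "r ^ nat \<lceil>L\<rceil> \<le> a ^ nat \<lceil>L\<rceil>" using a r by (intro power_mono) auto
      also have "\<dots> = a powr real (nat \<lceil>L\<rceil>)" using a by (simp add: powr_realpow)
      also have "\<dots> \<le> a powr L"
        using a elim by (intro powr_mono') (auto simp: of_nat_ceiling)
      also have "\<dots> = 1 / exp (c * L)"
        using a by (simp add: powr_def c_def exp_minus inverse_eq_divide mult.commute)
      finally have 1: "r ^ nat \<lceil>L\<rceil> \<le> 1 / exp (c * L)" .
      have "L powr M \<le> L powr 1" using elim M by (intro powr_mono) auto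
      then have "L powr M * r ^ nat \<lceil>L\<rceil> \<le> L * (1 / exp (c * L))"
        using 1 elim r by (intro mult_mono) auto
      then show ?case using c by simp
    qed
  qed
qed

text \<open>With N about L powr (2 - \<delta>), the vertical and the hitting terms decay like L powr
  - \<delta> and L powr (1 - (2 - \<delta>) * s). The two strict inequalities for M say that both
  beat L powr M.\<close>

theorem polynomial_condition_Q:
  assumes M: "M \<le> 1" "M < \<delta>" "M + 1 < (2 - \<delta>) * s" and \<delta>: "\<delta> < 2"
  shows "polynomial_condition Q M 1"
proof -
  \<comment> \<open>16 = 4 * 2 * 2: the constant of \<open>annealed_hitting\<close>, the bound
    \<lceil>L\<rceil> \<le> 2 L, and 2 powr s \<le> 2 for rounding the time down.\<close>
  define b where "b L = r ^ nat \<lceil>L\<rceil> / (1 - r) + 16 / (1 - r) * L powr (1 - (2 - \<delta>) * s) + L powr - \<delta> / 2" for L :: real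
  have bound: "measure Q (bad_exit_event 1 L y) \<le> b L" if L: "1 \<le> L" for L y
  proof -
    define x where "x = L powr (2 - \<delta>)"
    have x: "1 \<le> x" unfolding x_def using L \<delta> by (intro ge_one_powr_ge_zero) auto
    define N where "N = nat \<lfloor>x\<rfloor>"
    have fl: "1 \<le> \<lfloor>x\<rfloor>" using x by (simp add: le_floor_iff)
    then have "real N = real_of_int \<lfloor>x\<rfloor>" "0 < N" by (simp_all add: N_def)
    moreover have "1 \<le> real_of_int \<lfloor>x\<rfloor>" using fl by linarith
    moreover have "real_of_int \<lfloor>x\<rfloor> \<le> x" "x < real_of_int \<lfloor>x\<rfloor> + 1" by linarith+
    \<comment> \<open>Rounding down loses at most a factor 2 because x \<ge> 1.\<close>
    ultimately have N: "0 < N" "real N \<le> x" "x / 2 \<le> real N" by linarith+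
    have "real N powr - s \<le> (x / 2) powr - s"
      using N x s by (intro powr_mono2') auto
    also have "\<dots> = 2 powr s * x powr - s"
      using x by (simp add: powr_divide powr_minus field_simps)
    also have "\<dots> \<le> 2 * x powr - s"
      using powr_mono[of s 1 2] s by (intro mult_right_mono) auto
    also have "x powr - s = L powr - ((2 - \<delta>) * s)"
      unfolding x_def powr_powr by simp
    finally have Ns: "real N powr - s \<le> 2 * L powr - ((2 - \<delta>) * s)" .
    have "real_of_int \<lceil>L\<rceil> * real N powr - s \<le> 2 * L * (2 * L powr - ((2 - \<delta>) * s))"
      using L Ns by (intro mult_mono) (linarith | simp)+
    also have "\<dots> = 4 * L powr (1 - (2 - \<delta>) * s)"
      using L powr_add[of L 1 "- ((2 - \<delta>) * s)"] by simp
    finally have "4 / (1 - r) * (real_of_int \<lceil>L\<rceil> * real N powr - s) \<le> 4 / (1 - r) * (4 * L powr (1 - (2 - \<delta>) * s))"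
      using r by (intro mult_left_mono) auto
    moreover have "real N / (2 * L\<^sup>2) \<le> L powr - \<delta> / 2"
    proof -
      have "real N / (2 * L\<^sup>2) \<le> L powr (2 - \<delta>) / (2 * L\<^sup>2)"
        using N L unfolding x_def by (intro divide_right_mono) auto
      also have "\<dots> = L powr - \<delta> / 2"
        using L powr_add[of L 2 "- \<delta>"] by simp
      finally show ?thesis .
    qed
    ultimately show ?thesis
      using measure_bad_exit_le[of L N y] L N unfolding b_def by (simp add: mult.assoc)
  qed
  have "((\<lambda>L. L powr M * r ^ nat \<lceil>L\<rceil> / (1 - r) + 16 / (1 - r) * L powr - ((2 - \<delta>) * s - 1 - M) + L powr - (\<delta> - M) / 2)
      \<longlongrightarrow> 0 / (1 - r) + 16 / (1 - r) * 0 + 0 / 2) at_top"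
    using M r by (intro tendsto_add tendsto_divide tendsto_mult_left tendsto_const tendsto_powr_times_power
        tendsto_neg_powr filterlim_ident) auto
  moreover have "L powr M * r ^ nat \<lceil>L\<rceil> / (1 - r) + 16 / (1 - r) * L powr - ((2 - \<delta>) * s - 1 - M) + L powr - (\<delta> - M) / 2
      = L powr M * b L" for L
  proof -
    have "L powr - ((2 - \<delta>) * s - 1 - M) = L powr M * L powr (1 - (2 - \<delta>) * s)"
      "L powr - (\<delta> - M) = L powr M * L powr - \<delta>"
      by (simp_all add: powr_add[symmetric] algebra_simps)
    then show ?thesis unfolding b_def by (simp only: distrib_left times_divide_eq_right mult_ac)
  qed
  ultimately have lim: "((\<lambda>L. ereal (L powr M * b L)) \<longlongrightarrow> ereal 0) at_top" by simp
  let ?g = "\<lambda>L. ereal (L powr M) * (SUP y\<in>{y. fst y < 0}. ereal (measure Q (bad_exit_event 1 L y)))"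
  have "(?g \<longlongrightarrow> ereal 0) at_top"
  proof (rule tendsto_sandwich[OF _ _ tendsto_const lim])
    show "eventually (\<lambda>L. ereal 0 \<le> ?g L) at_top"
    proof (intro always_eventually allI)
      fix L
      \<comment> \<open>An explicit site is used because the supremum of an empty family would be
        negative.\<close>
      have "ereal 0 \<le> ereal (measure Q (bad_exit_event 1 L (- 1, 0)))" by simp
      also have "\<dots> \<le> (SUP y\<in>{y. fst y < 0}. ereal (measure Q (bad_exit_event 1 L y)))"
        by (rule SUP_upper) simp
      finally show "ereal 0 \<le> ?g L" by (simp add: zero_ereal_def[symmetric])
    qed
    show "eventually (\<lambda>L. ?g L \<le> ereal (L powr M * b L)) at_top"
      using eventually_ge_at_top[of 1]
    proof eventually_elim
      case (elim L)
      have "(SUP y\<in>{y. fst y < 0}. ereal (measure Q (bad_exit_event 1 L y))) \<le> ereal (b L)"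
        using bound[OF elim] by (intro SUP_least) simp
      then have "?g L \<le> ereal (L powr M) * ereal (b L)"
        by (intro ereal_mult_left_mono) auto
      then show ?case by simp
    qed
  qed
  then have "Limsup at_top ?g = ereal 0"
    by (intro lim_imp_Limsup) (simp_all add: trivial_limit_at_top_linorder)
  then show ?thesis
    unfolding polynomial_condition_def esssup_cond_exp_bad_exit by (simp add: zero_ereal_def)
qed

end

section \<open>Moments of the layers\<close>

text \<open>The tangent of the concave power at 1. It gives both E \<rho>^s \<le> 1 below \<kappa>
  and E \<rho> \<ge> 1.\<close>

lemma powr_le_affine:
  fixes x a :: real
  assumes x: "0 < x" and a: "0 \<le> a" "a \<le> 1"
  shows "x powr a \<le> a * x + (1 - a)"
proof -
  define l where "l = ln x"
  \<comment> \<open>Tangent lines of exp with weights a and 1 - a: their linear parts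
    cancel.\<close>
  have "1 = a * (1 + (1 - a) * l) + (1 - a) * (1 + - a * l)" by (simp add: algebra_simps)
  also have "\<dots> \<le> a * exp ((1 - a) * l) + (1 - a) * exp (- a * l)"
    using a exp_ge_add_one_self[of "(1 - a) * l"] exp_ge_add_one_self[of "- a * l"]
    by (intro add_mono mult_left_mono) auto
  finally have "x powr a * 1 \<le> x powr a * (a * exp ((1 - a) * l) + (1 - a) * exp (- a * l))"
    by (intro mult_left_mono) auto
  also have "\<dots> = a * (exp (a * l) * exp ((1 - a) * l)) + (1 - a) * (exp (a * l) * exp (- a * l))"
    using x by (simp add: powr_def l_def algebra_simps)
  also have "exp (a * l) * exp ((1 - a) * l) = x"
    using x by (simp add: exp_add[symmetric] l_def algebra_simps)
  also have "exp (a * l) * exp (- a * l) = 1"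
    by (simp add: exp_add[symmetric])
  finally show ?thesis by simp
qed

theorem theorem2p1:
  fixes \<Omega> :: "'a measure" and p \<rho> :: "'a \<Rightarrow> real" and P :: "int \<Rightarrow> 'a \<Rightarrow> real"
    and \<kappa> :: real and Q1 :: "(env \<times> path) measure"
  assumes "prob_space \<Omega>"
    and "p \<in> borel_measurable \<Omega>"
    and "\<And>\<xi>. \<xi> \<in> space \<Omega> \<Longrightarrow> 0 < p \<xi> \<and> p \<xi> < 1"
    and "\<rho> = (\<lambda>\<xi>. (1 - p \<xi>) / p \<xi>)"
    and "1 / 2 < \<kappa>" "\<kappa> < 1"
    and "(\<integral>\<xi>. \<rho> \<xi> powr \<kappa> \<partial>\<Omega>) = 1"
    and "integrable \<Omega> (\<lambda>\<xi>. \<rho> \<xi> powr \<kappa> * max 0 (ln (\<rho> \<xi>)))"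
    and "\<And>\<kappa>'. 1 / 2 < \<kappa>' \<Longrightarrow> \<kappa>' < 1 \<Longrightarrow> (\<integral>\<xi>. \<rho> \<xi> powr \<kappa>' \<partial>\<Omega>) = 1 \<Longrightarrow>
           integrable \<Omega> (\<lambda>\<xi>. \<rho> \<xi> powr \<kappa>' * max 0 (ln (\<rho> \<xi>))) \<Longrightarrow> \<kappa>' = \<kappa>"
    and "prob_space.indep_vars \<Omega> (\<lambda>_. borel) P UNIV"
    and "\<And>i. distr \<Omega> borel (P i) = distr \<Omega> borel p"
    and "Q1 = annealed_law (distr \<Omega> env_space (\<lambda>\<xi>. layered_env (\<lambda>i. P i \<xi>)))"
  shows "(AE (\<omega>, X) in Q1. filterlim (\<lambda>n. fst (X n)) at_top sequentially) \<and>
    (AE (\<omega>, X) in Q1. (\<lambda>n. (1 / real n) *\<^sub>R to_plane (X n)) \<longlonglongrightarrow> 0) \<and>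
    (\<forall>\<epsilon>>0. (\<lambda>n. measure Q1 {(\<omega>, X) \<in> space Q1.
        norm ((1 / norm (to_plane (X n))) *\<^sub>R to_plane (X n) - (1, 0)) > \<epsilon>}) \<longlonglongrightarrow> 0) \<and>
    (\<forall>\<epsilon>. 0 < \<epsilon> \<and> \<epsilon> < \<kappa> - 1 / 2 \<longrightarrow> polynomial_condition Q1 (\<kappa> - 1 / 2 - \<epsilon>) 1)"
proof -
  interpret prob_space \<Omega> by fact
  note [measurable] = \<open>p \<in> borel_measurable \<Omega>\<close>
  have p01: "0 < p \<xi>" "p \<xi> < 1" if "\<xi> \<in> space \<Omega>" for \<xi>
    using assms(3)[OF that] by auto
  have \<rho>_eq: "\<rho> \<xi> = (1 - p \<xi>) / p \<xi>" for \<xi> using \<open>\<rho> = _\<close> by simp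
  have [measurable]: "\<rho> \<in> borel_measurable \<Omega>" unfolding \<open>\<rho> = _\<close> by measurable
  have \<rho>_pos: "0 < \<rho> \<xi>" if "\<xi> \<in> space \<Omega>" for \<xi>
    using p01[OF that] by (simp add: \<rho>_eq)
  have P_meas [measurable]: "P i \<in> borel_measurable \<Omega>" for i
    using assms(10) unfolding indep_vars_def by auto
  have transfer: "(\<integral>\<^sup>+\<xi>. f (P i \<xi>) \<partial>\<Omega>) = (\<integral>\<^sup>+\<xi>. f (p \<xi>) \<partial>\<Omega>)" if "f \<in> borel_measurable borel" for f i
    using nn_integral_distr[OF P_meas[of i], of f] nn_integral_distr[of p \<Omega> borel f] that assms(11)[of i] by simp
  have "AE \<xi> in \<Omega>. 0 < P i \<xi> \<and> P i \<xi> < 1" for i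
  proof -
    have "AE x in distr \<Omega> borel p. 0 < x \<and> x < 1"
      by (subst AE_distr_iff) (auto intro!: AE_I2 p01)
    then have "AE x in distr \<Omega> borel (P i). 0 < x \<and> x < 1" unfolding assms(11) .
    then show ?thesis by (subst (asm) AE_distr_iff) auto
  qed
  then have layers: "iid_layers \<Omega> P"
    using assms(10,11) by unfold_locales (auto simp: AE_all_countable)

  \<comment> \<open>A nonintegrable function has Bochner integral 0, so the value 1 forces
    integrability.\<close>
  have int_\<kappa>: "integrable \<Omega> (\<lambda>\<xi>. \<rho> \<xi> powr \<kappa>)"
    using assms(7) not_integrable_integral_eq by fastforce
  have nn_\<kappa>: "(\<integral>\<^sup>+\<xi>. ennreal (\<rho> \<xi> powr \<kappa>) \<partial>\<Omega>) = 1"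
    using nn_integral_eq_integral[OF int_\<kappa>] assms(7) by simp
  \<comment> \<open>Concavity of the power s / \<kappa>, applied to \<rho> powr \<kappa>, bounds the
    moment by 1; uniqueness of \<kappa> excludes equality.\<close>
  have contracting: "\<exists>r. contracting_layers \<Omega> P s r" if s: "1 / 2 < s" "s < \<kappa>" for s
  proof -
    have le: "\<rho> \<xi> powr s \<le> s / \<kappa> * \<rho> \<xi> powr \<kappa> + (1 - s / \<kappa>)" if "\<xi> \<in> space \<Omega>" for \<xi>
      using powr_le_affine[of "\<rho> \<xi> powr \<kappa>" "s / \<kappa>"] s assms(5) \<rho>_pos[OF that] by (simp add: powr_powr)
    have int_s: "integrable \<Omega> (\<lambda>\<xi>. \<rho> \<xi> powr s)"
      by (rule Bochner_Integration.integrable_bound[where f = "\<lambda>\<xi>. s / \<kappa> * \<rho> \<xi> powr \<kappa> + (1 - s / \<kappa>)"])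
         (use int_\<kappa> s assms(5) in \<open>auto intro!: AE_I2 order_trans[OF le]\<close>)
    have "expectation (\<lambda>\<xi>. \<rho> \<xi> powr s) \<le> expectation (\<lambda>\<xi>. s / \<kappa> * \<rho> \<xi> powr \<kappa> + (1 - s / \<kappa>))"
      using int_s int_\<kappa> le by (intro integral_mono) auto
    also have "\<dots> = 1" using int_\<kappa> assms(7) by (simp add: prob_space)
    finally have le1: "expectation (\<lambda>\<xi>. \<rho> \<xi> powr s) \<le> 1" .
    have "expectation (\<lambda>\<xi>. \<rho> \<xi> powr s) \<noteq> 1"
    proof
      assume one: "expectation (\<lambda>\<xi>. \<rho> \<xi> powr s) = 1"
      \<comment> \<open>The logarithmic moment at s, needed to invoke uniqueness: the positive part
        of the logarithm vanishes below 1, and above 1 the power with exponent \<kappa>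
        dominates.\<close>
      have "integrable \<Omega> (\<lambda>\<xi>. \<rho> \<xi> powr s * max 0 (ln (\<rho> \<xi>)))"
      proof (rule Bochner_Integration.integrable_bound[OF assms(8)])
        show "AE \<xi> in \<Omega>. norm (\<rho> \<xi> powr s * max 0 (ln (\<rho> \<xi>))) \<le> norm (\<rho> \<xi> powr \<kappa> * max 0 (ln (\<rho> \<xi>)))"
        proof (rule AE_I2)
          fix \<xi> assume "\<xi> \<in> space \<Omega>"
          then have pos: "0 < \<rho> \<xi>" by (rule \<rho>_pos)
          show "norm (\<rho> \<xi> powr s * max 0 (ln (\<rho> \<xi>))) \<le> norm (\<rho> \<xi> powr \<kappa> * max 0 (ln (\<rho> \<xi>)))"
          proof (cases "1 \<le> \<rho> \<xi>")
            case True
            then have "\<rho> \<xi> powr s \<le> \<rho> \<xi> powr \<kappa>" using s by (intro powr_mono) auto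
            then show ?thesis by (simp add: abs_mult mult_right_mono)
          next
            case False
            then have "max 0 (ln (\<rho> \<xi>)) = 0" using pos by simp
            then show ?thesis by simp
          qed
        qed
      qed measurable
      from assms(9)[OF s(1) _ one this] s assms(6) show False by simp
    qed
    with le1 have lt1: "expectation (\<lambda>\<xi>. \<rho> \<xi> powr s) < 1" by simp
    have "(\<integral>\<^sup>+\<xi>. ennreal (rho (\<lambda>i. P i \<xi>) 0 powr s) \<partial>\<Omega>) = (\<integral>\<^sup>+\<xi>. ennreal (\<rho> \<xi> powr s) \<partial>\<Omega>)"
      unfolding rho_def \<rho>_eq by (rule transfer[of "\<lambda>x. ennreal (((1 - x) / x) powr s)"]) measurable
    also have "\<dots> = ennreal (expectation (\<lambda>\<xi>. \<rho> \<xi> powr s))"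
      using int_s by (intro nn_integral_eq_integral) auto
    finally have moment: "(\<integral>\<^sup>+\<xi>. ennreal (rho (\<lambda>i. P i \<xi>) 0 powr s) \<partial>\<Omega>) = ennreal (expectation (\<lambda>\<xi>. \<rho> \<xi> powr s))" .
    have "contracting_layers \<Omega> P s (expectation (\<lambda>\<xi>. \<rho> \<xi> powr s))"
      using s assms(6) lt1 moment
      by (intro contracting_layers.intro layers contracting_layers_axioms.intro) auto
    then show ?thesis ..
  qed

  \<comment> \<open>If E \<rho> < 1, the tangent bound would give E \<rho>^\<kappa> \<le> \<kappa> E
    \<rho> + 1 - \<kappa> < 1.\<close>
  have mean: "1 \<le> (\<integral>\<^sup>+\<xi>. ennreal (rho (\<lambda>i. P i \<xi>) 0) \<partial>\<Omega>)"
  proof (rule ccontr)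
    assume "\<not> 1 \<le> (\<integral>\<^sup>+\<xi>. ennreal (rho (\<lambda>i. P i \<xi>) 0) \<partial>\<Omega>)"
    also have "(\<integral>\<^sup>+\<xi>. ennreal (rho (\<lambda>i. P i \<xi>) 0) \<partial>\<Omega>) = (\<integral>\<^sup>+\<xi>. ennreal (\<rho> \<xi>) \<partial>\<Omega>)"
      unfolding rho_def \<rho>_eq by (rule transfer[of "\<lambda>x. ennreal ((1 - x) / x)"]) measurable
    finally obtain e where e: "(\<integral>\<^sup>+\<xi>. ennreal (\<rho> \<xi>) \<partial>\<Omega>) = ennreal e" "0 \<le> e" "e < 1"
      by (cases "\<integral>\<^sup>+\<xi>. ennreal (\<rho> \<xi>) \<partial>\<Omega>") (auto simp: not_le ennreal_less_one_iff)
    have "1 \<le> (\<integral>\<^sup>+\<xi>. (ennreal \<kappa> * ennreal (\<rho> \<xi>) + ennreal (1 - \<kappa>)) \<partial>\<Omega>)"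
      unfolding nn_\<kappa>[symmetric]
    proof (rule nn_integral_mono)
      fix \<xi> assume "\<xi> \<in> space \<Omega>"
      then have pos: "0 < \<rho> \<xi>" by (rule \<rho>_pos)
      then have "\<rho> \<xi> powr \<kappa> \<le> \<kappa> * \<rho> \<xi> + (1 - \<kappa>)"
        using assms(5,6) by (intro powr_le_affine) auto
      then have "ennreal (\<rho> \<xi> powr \<kappa>) \<le> ennreal (\<kappa> * \<rho> \<xi> + (1 - \<kappa>))" by (rule ennreal_leI)
      also have "\<dots> = ennreal \<kappa> * ennreal (\<rho> \<xi>) + ennreal (1 - \<kappa>)"
        using pos assms(5,6) by (simp add: ennreal_mult)
      finally show "ennreal (\<rho> \<xi> powr \<kappa>) \<le> ennreal \<kappa> * ennreal (\<rho> \<xi>) + ennreal (1 - \<kappa>)" .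
    qed
    also have "\<dots> = ennreal \<kappa> * ennreal e + ennreal (1 - \<kappa>)"
      by (subst nn_integral_add) (simp_all add: nn_integral_cmult e emeasure_space_1)
    also have "\<dots> = ennreal (\<kappa> * e + (1 - \<kappa>))"
      using e assms(5,6) by (simp add: ennreal_mult)
    finally have "1 \<le> \<kappa> * e + (1 - \<kappa>)" by (simp add: ennreal_le_iff2 flip: ennreal_1)
    moreover have "\<kappa> * e < \<kappa>" using e assms(5) by simp
    ultimately show False by linarith
  qed

  have Q1: "Q1 = iid_layers.Q \<Omega> P"
    unfolding assms(12) iid_layers.Q_def[OF layers] ..
  \<comment> \<open>The midpoint of 1/2 and \<kappa> serves as an exponent strictly between
    them.\<close>
  obtain r where "contracting_layers \<Omega> P ((1 / 2 + \<kappa>) / 2) r"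
    using contracting[of "(1 / 2 + \<kappa>) / 2"] assms(5) by auto
  then interpret half: contracting_layers \<Omega> P "(1 / 2 + \<kappa>) / 2" r .
  have "polynomial_condition Q1 (\<kappa> - 1 / 2 - \<epsilon>) 1" if \<epsilon>: "0 < \<epsilon>" "\<epsilon> < \<kappa> - 1 / 2" for \<epsilon>
  proof -
    obtain r' where "contracting_layers \<Omega> P (\<kappa> - \<epsilon> / 4) r'"
      using contracting[of "\<kappa> - \<epsilon> / 4"] \<epsilon> by auto
    then interpret near: contracting_layers \<Omega> P "\<kappa> - \<epsilon> / 4" r' .
    \<comment> \<open>This negative product is, up to sign, the surplus in M + 1 < (2 - \<delta>) s
      at s = \<kappa>. Lowering s by \<epsilon> / 4 costs less than the \<epsilon> gained in
      M.\<close>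
    have "(\<kappa> - 1) * (\<kappa> - 1 / 2) < 0" using assms(5,6) by (intro mult_neg_pos) auto
    moreover have "(2 - (\<kappa> - 1 / 2)) * (\<kappa> - \<epsilon> / 4)
        = \<kappa> - 1 / 2 - \<epsilon> + 1 - (\<kappa> - 1) * (\<kappa> - 1 / 2) + 3 / 8 * \<epsilon> + \<epsilon> * \<kappa> / 4"
      by (simp add: field_simps)
    moreover have "0 < \<epsilon> * \<kappa>" using \<epsilon> assms(5) by simp
    ultimately have "\<kappa> - 1 / 2 - \<epsilon> + 1 < (2 - (\<kappa> - 1 / 2)) * (\<kappa> - \<epsilon> / 4)"
      using \<epsilon> by linarith
    then show ?thesis
      unfolding Q1 using \<epsilon> assms(6)
      by (intro near.polynomial_condition_Q[where \<delta> = "\<kappa> - 1 / 2"]) auto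
  qed
  moreover have "(\<lambda>n. measure Q1 {(\<omega>, X) \<in> space Q1.
        norm ((1 / norm (to_plane (X n))) *\<^sub>R to_plane (X n) - (1, 0)) > \<epsilon>}) \<longlonglongrightarrow> 0" if "0 < \<epsilon>" for \<epsilon>
    unfolding Q1 by (rule half.direction_in_probability) (use assms(5) that in auto)
  ultimately show ?thesis
    using half.transient_right half.zero_speed[OF mean] unfolding Q1 by blast
qed

end
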